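(* Assume $r\ne0$ and let $\alpha\in k$ with $\alpha\notin-\mathbb N-\mathbb N\cdot2r$. Then the matrix $$\left(\frac{R_\lambda(-\rho_\alpha-\nu)}{R_\lambda(-\rho_\alpha)}\right)_{\lambda,\nu\in\Lambda}$$ is symmetric.
   Context: Let $k$ be a field of characteristic zero, $n\ge 1$, $\mathcal P=k[z_1,\dots,z_n]$, and let $W\subseteq S_n$ be the group of permutations $\pi$ with $\pi(i)\equiv i \bmod 2$ for all $i$, acting by permuting variables. $\mathbb N$ contains $0$. $\Lambda$ is the set of integer tuples $\lambda=(\lambda_1\ge\dots\ge\lambda_n\ge 0)$ and $|\lambda|_{\rm odd}=\sum_{i\text{ odd}}\lambda_i$. Fix $r\in k$ which is not a negative rational number and put $\rho=((n-1)r,(n-2)r,\dots,r,0)$. For $\lambda\in\Lambda$ let $[\lambda]_m=\lambda_m-\lambda_{m+1}+\dots+(-1)^{n-m}\lambda_n$. $R_\lambda(z)=R_\lambda(z;r)\in\mathcal P^W$ is the unique $W$-invariant polynomial of degree $|\lambda|_{\rm odd}$ which satisfies $R_\lambda(\rho+\mu)=0$ for all $\mu\in\Lambda$ with $|\mu|_{\rm odd}\le|\lambda|_{\rm odd}$, $\mu\ne\lambda$, and in which the monomial $z^{[\lambda]}$ has coefficient $1$ (it is known that this exists and is unique). For $\alpha\in k$ put $\rho_\alpha=\rho+(\alpha,\dots,\alpha)$. Under the stated assumptions on $r,\alpha$ one has $R_\lambda(-\rho_\alpha)\ne0$ for all $\lambda\in\Lambda$. *)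

theory Defs
  imports Complex_Main "HOL-Library.Poly_Mapping" "HOL-Combinatorics.Permutations"
begin

(* A monomial is its exponent function; a polynomial maps monomials to coefficients.
   The monoid-algebra product of Poly_Mapping is the product of polynomials. *)
type_synonym 'a mpolynomial = "(nat \<Rightarrow>\<^sub>0 nat) \<Rightarrow>\<^sub>0 'a"

(* k[z_1, ..., z_n] *)
definition poly_ring :: "nat \<Rightarrow> ('a::zero) mpolynomial set" where
  "poly_ring n = {p. \<forall>m\<in>Poly_Mapping.keys p. Poly_Mapping.keys m \<subseteq> {1..n}}"

definition eval_poly :: "(nat \<Rightarrow> 'a::comm_ring_1) \<Rightarrow> 'a mpolynomial \<Rightarrow> 'a" where
  "eval_poly x p = (\<Sum>m\<in>Poly_Mapping.keys p.
     Poly_Mapping.lookup p m *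
       (\<Prod>i\<in>Poly_Mapping.keys m. x i ^ Poly_Mapping.lookup m i))"

(* The zero polynomial gets degree 0. *)
definition total_degree :: "('a::zero) mpolynomial \<Rightarrow> nat" where
  "total_degree p =
     Max (insert 0 ((\<lambda>m. \<Sum>i\<in>Poly_Mapping.keys m. Poly_Mapping.lookup m i) ` Poly_Mapping.keys p))"

definition parity_perms :: "nat \<Rightarrow> (nat \<Rightarrow> nat) set" where
  "parity_perms n = {\<pi>. \<pi> permutes {1..n} \<and> (\<forall>i\<in>{1..n}. \<pi> i mod 2 = i mod 2)}"

(* For bijective \<pi> this is the ring automorphism z_i \<mapsto> z_{\<pi> i}: it sends the monomial m to
   m \<circ> inv \<pi>, so the coefficient of m in the image of p is that of m \<circ> \<pi> in p. *)
definition permute_vars :: "(nat \<Rightarrow> nat) \<Rightarrow> ('a::zero) mpolynomial \<Rightarrow> 'a mpolynomial" where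
  "permute_vars \<pi> p = Poly_Mapping.map_key (Poly_Mapping.map_key \<pi>) p"

definition W_invariant :: "nat \<Rightarrow> ('a::zero) mpolynomial \<Rightarrow> bool" where
  "W_invariant n p \<longleftrightarrow> (\<forall>\<pi>\<in>parity_perms n. permute_vars \<pi> p = p)"

(* Tuples are functions on {1..n}, extended by 0 so that each tuple has one representative. *)
definition Lam :: "nat \<Rightarrow> (nat \<Rightarrow> nat) set" where
  "Lam n = {l. (\<forall>i j. 1 \<le> i \<and> i \<le> j \<and> j \<le> n \<longrightarrow> l j \<le> l i) \<and> (\<forall>i. i \<notin> {1..n} \<longrightarrow> l i = 0)}"

definition odd_size :: "nat \<Rightarrow> (nat \<Rightarrow> nat) \<Rightarrow> nat" where
  "odd_size n l = (\<Sum>i | i \<in> {1..n} \<and> odd i. l i)"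

definition alt_tail :: "nat \<Rightarrow> (nat \<Rightarrow> nat) \<Rightarrow> nat \<Rightarrow> int" where
  "alt_tail n l m = (\<Sum>j=m..n. (-1) ^ (j - m) * int (l j))"

lemma alt_tail_step: "m \<le> n \<Longrightarrow> alt_tail n l m = int (l m) - alt_tail n l (Suc m)"
proof -
  assume "m \<le> n"
  then have "alt_tail n l m = int (l m) + (\<Sum>j=Suc m..n. (-1) ^ (j - m) * int (l j))"
    by (simp add: alt_tail_def sum.atLeast_Suc_atMost)
  also have "(\<Sum>j=Suc m..n. (-1) ^ (j - m) * int (l j)) = - alt_tail n l (Suc m)"
    unfolding alt_tail_def sum_negf[symmetric]
    by (rule sum.cong) (auto simp: Suc_diff_Suc[symmetric] Suc_le_eq)
  finally show ?thesis by simp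
qed

lemma alt_tail_bounds:
  assumes "l \<in> Lam n" "1 \<le> m" "m \<le> Suc n"
  shows "0 \<le> alt_tail n l m \<and> alt_tail n l m \<le> int (l m)"
  using assms(3,2)
proof (induction m rule: inc_induct)
  case base
  then show ?case by (simp add: alt_tail_def)
next
  case (step m)
  then have "l (Suc m) \<le> l m"
    using assms(1) by (cases "Suc m \<le> n") (auto simp: Lam_def)
  with step show ?case by (simp add: alt_tail_step)
qed

(* The exponent of the leading monomial; no truncation happens in nat, by alt_tail_bounds. *)
definition bracket :: "nat \<Rightarrow> (nat \<Rightarrow> nat) \<Rightarrow> (nat \<Rightarrow>\<^sub>0 nat)" where
  "bracket n l = Abs_poly_mapping (\<lambda>m. if m \<in> {1..n} then nat (alt_tail n l m) else 0)"

lemma lookup_bracket: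
  "Poly_Mapping.lookup (bracket n l) m = (if m \<in> {1..n} then nat (alt_tail n l m) else 0)"
proof -
  have "finite {m. (if m \<in> {1..n} then nat (alt_tail n l m) else 0) \<noteq> 0}"
    by (rule finite_subset[of _ "{1..n}"]) auto
  then show ?thesis by (simp add: bracket_def Abs_poly_mapping_inverse)
qed

(* Points of k^n are functions of which only the values on {1..n} matter. *)
definition rho :: "nat \<Rightarrow> 'a::field_char_0 \<Rightarrow> nat \<Rightarrow> 'a" where
  "rho n r i = of_nat (n - i) * r"

definition rho_shift :: "nat \<Rightarrow> 'a::field_char_0 \<Rightarrow> 'a \<Rightarrow> nat \<Rightarrow> 'a" where
  "rho_shift n r \<alpha> i = rho n r i + \<alpha>"

definition is_R :: "nat \<Rightarrow> 'a::field_char_0 \<Rightarrow> (nat \<Rightarrow> nat) \<Rightarrow> 'a mpolynomial \<Rightarrow> bool" where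
  "is_R n r l p \<longleftrightarrow>
     p \<in> poly_ring n \<and> W_invariant n p \<and> total_degree p = odd_size n l \<and>
     (\<forall>\<mu>\<in>Lam n. odd_size n \<mu> \<le> odd_size n l \<and> \<mu> \<noteq> l \<longrightarrow> eval_poly (\<lambda>i. rho n r i + of_nat (\<mu> i)) p = 0) \<and>
     Poly_Mapping.lookup p (bracket n l) = 1"

(* Meaningful for l in Lam n and r not a negative rational, where existence and uniqueness hold. *)
definition R_poly :: "nat \<Rightarrow> 'a::field_char_0 \<Rightarrow> (nat \<Rightarrow> nat) \<Rightarrow> 'a mpolynomial" where
  "R_poly n r l = (THE p. is_R n r l p)"

end

theory Submission
  imports Defs "HOL-Computational_Algebra.Polynomial"
begin

text \<open>
  Let \<open>Rt l\<close> be \<open>R l\<close> normalized by \<open>Rt l (\<rho> + l) = 1\<close>. An invariant polynomial of degree at most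
  \<open>d\<close> is determined by its values at the points \<open>\<rho> + \<mu>\<close> with \<open>\<bar>\<mu>\<bar> \<le> d\<close>. By this
  uniqueness the operator \<open>L p z = (\<Sum>S. f S z * p (z - 1 S))\<close>, with the explicit rational
  functions \<open>f S\<close> of \<open>step_coef\<close> and \<open>1 S\<close> the indicator of \<open>S\<close>, satisfies
  \<open>L (Rt l) = (h - \<bar>l\<bar>) * Rt l\<close>, where \<open>h\<close> is linear with \<open>h (\<rho> + \<mu>) = \<bar>\<mu>\<bar>\<close>. The function
  \<open>(h - \<bar>l\<bar>) * Rt l\<close> is in turn a combination of the \<open>Rt \<mu>\<close> with \<open>\<bar>\<mu>\<bar> = \<bar>l\<bar> + 1\<close>.

  The \<open>f S\<close> vanish for the steps leaving the lattice, both on \<open>\<rho> + \<Lambda>\<close> and on \<open>- \<rho>\<^sub>\<alpha> - \<Lambda>\<close>. An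
  explicit product \<open>w\<close> (\<open>weight\<close>) satisfies \<open>w (\<nu> + 1 S) * f S (\<rho> + \<nu> + 1 S) = w \<nu> * f S (- \<rho>\<^sub>\<alpha> - \<nu>)\<close>, so
  \<open>L\<close> is self-adjoint for the bilinear form \<open>V (Rt l) (Rt \<nu>) = w \<nu> * Rt l (- \<rho>\<^sub>\<alpha> - \<nu>)\<close>. The
  multiplication by an invariant \<open>q\<close> is \<open>exp (- ad L)\<close> applied to the diagonal operator
  \<open>Rt l \<mapsto> q (\<rho> + l) * Rt l\<close>. For \<open>q' z = q (- z - \<alpha>)\<close> the adjoint of the multiplication by \<open>q'\<close>
  is visibly the diagonal operator of \<open>q\<close>; hence the adjoint of the diagonal operator of \<open>q'\<close> is
  the multiplication by \<open>q\<close>. Taking \<open>q = Rt \<kappa>\<close> and evaluating \<open>V (Rt l) (q * 1)\<close> gives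
  \<open>w \<kappa> * Rt l (- \<rho>\<^sub>\<alpha> - \<kappa>) = w 0 * Rt \<kappa> (- \<rho>\<^sub>\<alpha> - l) * Rt l (- \<rho>\<^sub>\<alpha>)\<close>. The case \<open>l = 0\<close>
  evaluates \<open>Rt \<kappa> (- \<rho>\<^sub>\<alpha>)\<close>, which is nonzero because \<open>w\<close> is, and the symmetry follows.
\<close>

section \<open>Polynomials as functions\<close>

text \<open>The exponential formula is commutativity in disguise. In the basis \<open>Rt\<close>,
  multiplication by \<open>h\<close> is E + A, where E is diagonal with the sizes as entries and A,
  the matrix of L, raises the size by one. Multiplication M by an invariant q commutes with it, so
  [E, M] = [M, A], and the component of M raising the size by m satisfies m M_m = [M_(m-1), A]. M_0
  is diagonal because q * \<open>Rt l\<close> vanishes at the other lattice points of size at most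
  that of l. Hence A alone governs all products, and its self-adjointness suffices.

  The \<open>f S\<close> are shaped by the boundary of the lattice: the factors x a - x b - r and x
  a vanish at steps that would leave it. The denominators x a - x b for equal parity bring the
  degree down to one, the degree of \<open>h\<close>. The price is poles at coinciding coordinates,
  so identities are checked off the poles and extended by cancelling Vandermonde products; r
  \<noteq> 0 keeps the lattice points themselves off the poles.\<close>

definition mono_deg :: "(nat \<Rightarrow>\<^sub>0 nat) \<Rightarrow> nat" where
  "mono_deg m = (\<Sum>i\<in>Poly_Mapping.keys m. Poly_Mapping.lookup m i)"

definition eval_mono :: "(nat \<Rightarrow> 'a::comm_ring_1) \<Rightarrow> (nat \<Rightarrow>\<^sub>0 nat) \<Rightarrow> 'a" where
  "eval_mono x m = (\<Prod>i\<in>Poly_Mapping.keys m. x i ^ Poly_Mapping.lookup m i)"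

lemma mono_deg_superset:
  assumes "finite A" "Poly_Mapping.keys m \<subseteq> A"
  shows "mono_deg m = (\<Sum>i\<in>A. Poly_Mapping.lookup m i)"
  unfolding mono_deg_def
  by (rule sum.mono_neutral_left) (use assms in \<open>auto simp: in_keys_iff\<close>)

lemma eval_mono_superset:
  assumes "finite A" "Poly_Mapping.keys m \<subseteq> A"
  shows "eval_mono x m = (\<Prod>i\<in>A. x i ^ Poly_Mapping.lookup m i)"
  unfolding eval_mono_def
  by (rule prod.mono_neutral_left) (use assms in \<open>auto simp: in_keys_iff\<close>)

lemma keys_add_nat: "Poly_Mapping.keys (m + m' :: nat \<Rightarrow>\<^sub>0 nat) = Poly_Mapping.keys m \<union> Poly_Mapping.keys m'"
  by (auto simp: in_keys_iff lookup_add)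

lemma mono_deg_add: "mono_deg (m + m') = mono_deg m + mono_deg m'"
proof -
  let ?A = "Poly_Mapping.keys m \<union> Poly_Mapping.keys m'"
  have "mono_deg k = (\<Sum>i\<in>?A. Poly_Mapping.lookup k i)" if "k \<in> {m, m', m + m'}" for k
    using that by (intro mono_deg_superset) (auto simp: keys_add_nat)
  then show ?thesis by (simp add: lookup_add sum.distrib)
qed

lemma eval_mono_add: "eval_mono x (m + m') = eval_mono x m * eval_mono x m'"
proof -
  let ?A = "Poly_Mapping.keys m \<union> Poly_Mapping.keys m'"
  have "eval_mono x k = (\<Prod>i\<in>?A. x i ^ Poly_Mapping.lookup k i)" if "k \<in> {m, m', m + m'}" for k
    using that by (intro eval_mono_superset) (auto simp: keys_add_nat)
  then show ?thesis by (simp add: lookup_add power_add prod.distrib)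
qed

lemma mono_deg_single [simp]: "mono_deg (Poly_Mapping.single i k) = k"
  by (simp add: mono_deg_def)

lemma eval_mono_single [simp]: "eval_mono x (Poly_Mapping.single i k) = x i ^ k"
  by (simp add: eval_mono_def)

lemma eval_mono_0 [simp]: "eval_mono x 0 = 1"
  by (simp add: eval_mono_def)

lemma mono_deg_0 [simp]: "mono_deg 0 = 0"
  by (simp add: mono_deg_def)

lemma eval_poly_superset:
  assumes "finite A" "Poly_Mapping.keys p \<subseteq> A"
  shows "eval_poly x p = (\<Sum>m\<in>A. Poly_Mapping.lookup p m * eval_mono x m)"
  unfolding eval_poly_def eval_mono_def
  by (rule sum.mono_neutral_left) (use assms in \<open>auto simp: in_keys_iff\<close>)

lemma eval_poly_0 [simp]: "eval_poly x 0 = 0"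
  by (simp add: eval_poly_def)

lemma eval_poly_single [simp]: "eval_poly x (Poly_Mapping.single m c) = c * eval_mono x m"
  by (cases "c = 0") (auto simp: eval_poly_def eval_mono_def)

lemma eval_poly_add: "eval_poly x (p + q) = eval_poly x p + eval_poly x q"
proof -
  let ?A = "Poly_Mapping.keys p \<union> Poly_Mapping.keys q"
  have "eval_poly x k = (\<Sum>m\<in>?A. Poly_Mapping.lookup k m * eval_mono x m)" if "k \<in> {p, q, p + q}" for k
    using that Poly_Mapping.keys_add[of p q] by (intro eval_poly_superset) auto
  then show ?thesis by (simp add: lookup_add sum.distrib distrib_right)
qed

lemma eval_poly_sum: "eval_poly x (\<Sum>i\<in>I. f i) = (\<Sum>i\<in>I. eval_poly x (f i))"
  by (induction I rule: infinite_finite_induct) (auto simp: eval_poly_add)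

lemma poly_mapping_sum_single:
  "p = (\<Sum>m\<in>Poly_Mapping.keys p. Poly_Mapping.single m (Poly_Mapping.lookup p m))"
  by (rule poly_mapping_eqI)
    (auto simp: lookup_sum lookup_single when_def in_keys_iff sum.delta')

lemma eval_poly_mult: "eval_poly x (p * q) = eval_poly x p * eval_poly x q"
proof -
  have "p * q = (\<Sum>m\<in>Poly_Mapping.keys p. \<Sum>m'\<in>Poly_Mapping.keys q.
      Poly_Mapping.single (m + m') (Poly_Mapping.lookup p m * Poly_Mapping.lookup q m'))"
    by (subst poly_mapping_sum_single[of p], subst poly_mapping_sum_single[of q])
      (simp add: sum_product mult_single)
  then have "eval_poly x (p * q) = (\<Sum>m\<in>Poly_Mapping.keys p. \<Sum>m'\<in>Poly_Mapping.keys q.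
      (Poly_Mapping.lookup p m * eval_mono x m) * (Poly_Mapping.lookup q m' * eval_mono x m'))"
    by (simp add: eval_poly_sum eval_mono_add mult_ac)
  then show ?thesis
    by (simp add: eval_poly_def eval_mono_def sum_product)
qed

lemma digits_unique:
  fixes B :: nat and a b :: "nat \<Rightarrow> nat"
  assumes "(\<Sum>i<N. a i * B ^ i) = (\<Sum>i<N. b i * B ^ i)" "\<And>i. i < N \<Longrightarrow> a i < B" "\<And>i. i < N \<Longrightarrow> b i < B"
  shows "\<forall>i<N. a i = b i"
  using assms
proof (induction N arbitrary: a b)
  case (Suc N)
  have *: "(\<Sum>i<Suc N. c i * B ^ i) = c 0 + B * (\<Sum>i<N. c (Suc i) * B ^ i)" for c :: "nat \<Rightarrow> nat"
    by (subst sum.lessThan_Suc_shift) (simp add: sum_distrib_left mult_ac)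
  have eq: "a 0 + B * (\<Sum>i<N. a (Suc i) * B ^ i) = b 0 + B * (\<Sum>i<N. b (Suc i) * B ^ i)"
    using Suc.prems(1) unfolding * .
  have lt: "a 0 < B" "b 0 < B" using Suc.prems by auto
  have "a 0 = b 0"
    using arg_cong[OF eq, of "\<lambda>t. t mod B"] lt by simp
  moreover from this eq lt have "(\<Sum>i<N. a (Suc i) * B ^ i) = (\<Sum>i<N. b (Suc i) * B ^ i)"
    by auto
  then have "\<forall>i<N. a (Suc i) = b (Suc i)"
    using Suc.prems by (intro Suc.IH) auto
  ultimately show ?case
    by (metis less_Suc_eq_0_disj)
qed simp

text \<open>Kronecker's substitution \<open>x i = t ^ B ^ i\<close> separates the monomials of \<open>p\<close>.\<close>

lemma eval_poly_eq_0_imp: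
  fixes p :: "'a::field_char_0 mpolynomial"
  assumes "\<And>x. eval_poly x p = 0"
  shows "p = 0"
proof (rule ccontr)
  assume "p \<noteq> 0"
  then obtain m0 where m0: "m0 \<in> Poly_Mapping.keys p"
    by (metis Poly_Mapping.lookup_zero in_keys_iff poly_mapping_eqI)
  \<comment> \<open>\<open>K\<close> and \<open>E\<close> collect the variables and exponents that
    occur. The inserted 0 keeps \<open>Max\<close> meaningful on an empty set, and \<open>B\<close>
    exceeds every digit.\<close>
  define K where "K = (\<Union>m\<in>Poly_Mapping.keys p. Poly_Mapping.keys m)"
  define N where "N = Suc (Max (insert 0 K))"
  define E where "E = (\<Union>m\<in>Poly_Mapping.keys p. Poly_Mapping.lookup m ` K)"
  define B where "B = Suc (Max (insert 0 E))"
  define code where "code m = (\<Sum>i<N. Poly_Mapping.lookup m i * B ^ i)" for m :: "nat \<Rightarrow>\<^sub>0 nat"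
  have fin: "finite K" "finite E" by (auto simp: K_def E_def)
  have N: "i < N" if "m \<in> Poly_Mapping.keys p" "i \<in> Poly_Mapping.keys m" for m i
    using that fin by (auto simp: N_def K_def less_Suc_eq_le intro!: Max_ge)
  have B: "Poly_Mapping.lookup m i < B" if "m \<in> Poly_Mapping.keys p" for m i
  proof (cases "i \<in> Poly_Mapping.keys m")
    case True
    then have "Poly_Mapping.lookup m i \<in> E" using that by (auto simp: E_def K_def)
    then show ?thesis using fin by (auto simp: B_def less_Suc_eq_le intro!: Max_ge)
  qed (simp add: in_keys_iff B_def)
  have inj: "m = m0" if m: "m \<in> Poly_Mapping.keys p" and "code m = code m0" for m
  proof (rule poly_mapping_eqI)
    fix i
    have "\<forall>i<N. Poly_Mapping.lookup m i = Poly_Mapping.lookup m0 i"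
      using that m0 B unfolding code_def by (intro digits_unique) auto
    then show "Poly_Mapping.lookup m i = Poly_Mapping.lookup m0 i"
      using N[OF m, of i] N[OF m0, of i]
      by (metis not_in_keys_iff_lookup_eq_zero)
  qed
  define q where "q = (\<Sum>m\<in>Poly_Mapping.keys p. Polynomial.monom (Poly_Mapping.lookup p m) (code m))"
  have "poly q t = eval_poly (\<lambda>i. t ^ (B ^ i)) p" for t
  proof -
    have "eval_mono (\<lambda>i. t ^ (B ^ i)) m = t ^ code m" if "m \<in> Poly_Mapping.keys p" for m
      using N[OF that] unfolding code_def
      by (subst eval_mono_superset[of "{..<N}"])
        (auto simp: power_sum power_mult[symmetric] mult.commute)
    then show ?thesis
      by (simp add: q_def poly_sum poly_monom eval_poly_def flip: eval_mono_def)
  qed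
  with assms have "q = 0" by (simp flip: poly_all_0_iff_0)
  moreover have "coeff q (code m0) = (\<Sum>m\<in>Poly_Mapping.keys p. if m = m0 then Poly_Mapping.lookup p m else 0)"
    unfolding q_def coeff_sum by (intro sum.cong) (auto dest: inj)
  ultimately show False
    using m0 by (simp add: in_keys_iff)
qed

lemma eval_poly_minus: "eval_poly x (- p) = - eval_poly x p"
  using eval_poly_add[of x p "- p"] by (simp add: eq_neg_iff_add_eq_0 add.commute)

lemma eval_poly_inject:
  fixes p q :: "'a::field_char_0 mpolynomial"
  assumes "\<And>x. eval_poly x p = eval_poly x q"
  shows "p = q"
proof -
  have "p - q = 0"
    using assms eval_poly_add[of _ p "- q"] by (intro eval_poly_eq_0_imp) (simp add: eval_poly_minus)
  then show ?thesis by simp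
qed

text \<open>The degree bound is an integer: a negative bound forces the zero polynomial, so that
  dividing by a linear factor always lowers the bound by one.\<close>

inductive polyfun :: "nat \<Rightarrow> int \<Rightarrow> ((nat \<Rightarrow> 'a::field_char_0) \<Rightarrow> 'a) \<Rightarrow> bool" for n where
  zero: "polyfun n d (\<lambda>x. 0)"
| const: "0 \<le> d \<Longrightarrow> polyfun n d (\<lambda>x. c)"
| add: "polyfun n d F \<Longrightarrow> polyfun n d G \<Longrightarrow> polyfun n d (\<lambda>x. F x + G x)"
| var: "i \<in> {1..n} \<Longrightarrow> polyfun n d F \<Longrightarrow> polyfun n (d + 1) (\<lambda>x. x i * F x)"
| mono: "polyfun n d F \<Longrightarrow> d \<le> e \<Longrightarrow> polyfun n e F"

lemma polyfun_neg: "polyfun n d F \<Longrightarrow> d < 0 \<Longrightarrow> F x = 0"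
  by (induction arbitrary: x rule: polyfun.induct) auto

lemma polyfun_local:
  assumes "polyfun n d F" "\<And>i. i \<in> {1..n} \<Longrightarrow> x i = y i"
  shows "F x = F y"
  using assms by (induction rule: polyfun.induct) auto

lemma polyfun_mult:
  assumes "polyfun n d F" "polyfun n e G"
  shows "polyfun n (d + e) (\<lambda>x. F x * G x)"
  using assms(1)
proof (induction rule: polyfun.induct)
  case (const d c)
  have "polyfun n e (\<lambda>x. c * G x)"
    using assms(2)
  proof (induction rule: polyfun.induct)
    case (add d F G) then show ?case by (simp add: distrib_left polyfun.add)
  next
    case (var i d F) then show ?case
      using polyfun.var[OF var(1,3)] by (simp add: mult.left_commute)
  qed (auto intro: polyfun.intros)
  then show ?case using const by (elim polyfun.mono) auto
next
  case (add d F G') then show ?case by (simp add: distrib_right polyfun.add)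
next
  case (var i d F) then show ?case
    using polyfun.var[OF var(1,3)] by (simp add: mult.assoc add_ac)
next
  case (mono d F d') then show ?case by (elim polyfun.mono) auto
qed (auto intro: polyfun.intros)

lemma polyfun_cmult: "polyfun n d F \<Longrightarrow> polyfun n d (\<lambda>x. c * F x)"
  using polyfun_mult[OF polyfun.const[of 0], of n d F c] by simp

lemma polyfun_uminus: "polyfun n d F \<Longrightarrow> polyfun n d (\<lambda>x. - F x)"
  using polyfun_cmult[of n d F "-1"] by simp

lemma polyfun_diff: "polyfun n d F \<Longrightarrow> polyfun n d G \<Longrightarrow> polyfun n d (\<lambda>x. F x - G x)"
  using polyfun.add[OF _ polyfun_uminus, of n d F G] by simp

lemma polyfun_var: "i \<in> {1..n} \<Longrightarrow> polyfun n 1 (\<lambda>x. x i)"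
  using polyfun.var[of i n 0 "\<lambda>_. 1"] polyfun.const[of 0 n 1] by simp

lemma polyfun_upd:
  "i \<in> {1..n} \<Longrightarrow> polyfun n 1 c \<Longrightarrow> polyfun n 1 (\<lambda>x. (x(j := c x)) i)"
  by (cases "i = j") (auto intro: polyfun_var)

lemma polyfun_sum: "(\<And>i. i \<in> I \<Longrightarrow> polyfun n d (F i)) \<Longrightarrow> polyfun n d (\<lambda>x. \<Sum>i\<in>I. F i x)"
  by (induction I rule: infinite_finite_induct) (auto intro: polyfun.intros)

lemma polyfun_prod:
  "(\<And>i. i \<in> I \<Longrightarrow> polyfun n (d i) (F i)) \<Longrightarrow> polyfun n (\<Sum>i\<in>I. d i) (\<lambda>x. \<Prod>i\<in>I. F i x)"
  by (induction I rule: infinite_finite_induct) (auto intro: polyfun.intros polyfun_mult)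

lemma polyfun_subst:
  assumes "polyfun n d F" "\<And>i. i \<in> {1..n} \<Longrightarrow> polyfun m 1 (\<lambda>x. \<sigma> x i)"
  shows "polyfun m d (\<lambda>x. F (\<sigma> x))"
  using assms(1)
proof (induction rule: polyfun.induct)
  case (var i d F)
  then show ?case using polyfun_mult[OF assms(2)[OF var(1)] var(3)] by (simp add: add.commute)
qed (auto intro: polyfun.intros)

text \<open>Translation preserves the top-degree part. On x i * F the difference is x i times the
  difference of F plus s i times a translate of F, both one degree below the product.\<close>

lemma polyfun_translate_diff:
  assumes "polyfun n d F"
  shows "polyfun n (d - 1) (\<lambda>x. F x - F (\<lambda>i. x i - s i))"
  using assms
proof (induction rule: polyfun.induct)
  case (add d F G)
  then show ?case using polyfun.add[OF add(3,4)] by (simp add: algebra_simps)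
next
  case (var i d F)
  have tr: "polyfun n d (\<lambda>x. F (\<lambda>i. x i - s i))"
    using var(2) by (rule polyfun_subst) (auto intro!: polyfun_diff polyfun_var polyfun.const)
  show ?case
    using polyfun.add[OF polyfun.var[OF var(1,3), simplified] polyfun_cmult[OF tr, of "s i"]]
    by (simp add: algebra_simps)
next
  case (mono d F e)
  then show ?case by (elim polyfun.mono) auto
qed (auto intro: polyfun.intros)

lemma polyfun_rep:
  assumes "polyfun n d F"
  obtains p where "p \<in> poly_ring n" "\<And>x. F x = eval_poly x p"
    "\<And>m. m \<in> Poly_Mapping.keys p \<Longrightarrow> int (mono_deg m) \<le> d"
proof -
  have "\<exists>p\<in>poly_ring n. (\<forall>x. F x = eval_poly x p) \<and> (\<forall>m\<in>Poly_Mapping.keys p. int (mono_deg m) \<le> d)"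
    using assms
  proof (induction rule: polyfun.induct)
    case (zero d)
    show ?case by (rule bexI[of _ 0]) (auto simp: poly_ring_def)
  next
    case (const d c)
    then show ?case by (intro bexI[of _ "Poly_Mapping.single 0 c"]) (auto simp: poly_ring_def split: if_splits)
  next
    case (add d F G)
    then obtain p q where "p \<in> poly_ring n" "\<forall>x. F x = eval_poly x p" "\<forall>m\<in>Poly_Mapping.keys p. int (mono_deg m) \<le> d"
      "q \<in> poly_ring n" "\<forall>x. G x = eval_poly x q" "\<forall>m\<in>Poly_Mapping.keys q. int (mono_deg m) \<le> d" by blast
    moreover have "m \<in> Poly_Mapping.keys p \<or> m \<in> Poly_Mapping.keys q" if "m \<in> Poly_Mapping.keys (p + q)" for m
      using that Poly_Mapping.keys_add[of p q] by blast
    ultimately show ?case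
      unfolding poly_ring_def by (intro bexI[of _ "p + q"]) (simp_all add: eval_poly_add, blast+)
  next
    case (var i d F)
    then obtain p where p: "p \<in> poly_ring n" "\<forall>x. F x = eval_poly x p" "\<forall>m\<in>Poly_Mapping.keys p. int (mono_deg m) \<le> d"
      by blast
    let ?X = "Poly_Mapping.single (Poly_Mapping.single i 1) 1 :: 'a mpolynomial"
    have ex: "\<exists>m'\<in>Poly_Mapping.keys p. m = Poly_Mapping.single i 1 + m'" if "m \<in> Poly_Mapping.keys (?X * p)" for m
      using that Poly_Mapping.keys_mult[of ?X p] by auto
    have "Poly_Mapping.keys m \<subseteq> {1..n} \<and> int (mono_deg m) \<le> d + 1" if m: "m \<in> Poly_Mapping.keys (?X * p)" for m
    proof -
      obtain m' where "m' \<in> Poly_Mapping.keys p" "m = Poly_Mapping.single i 1 + m'" using ex[OF m] by blast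
      then show ?thesis using p(1,3) var(1) by (auto simp: poly_ring_def mono_deg_add keys_add_nat)
    qed
    moreover have "x i * F x = eval_poly x (?X * p)" for x
      using p(2) by (simp add: eval_poly_mult)
    ultimately show ?case unfolding poly_ring_def by blast
  next
    case (mono d F e)
    then show ?case by (meson order.trans)
  qed
  then show ?thesis using that by blast
qed

lemma polyfun_eval_poly:
  assumes "p \<in> poly_ring n" "\<And>m. m \<in> Poly_Mapping.keys p \<Longrightarrow> int (mono_deg m) \<le> d"
  shows "polyfun n d (\<lambda>x. eval_poly x p)"
proof -
  have "polyfun n d (\<lambda>x. \<Sum>m\<in>Poly_Mapping.keys p. Poly_Mapping.lookup p m * (\<Prod>i\<in>Poly_Mapping.keys m. x i ^ Poly_Mapping.lookup m i))"
  proof (intro polyfun_sum polyfun_cmult)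
    fix m assume m: "m \<in> Poly_Mapping.keys p"
    have pow: "polyfun n (int k) (\<lambda>x. x i ^ k)" if "i \<in> {1..n}" for i k
      using polyfun_prod[of "{..<k}" n "\<lambda>_. 1" "\<lambda>_ x. x i"] polyfun_var[OF that] by simp
    have "polyfun n (\<Sum>i\<in>Poly_Mapping.keys m. int (Poly_Mapping.lookup m i)) (\<lambda>x. \<Prod>i\<in>Poly_Mapping.keys m. x i ^ Poly_Mapping.lookup m i)"
      using assms(1) m unfolding poly_ring_def by (intro polyfun_prod pow) blast
    then show "polyfun n d (\<lambda>x. \<Prod>i\<in>Poly_Mapping.keys m. x i ^ Poly_Mapping.lookup m i)"
      by (rule polyfun.mono) (use assms(2)[OF m] in \<open>simp add: mono_deg_def\<close>)
  qed
  then show ?thesis by (simp add: eval_poly_def)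
qed

text \<open>The polynomial ring is an integral domain, so a factor that is nonzero somewhere cancels
  everywhere, even at points where it vanishes.\<close>

lemma polyfun_mult_eq_0:
  assumes "polyfun n d F" "polyfun n e G" "\<And>x. F x * G x = 0" "F y \<noteq> 0"
  shows "G x = 0"
proof -
  obtain p where p: "\<And>x. F x = eval_poly x p" using polyfun_rep[OF assms(1)] by metis
  obtain q where q: "\<And>x. G x = eval_poly x q" using polyfun_rep[OF assms(2)] by metis
  have "p * q = 0"
    by (rule eval_poly_eq_0_imp) (use assms(3) p q in \<open>simp add: eval_poly_mult\<close>)
  moreover have "p \<noteq> 0" using assms(4) p by auto
  ultimately show ?thesis using q by simp
qed

text \<open>Division with remainder by a linear form, the remainder being the restriction to its
  hyperplane. The quotient for x i * F is F x + c x * G x, where G is the quotient for F.\<close>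

lemma polyfun_divide:
  assumes "polyfun n d F" "i \<in> {1..n}" "polyfun n 1 c"
  obtains G where "polyfun n (d - 1) G" "\<And>x. F x - F (x(i := c x)) = (x i - c x) * G x"
proof -
  have "\<exists>G. polyfun n (d - 1) G \<and> (\<forall>x. F x - F (x(i := c x)) = (x i - c x) * G x)"
    using assms(1)
  proof (induction rule: polyfun.induct)
    case (add d F F')
    then obtain G G' where "polyfun n (d - 1) G" "\<forall>x. F x - F (x(i := c x)) = (x i - c x) * G x"
      "polyfun n (d - 1) G'" "\<forall>x. F' x - F' (x(i := c x)) = (x i - c x) * G' x" by blast
    then show ?case
      by (intro exI[of _ "\<lambda>x. G x + G' x"])
        (simp add: polyfun.add distrib_left add_diff_add del: fun_upd_apply)
  next
    case (var j d F)
    then obtain G where G: "polyfun n (d - 1) G" "\<And>x. F x - F (x(i := c x)) = (x i - c x) * G x" by blast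
    show ?case
    proof (cases "j = i")
      case True
      have "polyfun n d (\<lambda>x. F x + c x * G x)"
        using polyfun_mult[OF assms(3) G(1)] var(2) by (auto intro: polyfun.add)
      moreover have "x i * F x - c x * F (x(i := c x)) = (x i - c x) * (F x + c x * G x)" for x
      proof -
        have "x i * F x - c x * F (x(i := c x)) = (x i - c x) * F x + c x * (F x - F (x(i := c x)))"
          by (simp add: algebra_simps)
        then show ?thesis unfolding G(2) by (simp add: algebra_simps)
      qed
      ultimately show ?thesis using True by (intro exI[of _ "\<lambda>x. F x + c x * G x"]) (simp_all only: fun_upd_same add_diff_cancel_right' simp_thms)
    next
      case False
      have "x j * F x - (x(i := c x)) j * F (x(i := c x)) = (x i - c x) * (x j * G x)" for x
        unfolding fun_upd_other[OF False] using G(2)[of x] by (metis mult.left_commute right_diff_distrib)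
      moreover have "polyfun n (d + 1 - 1) (\<lambda>x. x j * G x)"
        using polyfun.var[OF var(1) G(1)] by simp
      ultimately show ?thesis by blast
    qed
  next
    case (mono d F e)
    then show ?case using polyfun.mono[of n "d - 1" _ "e - 1"] by fastforce
  qed (auto intro!: exI[of _ "\<lambda>_. 0"] polyfun.zero)
  then show ?thesis using that by blast
qed

text \<open>The hyperplanes are divided out one at a time. The quotient by the factor of u still
  vanishes on the hyperplane of t: by the last assumption that factor is not identically zero there,
  so it cancels after composing with the projection \<open>?s\<close> onto this hyperplane.\<close>

lemma polyfun_divide_prod:
  fixes a :: "'t \<Rightarrow> nat" and c :: "'t \<Rightarrow> (nat \<Rightarrow> 'a::field_char_0) \<Rightarrow> 'a"
  assumes "finite T" "polyfun n d F"
    and "\<And>t. t \<in> T \<Longrightarrow> a t \<in> {1..n}" "\<And>t. t \<in> T \<Longrightarrow> polyfun n 1 (c t)"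
    and "\<And>t x y. t \<in> T \<Longrightarrow> c t (x(a t := y)) = c t x"
    and "\<And>t x. t \<in> T \<Longrightarrow> x (a t) = c t x \<Longrightarrow> F x = 0"
    and "\<And>t u. t \<in> T \<Longrightarrow> u \<in> T \<Longrightarrow> t \<noteq> u \<Longrightarrow> \<exists>x. x (a t) = c t x \<and> x (a u) \<noteq> c u x"
  obtains G where "polyfun n (d - int (card T)) G" "\<And>x. F x = (\<Prod>t\<in>T. x (a t) - c t x) * G x"
proof -
  have "\<exists>G. polyfun n (d - int (card T)) G \<and> (\<forall>x. F x = (\<Prod>t\<in>T. x (a t) - c t x) * G x)"
    using assms
  proof (induction T arbitrary: d F rule: finite_induct)
    case empty
    then show ?case by auto
  next
    case (insert u T)
    obtain G where G: "polyfun n (d - 1) G" "\<And>x. F x - F (x(a u := c u x)) = (x (a u) - c u x) * G x"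
      using polyfun_divide[OF insert.prems(1), of "a u" "c u"] insert.prems(2,3) by blast
    have "F (x(a u := c u x)) = 0" for x
      by (rule insert.prems(5)[of u]) (use insert.prems(4)[of u] in auto)
    then have FG: "F x = (x (a u) - c u x) * G x" for x using G(2)[of x] by simp
    have G0: "G x = 0" if t: "t \<in> T" and x: "x (a t) = c t x" for t x
    proof -
      let ?s = "\<lambda>x. x(a t := c t x)"
      have s: "polyfun n 1 (\<lambda>x. ?s x i)" if "i \<in> {1..n}" for i
        using that insert.prems(3)[of t] t by (intro polyfun_upd) auto
      have lu: "polyfun n 1 (\<lambda>x. x (a u) - c u x)"
        using insert.prems(2,3) by (intro polyfun_diff polyfun_var) auto
      have "F (?s x) = 0" for x
        by (rule insert.prems(5)[of t]) (use t insert.prems(4)[of t] in auto)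
      then have z: "(?s x (a u) - c u (?s x)) * G (?s x) = 0" for x
        using FG[of "?s x"] by simp
      from insert.prems(6)[of t u] t insert.hyps obtain y where
        y: "y (a t) = c t y" "y (a u) \<noteq> c u y" by fastforce
      then have "?s y = y" by auto
      with y have y': "?s y (a u) - c u (?s y) \<noteq> 0" by simp
      have "G (?s x) = 0"
        using polyfun_mult_eq_0[OF polyfun_subst[OF lu s] polyfun_subst[OF G(1) s] z y'] by blast
      moreover have "?s x = x" using x by auto
      ultimately show ?thesis by simp
    qed
    have "\<exists>H. polyfun n (d - 1 - int (card T)) H \<and> (\<forall>x. G x = (\<Prod>t\<in>T. x (a t) - c t x) * H x)"
      using G(1) insert.prems(2-4,6) G0 by (intro insert.IH) auto
    then obtain H where H: "polyfun n (d - 1 - int (card T)) H" "\<And>x. G x = (\<Prod>t\<in>T. x (a t) - c t x) * H x"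
      by blast
    then show ?case using insert.hyps FG
      by (intro exI[of _ H]) (auto simp: algebra_simps)
  qed
  then show ?thesis using that by blast
qed

section \<open>Coefficients of polynomial functions\<close>

definition coef :: "((nat \<Rightarrow> 'a::field_char_0) \<Rightarrow> 'a) \<Rightarrow> (nat \<Rightarrow>\<^sub>0 nat) \<Rightarrow> 'a" where
  "coef F = Poly_Mapping.lookup (THE p. \<forall>x. F x = eval_poly x p)"

lemma coef_eval_poly:
  assumes "\<And>x. F x = eval_poly x p"
  shows "coef F = Poly_Mapping.lookup p"
proof -
  have "(THE p. \<forall>x. F x = eval_poly x p) = p"
    using assms by (intro the_equality) (auto intro: eval_poly_inject)
  then show ?thesis by (simp add: coef_def)
qed

lemma lookup_single_times:
  "Poly_Mapping.lookup (Poly_Mapping.single k c * p) (k + m :: nat \<Rightarrow>\<^sub>0 nat) = c * Poly_Mapping.lookup p m"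
proof -
  have "Poly_Mapping.single k c * p
      = (\<Sum>m\<in>Poly_Mapping.keys p. Poly_Mapping.single (k + m) (c * Poly_Mapping.lookup p m))"
    by (subst poly_mapping_sum_single[of p]) (simp add: sum_distrib_left mult_single)
  then show ?thesis
    by (auto simp: lookup_sum lookup_single when_def in_keys_iff sum.delta')
qed

lemma coef_const: "coef (\<lambda>x. c) m = (if m = 0 then c else 0)"
  by (subst coef_eval_poly[of _ "Poly_Mapping.single 0 c"]) (auto simp: lookup_single)

lemma coef_add:
  assumes "polyfun n d F" "polyfun n e G"
  shows "coef (\<lambda>x. F x + G x) m = coef F m + coef G m"
proof -
  obtain p where p: "\<And>x. F x = eval_poly x p" using polyfun_rep[OF assms(1)] by metis
  obtain q where q: "\<And>x. G x = eval_poly x q" using polyfun_rep[OF assms(2)] by metis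
  have "coef (\<lambda>x. F x + G x) = Poly_Mapping.lookup (p + q)"
    by (rule coef_eval_poly) (simp add: p q eval_poly_add)
  then show ?thesis by (simp add: lookup_add coef_eval_poly[OF p] coef_eval_poly[OF q])
qed

lemma coef_cmult:
  assumes "polyfun n d F"
  shows "coef (\<lambda>x. c * F x) m = c * coef F m"
proof -
  obtain p where p: "\<And>x. F x = eval_poly x p" using polyfun_rep[OF assms(1)] by metis
  have "coef (\<lambda>x. c * F x) = Poly_Mapping.lookup (Poly_Mapping.single 0 c * p)"
    by (rule coef_eval_poly) (simp add: p eval_poly_mult)
  then show ?thesis using lookup_single_times[of 0 c p m] by (simp add: coef_eval_poly[OF p])
qed

lemma coef_var:
  assumes "polyfun n d F"
  shows "coef (\<lambda>x. x i * F x) (Poly_Mapping.single i 1 + m) = coef F m"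
    and "Poly_Mapping.lookup m i = 0 \<Longrightarrow> coef (\<lambda>x. x i * F x) m = 0"
proof -
  obtain p where p: "\<And>x. F x = eval_poly x p" using polyfun_rep[OF assms(1)] by metis
  let ?X = "Poly_Mapping.single (Poly_Mapping.single i 1) 1 * p"
  have *: "coef (\<lambda>x. x i * F x) = Poly_Mapping.lookup ?X"
    by (rule coef_eval_poly) (simp add: p eval_poly_mult)
  then show "coef (\<lambda>x. x i * F x) (Poly_Mapping.single i 1 + m) = coef F m"
    by (simp add: lookup_single_times coef_eval_poly[OF p])
  assume m: "Poly_Mapping.lookup m i = 0"
  have "m \<notin> Poly_Mapping.keys ?X"
  proof
    assume "m \<in> Poly_Mapping.keys ?X"
    then obtain m' where "m = Poly_Mapping.single i 1 + m'"
      using Poly_Mapping.keys_mult[of "Poly_Mapping.single (Poly_Mapping.single i 1) 1" p] by auto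
    with m show False by (simp add: lookup_add)
  qed
  then show "coef (\<lambda>x. x i * F x) m = 0" by (simp add: * in_keys_iff)
qed

lemma coef_beyond_degree:
  assumes "polyfun n d F" "d < int (mono_deg m)"
  shows "coef F m = 0"
proof -
  obtain p where p: "\<And>x. F x = eval_poly x p" "\<And>m. m \<in> Poly_Mapping.keys p \<Longrightarrow> int (mono_deg m) \<le> d"
    using polyfun_rep[OF assms(1)] by metis
  then show ?thesis using assms(2) by (metis coef_eval_poly[OF p(1)] in_keys_iff linorder_not_le)
qed

text \<open>Only the leading term of each factor reaches a monomial of this degree; the contribution
  of the constant - s has too low a degree.\<close>

lemma coef_prod_linear:
  assumes "finite I" "I \<subseteq> {1..n}" "polyfun n d F" "d \<le> int (mono_deg m)"
  shows "coef (\<lambda>x. (\<Prod>i\<in>I. x i - s) * F x) ((\<Sum>i\<in>I. Poly_Mapping.single i 1) + m) = coef F m"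
  using assms(1,2)
proof (induction I rule: finite_induct)
  case (insert i I)
  let ?F = "\<lambda>x. (\<Prod>i\<in>I. x i - s) * F x" and ?m = "(\<Sum>i\<in>I. Poly_Mapping.single i 1) + m"
  have "polyfun n (\<Sum>i\<in>I. 1) (\<lambda>x. \<Prod>i\<in>I. x i - s)"
    using insert.prems by (intro polyfun_prod polyfun_diff polyfun_var polyfun.const) auto
  then have F: "polyfun n (int (card I) + d) ?F"
    using polyfun_mult[OF _ assms(3)] by fastforce
  have "finite I \<Longrightarrow> mono_deg (\<Sum>i\<in>I. Poly_Mapping.single i 1) = card I"
    by (induction I rule: finite_induct) (auto simp: mono_deg_add)
  then have deg: "mono_deg ?m = card I + mono_deg m" using insert.hyps by (simp add: mono_deg_add)
  have "coef (\<lambda>x. x i * ?F x + - s * ?F x) (Poly_Mapping.single i 1 + ?m)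
      = coef ?F ?m + - s * coef ?F (Poly_Mapping.single i 1 + ?m)"
    using insert.prems
    by (subst coef_add[OF polyfun.var[OF _ F] polyfun_cmult[OF F]])
      (simp_all only: coef_var[OF F] coef_cmult[OF F] insert_subset)
  moreover have "coef ?F (Poly_Mapping.single i 1 + ?m) = 0"
    using assms(4) by (intro coef_beyond_degree[OF F]) (simp only: mono_deg_add[of "Poly_Mapping.single i 1"] deg, simp)
  ultimately have "coef (\<lambda>x. x i * ?F x + - s * ?F x) (Poly_Mapping.single i 1 + ?m) = coef F m"
    using insert by simp
  moreover have "(\<lambda>x. x i * ?F x + - s * ?F x) = (\<lambda>x. (\<Prod>i\<in>insert i I. x i - s) * F x)"
    using insert.hyps by (auto simp: algebra_simps)
  ultimately show ?case using insert.hyps by (simp add: add.assoc)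
qed simp

text \<open>Monomials containing x i drop in degree when x i becomes a constant, so they cannot
  reach a monomial of degree at least d; the others are untouched.\<close>

lemma coef_restrict:
  assumes "polyfun n d F" "i \<in> {1..n}"
  shows "d \<le> int (mono_deg m) \<Longrightarrow> Poly_Mapping.lookup m i = 0 \<Longrightarrow>
    coef (\<lambda>x. F (x(i := s))) m = coef F m"
  using assms(1)
proof (induction arbitrary: m rule: polyfun.induct)
  case (add d F G)
  have res: "polyfun n d (\<lambda>x. F (x(i := s)))" if "polyfun n d F" for F
    using that by (rule polyfun_subst) (intro polyfun_upd polyfun.const, simp_all)
  show ?case
    using add by (simp add: coef_add[OF add(1,2)] coef_add[OF res[OF add(1)] res[OF add(2)]] del: fun_upd_apply)
next
  case (var j d F)
  have res: "polyfun n d (\<lambda>x. F (x(i := s)))"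
    using var(2) by (rule polyfun_subst) (intro polyfun_upd polyfun.const, simp_all)
  show ?case
  proof (cases "j = i")
    case True
    then show ?thesis
      using var(4,5) coef_beyond_degree[OF res, of m] by (simp add: coef_cmult[OF res[unfolded fun_upd_def]] coef_var(2)[OF var(2)] fun_upd_def)
  next
    case False
    show ?thesis
    proof (cases "Poly_Mapping.lookup m j = 0")
      case True
      then show ?thesis using False coef_var(2)[OF res True] by (simp add: coef_var(2)[OF var(2)] fun_upd_def)
    next
      case m: False
      define m' where "m' = m - Poly_Mapping.single j 1"
      have m': "m = Poly_Mapping.single j 1 + m'"
        using m by (intro poly_mapping_eqI) (auto simp: m'_def lookup_add lookup_minus lookup_single when_def)
      then have "coef (\<lambda>x. F (x(i := s))) m' = coef F m'"
        using var(4,5) False by (intro var(3)) (auto simp: mono_deg_add lookup_add)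
      then show ?thesis
        using False coef_var(1)[OF res, of j m'] coef_var(1)[OF var(2), of j m'] by (simp add: m' fun_upd_def)
    qed
  qed
qed auto

section \<open>Interpolation on the shifted lattice\<close>

definition Winv :: "nat \<Rightarrow> ((nat \<Rightarrow> 'a) \<Rightarrow> 'a) \<Rightarrow> bool" where
  "Winv n F \<longleftrightarrow> (\<forall>\<pi>\<in>parity_perms n. \<forall>x. F (x \<circ> \<pi>) = F x)"

text \<open>The offset s is what the interpolation argument varies; s = 0 gives \<rho> + l, and s =
  \<alpha> gives the points whose negatives carry the symmetric matrix.\<close>

definition lat :: "nat \<Rightarrow> 'a::field_char_0 \<Rightarrow> 'a \<Rightarrow> (nat \<Rightarrow> nat) \<Rightarrow> nat \<Rightarrow> 'a" where
  "lat n r s l i = s + of_nat (n - i) * r + of_nat (l i)"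

text \<open>The orbit of the last position under W.\<close>

definition same_par :: "nat \<Rightarrow> nat set" where
  "same_par n = {i \<in> {1..n}. i mod 2 = n mod 2}"

definition add_one :: "nat \<Rightarrow> (nat \<Rightarrow> nat) \<Rightarrow> nat \<Rightarrow> nat" where
  "add_one n l i = (if i \<in> {1..n} then Suc (l i) else 0)"

section \<open>Parity classes and the exponents [l]\<close>

lemma transpose_parity_perms:
  "i \<in> {1..n} \<Longrightarrow> j \<in> {1..n} \<Longrightarrow> i mod 2 = j mod 2 \<Longrightarrow> Transposition.transpose i j \<in> parity_perms n"
  unfolding parity_perms_def mem_Collect_eq
  by (intro conjI permutes_swap_id) (auto simp: transpose_def)

lemma finite_same_par [simp]: "finite (same_par n)"
  by (simp add: same_par_def)

text \<open>The right side is the growth of \<open>odd_size\<close> under \<open>add_one\<close>,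
  the left side the degree of the product of x i - s over the orbit of n. For even n the successor
  map pairs the two classes.\<close>

lemma card_same_par: "card (same_par n) = card {i \<in> {1..n}. odd i}"
proof (cases "odd n")
  case True
  then show ?thesis by (simp add: same_par_def odd_iff_mod_2_eq_one)
next
  case False
  have "bij_betw Suc {i \<in> {1..n}. odd i} (same_par n)"
    unfolding bij_betw_def
  proof (intro conjI set_eqI iffI)
    fix i assume "i \<in> same_par n"
    then have "i = Suc (i - 1)" "i - 1 \<in> {1..n}" "odd (i - 1)"
      using False unfolding same_par_def by (auto simp: mod2_eq_if elim!: evenE split: if_splits)
    then show "i \<in> Suc ` {i \<in> {1..n}. odd i}" by blast
  next
    fix i assume "i \<in> Suc ` {i \<in> {1..n}. odd i}"
    then obtain k where k: "i = Suc k" "k \<in> {1..n}" "odd k" by blast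
    with False have "k \<noteq> n" by auto
    with k have "i \<in> {1..n}" by simp
    moreover have "i mod 2 = n mod 2" using k False by (simp add: mod2_eq_if)
    ultimately show "i \<in> same_par n" by (simp add: same_par_def)
  qed auto
  then show ?thesis by (metis bij_betw_same_card)
qed

lemma add_one_Lam: "l \<in> Lam n \<Longrightarrow> add_one n l \<in> Lam n"
  by (auto simp: Lam_def add_one_def)

lemma odd_size_add_one: "odd_size n (add_one n l) = odd_size n l + card (same_par n)"
proof -
  have "odd_size n (add_one n l) = (\<Sum>i | i \<in> {1..n} \<and> odd i. l i + 1)"
    unfolding odd_size_def by (rule sum.cong) (auto simp: add_one_def)
  then show ?thesis by (simp add: odd_size_def card_same_par sum_Suc)
qed

lemma alt_tail_add_one:
  assumes "1 \<le> m" "m \<le> Suc n"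
  shows "alt_tail n (add_one n l) m = alt_tail n l m + (if m \<le> n \<and> m mod 2 = n mod 2 then 1 else 0)"
  using assms(2,1)
proof (induction m rule: inc_induct)
  case base
  then show ?case by (simp add: alt_tail_def)
next
  case (step m)
  then have "m \<le> n" by simp
  have "Suc m mod 2 = n mod 2 \<longleftrightarrow> m mod 2 \<noteq> n mod 2" by (auto simp: mod2_eq_if)
  with \<open>m \<le> n\<close> have "m mod 2 = n mod 2 \<longleftrightarrow> \<not> (Suc m \<le> n \<and> Suc m mod 2 = n mod 2)"
    by (cases "m = n") auto
  with \<open>m \<le> n\<close> show ?case
    using step alt_tail_step[of m n l] alt_tail_step[of m n "add_one n l"]
    by (simp add: add_one_def[of n l m])
qed

lemma lookup_sum_singles:
  "finite I \<Longrightarrow> Poly_Mapping.lookup (\<Sum>i\<in>I. Poly_Mapping.single i (1::nat)) m = (if m \<in> I then 1 else 0)"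
  by (simp add: lookup_sum lookup_single when_def sum.delta)

text \<open>Multiplication by the orbit product of x i - s therefore takes the distinguished
  monomial of l to that of \<open>add_one n l\<close>.\<close>

lemma bracket_add_one:
  assumes "l \<in> Lam n"
  shows "bracket n (add_one n l) = (\<Sum>i\<in>same_par n. Poly_Mapping.single i 1) + bracket n l"
proof (rule poly_mapping_eqI)
  fix m
  show "Poly_Mapping.lookup (bracket n (add_one n l)) m
      = Poly_Mapping.lookup ((\<Sum>i\<in>same_par n. Poly_Mapping.single i 1) + bracket n l) m"
    using alt_tail_bounds[OF assms, of m] alt_tail_add_one[of m n l]
    unfolding lookup_add lookup_bracket lookup_sum_singles[OF finite_same_par]
    by (auto simp: same_par_def nat_add_distrib)
qed

lemma bracket_Suc:
  assumes "l (Suc n) = 0"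
  shows "bracket (Suc n) l = bracket n l"
proof (rule poly_mapping_eqI)
  fix m
  have "alt_tail (Suc n) l m = alt_tail n l m" if "m \<le> n"
  proof -
    have "{m..Suc n} = insert (Suc n) {m..n}" using that by auto
    then show ?thesis using assms unfolding alt_tail_def by simp
  qed
  then show "Poly_Mapping.lookup (bracket (Suc n) l) m = Poly_Mapping.lookup (bracket n l) m"
    using assms by (cases "m = Suc n") (auto simp: lookup_bracket le_Suc_eq alt_tail_def)
qed

lemma mono_deg_bracket:
  assumes "l \<in> Lam n"
  shows "mono_deg (bracket n l) = odd_size n l"
proof -
  \<comment> \<open>\<open>T k\<close> sums the parts at k, k + 2, and so on. The alternating tails
    are the differences T m - T (m + 1), so their sum telescopes to T 1, the odd size.\<close>
  define T where "T k = (\<Sum>j | j \<in> {k..n} \<and> j mod 2 = k mod 2. int (l j))" for k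
  have T: "T k = int (l k) + T (k + 2)" if "k \<le> n" for k
  proof -
    have "{j. j \<in> {k..n} \<and> j mod 2 = k mod 2} = insert k {j. j \<in> {k + 2..n} \<and> j mod 2 = (k + 2) mod 2}"
    proof (intro set_eqI)
      fix j
      have "j mod 2 = k mod 2 \<Longrightarrow> j \<noteq> Suc k" by (auto simp: mod2_eq_if split: if_splits)
      with that show "j \<in> {j. j \<in> {k..n} \<and> j mod 2 = k mod 2}
          \<longleftrightarrow> j \<in> insert k {j. j \<in> {k + 2..n} \<and> j mod 2 = (k + 2) mod 2}" by auto
    qed
    then show ?thesis by (simp add: T_def)
  qed
  have T0: "T k = 0" if "n < k" for k using that by (simp add: T_def)
  have aT: "alt_tail n l m = T m - T (Suc m)" if "m \<le> Suc n" for m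
    using that
  proof (induction m rule: inc_induct)
    case (step m)
    then show ?case using alt_tail_step[of m n l] T[of m] by simp
  qed (simp add: T0 alt_tail_def)
  have sT: "(\<Sum>j=m..n. alt_tail n l j) = T m" if "m \<le> Suc n" for m
    using that
  proof (induction m rule: inc_induct)
    case (step m)
    then have "m \<le> n" by simp
    then have "(\<Sum>j=m..n. alt_tail n l j) = alt_tail n l m + (\<Sum>j=Suc m..n. alt_tail n l j)"
      by (rule sum.atLeast_Suc_atMost)
    then show ?case using step aT[of m] by simp
  qed (simp add: T0)
  have "int (mono_deg (bracket n l)) = (\<Sum>j=1..n. int (Poly_Mapping.lookup (bracket n l) j))"
    by (subst mono_deg_superset[of "{1..n}"]) (auto simp: in_keys_iff lookup_bracket split: if_splits)
  also have "\<dots> = (\<Sum>j=1..n. alt_tail n l j)"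
    using alt_tail_bounds[OF assms] by (intro sum.cong) (auto simp: lookup_bracket)
  also have "\<dots> = T 1" by (rule sT) simp
  also have "\<dots> = int (odd_size n l)"
    unfolding T_def odd_size_def of_nat_sum by (rule sum.cong) (auto simp: odd_iff_mod_2_eq_one)
  finally show ?thesis by simp
qed

lemma Lam_Suc: "l \<in> Lam n \<Longrightarrow> l \<in> Lam (Suc n)" "l \<in> Lam (Suc n) \<Longrightarrow> l (Suc n) = 0 \<Longrightarrow> l \<in> Lam n"
  unfolding Lam_def by (auto simp: le_Suc_eq)

lemma odd_size_Suc: "l (Suc n) = 0 \<Longrightarrow> odd_size (Suc n) l = odd_size n l"
  unfolding odd_size_def
  by (rule sum.mono_neutral_right) (auto simp: le_Suc_eq)

lemma parity_perms_Suc: "\<pi> \<in> parity_perms n \<Longrightarrow> \<pi> \<in> parity_perms (Suc n) \<and> \<pi> (Suc n) = Suc n"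
  by (auto simp: parity_perms_def permutes_not_in le_Suc_eq intro: permutes_subset)

text \<open>Every use of the assumption that r is not a negative rational passes through this fact:
  with b nonzero the equation would make r equal to - b / a.\<close>

lemma lat_eq_0_iff:
  fixes r :: "'a::field_char_0"
  assumes "\<And>q::rat. q < 0 \<Longrightarrow> r \<noteq> of_rat q"
  shows "of_nat a * r + of_nat b = 0 \<Longrightarrow> b = 0"
proof (rule ccontr)
  assume eq: "of_nat a * r + of_nat b = 0" and b: "b \<noteq> 0"
  then have a: "a \<noteq> 0" by (cases "a = 0") auto
  have "r = of_rat (- (of_nat b / of_nat a))"
    using eq a by (simp add: of_rat_minus of_rat_divide field_simps eq_neg_iff_add_eq_0)
  moreover have "- (of_nat b / of_nat a) < (0::rat)" using a b by simp
  ultimately show False using assms by blast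
qed

lemma Winv_vanish_hyperplanes:
  assumes "Winv (Suc n) F" "\<And>x. x (Suc n) = s \<Longrightarrow> F x = 0" "i \<in> same_par (Suc n)" "x i = s"
  shows "F x = 0"
proof -
  let ?t = "Transposition.transpose i (Suc n)"
  have "?t \<in> parity_perms (Suc n)"
    using assms(3) by (intro transpose_parity_perms) (auto simp: same_par_def)
  then have "F x = F (x \<circ> ?t)" using assms(1) by (simp add: Winv_def)
  also have "\<dots> = 0" by (rule assms(2)) (use assms(4) in simp)
  finally show ?thesis .
qed

lemma parity_perms_range: "\<pi> \<in> parity_perms n \<Longrightarrow> \<pi> i \<in> {1..n} \<longleftrightarrow> i \<in> {1..n}"
  unfolding parity_perms_def by (blast dest: permutes_in_image)

lemma parity_perms_bij:
  assumes "\<pi> \<in> parity_perms n"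
  shows "bij_betw \<pi> {i \<in> {1..n}. i mod 2 = c} {i \<in> {1..n}. i mod 2 = c}"
proof -
  let ?A = "{i \<in> {1..n}. i mod 2 = c}"
  have inj: "inj_on \<pi> ?A"
    using assms unfolding parity_perms_def mem_Collect_eq by (metis inj_on_subset permutes_inj subset_UNIV)
  have "\<pi> ` ?A \<subseteq> ?A"
    using assms parity_perms_range[OF assms] unfolding parity_perms_def by blast
  then have "\<pi> ` ?A = ?A"
    by (intro endo_inj_surj inj) auto
  with inj show ?thesis by (simp add: bij_betw_def)
qed

lemma polyfun_parity_perm:
  assumes "polyfun n d F" "\<pi> \<in> parity_perms n"
  shows "polyfun n d (\<lambda>x. F (x \<circ> \<pi>))"
proof -
  have "polyfun n d (\<lambda>x. F (\<lambda>i. x (\<pi> i)))"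
    by (rule polyfun_subst[OF assms(1)]) (simp only: polyfun_var parity_perms_range[OF assms(2)])
  then show ?thesis by (simp add: o_def)
qed

text \<open>The orbit product is itself invariant, and it cancels because it is nonzero at the
  constant point s + 1.\<close>

lemma Winv_prod_cancel:
  assumes F: "Winv n F" "\<And>x. F x = (\<Prod>i\<in>same_par n. x i - s) * G x" and G: "polyfun n d G"
  shows "Winv n G"
  unfolding Winv_def
proof (intro ballI allI)
  fix \<pi> x assume \<pi>: "\<pi> \<in> parity_perms n"
  let ?P = "\<lambda>x. \<Prod>i\<in>same_par n. x i - s"
  have P: "polyfun n (\<Sum>i\<in>same_par n. 1) ?P"
    by (intro polyfun_prod polyfun_diff polyfun_var polyfun.const) (auto simp: same_par_def)
  have "?P (x \<circ> \<pi>) = ?P x" for x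
    using prod.reindex_bij_betw[OF parity_perms_bij[OF \<pi>], of "\<lambda>i. x i - s" "n mod 2"]
    by (simp add: same_par_def)
  moreover have "F (x \<circ> \<pi>) = F x" for x using F(1) \<pi> unfolding Winv_def by blast
  ultimately have "?P x * G (x \<circ> \<pi>) = ?P x * G x" for x
    using F(2)[of x] F(2)[of "x \<circ> \<pi>"] by auto
  then have z: "?P x * (G (x \<circ> \<pi>) - G x) = 0" for x
    by (simp add: right_diff_distrib)
  have Gd: "polyfun n d (\<lambda>x. G (x \<circ> \<pi>) - G x)"
    by (intro polyfun_diff G polyfun_parity_perm[OF G \<pi>])
  have "G (x \<circ> \<pi>) - G x = 0"
    by (rule polyfun_mult_eq_0[OF P Gd z, where y = "\<lambda>_. s + 1"]) simp
  then show "G (x \<circ> \<pi>) = G x" by simp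
qed

text \<open>The points with \<open>\<mu> n = 0\<close> fill the lattice of one
  dimension less inside the hyperplane \<open>x n = s\<close>; dividing by its orbit leads back to the same
  lattice with \<open>s\<close> replaced by \<open>s + 1\<close>.\<close>

lemma interpolation_zero:
  fixes r :: "'a::field_char_0"
  assumes r: "\<And>q::rat. q < 0 \<Longrightarrow> r \<noteq> of_rat q"
  shows "polyfun n d F \<Longrightarrow> Winv n F \<Longrightarrow>
    (\<And>\<mu>. \<mu> \<in> Lam n \<Longrightarrow> int (odd_size n \<mu>) \<le> d \<Longrightarrow>
       \<not> (\<mu> = l \<and> int (odd_size n \<mu>) = d \<and> coef F (bracket n l) = 0) \<Longrightarrow> F (lat n r s \<mu>) = 0) \<Longrightarrow>
    F x = 0"
\<comment> \<open>The excepted case of the vanishing hypothesis lets, at a single point l of full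
  size d, a vanishing coefficient of the monomial [l] stand in for a vanishing value. This is what
  fits the normalization of \<open>R_poly\<close>.\<close>
proof (induction n arbitrary: d F s l x)
  case 0
  show ?case
  proof (cases "0 \<le> d")
    case False
    then show ?thesis using polyfun_neg[OF 0(1)] by simp
  next
    case True
    define c where "c = F (lat 0 r s (\<lambda>_. 0))"
    have F: "F = (\<lambda>x. c)" using polyfun_local[OF 0(1)] by (auto simp: c_def)
    have b: "bracket 0 l = 0" by (rule poly_mapping_eqI) (simp add: lookup_bracket)
    have "c = 0"
      using 0(3)[of "\<lambda>_. 0"] True by (cases "c = 0") (auto simp: Lam_def odd_size_def F b coef_const)
    then show ?thesis by (simp add: F)
  qed
next
  case (Suc n)
  note IHn = Suc.IH
  from Suc.prems show ?case
  proof (induction "nat (d + 1)" arbitrary: d F s l x rule: less_induct)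
    case less
    note F = less.prems(1) and inv = less.prems(2) and van = less.prems(3)
    let ?n = "Suc n" and ?I = "same_par (Suc n)"
    show ?case
    proof (cases "d < 0")
      case True
      then show ?thesis using polyfun_neg[OF F] by simp
    next
      case d: False
      let ?F1 = "\<lambda>x. F (x(?n := s))"
      have F1: "polyfun n d ?F1"
      proof (rule polyfun_subst[OF F])
        show "polyfun n 1 (\<lambda>x. (x(?n := s)) i)" if "i \<in> {1..?n}" for i
          using that by (cases "i = ?n") (simp_all add: polyfun.const polyfun_var)
      qed
      have inv1: "Winv n ?F1"
        unfolding Winv_def
      proof (intro ballI allI)
        fix \<pi> x assume "\<pi> \<in> parity_perms n"
        note \<pi> = parity_perms_Suc[OF this]
        have "inj \<pi>" using \<pi> by (auto simp: parity_perms_def permutes_inj)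
        then have "(x \<circ> \<pi>)(?n := s) = x(?n := s) \<circ> \<pi>"
          using \<pi> by (auto simp: fun_eq_iff inj_eq) (metis injD)
        then show "F ((x \<circ> \<pi>)(?n := s)) = F (x(?n := s))"
          using inv \<pi> by (simp add: Winv_def)
      qed
      \<comment> \<open>With one variable fewer the entries of \<rho> are smaller by r, which the
        offset s + r restores.\<close>
      have F1_0: "?F1 x = 0" for x
      proof (rule IHn[OF F1 inv1, of l "s + r"])
        fix \<mu> assume \<mu>: "\<mu> \<in> Lam n" "int (odd_size n \<mu>) \<le> d"
          "\<not> (\<mu> = l \<and> int (odd_size n \<mu>) = d \<and> coef ?F1 (bracket n l) = 0)"
        have \<mu>0: "\<mu> ?n = 0" using \<mu>(1) by (auto simp: Lam_def)
        have "F ((lat n r (s + r) \<mu>)(?n := s)) = F (lat ?n r s \<mu>)"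
          by (rule polyfun_local[OF F])
            (use \<mu>0 in \<open>auto simp: lat_def le_Suc_eq Suc_diff_le algebra_simps\<close>)
        also have "\<dots> = 0"
        proof (rule van)
          show "\<mu> \<in> Lam ?n" using \<mu>(1) by (rule Lam_Suc)
          show "int (odd_size ?n \<mu>) \<le> d" using \<mu> odd_size_Suc[of \<mu> n, OF \<mu>0] by simp
          show "\<not> (\<mu> = l \<and> int (odd_size ?n \<mu>) = d \<and> coef F (bracket ?n l) = 0)"
          proof
            assume a: "\<mu> = l \<and> int (odd_size ?n \<mu>) = d \<and> coef F (bracket ?n l) = 0"
            then have l: "l \<in> Lam n" "l ?n = 0" using \<mu>(1) \<mu>0 by auto
            have deg: "d \<le> int (mono_deg (bracket n l))"
              using a mono_deg_bracket[OF l(1)] odd_size_Suc[of l n, OF l(2)] by auto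
            have "coef ?F1 (bracket n l) = coef F (bracket n l)"
              by (rule coef_restrict[OF F _ deg]) (auto simp: lookup_bracket)
            then show False using a \<mu>(3) bracket_Suc[of l n, OF l(2)] odd_size_Suc[of \<mu> n, OF \<mu>0] by auto
          qed
        qed
        finally show "F ((lat n r (s + r) \<mu>)(?n := s)) = 0" .
      qed
      have "F x = 0" if "x ?n = s" for x
        using F1_0[of x] that by (metis fun_upd_triv)
      then have hyp: "F x = 0" if "i \<in> ?I" "x i = s" for i x
        using Winv_vanish_hyperplanes[OF inv] that by blast
      obtain G where G: "polyfun ?n (d - int (card ?I)) G" "\<And>x. F x = (\<Prod>i\<in>?I. x i - s) * G x"
      proof (rule polyfun_divide_prod[OF finite_same_par[of ?n] F, of "\<lambda>i. i" "\<lambda>_ _. s"])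
        show "\<exists>x. x t = s \<and> x u \<noteq> s" if "t \<noteq> u" for t u
          using that by (intro exI[of _ "(\<lambda>_. s + 1)(t := s)"]) auto
      qed (use hyp in \<open>auto intro: polyfun.const simp: same_par_def\<close>)
      have card: "card ?I \<ge> 1"
        by (auto simp: Suc_le_eq card_gt_0_iff same_par_def)
      \<comment> \<open>Truncation at 0 is harmless, since \<open>l'\<close> matters only if l is
        \<open>add_one ?n\<close> of some partition.\<close>
      define l' where "l' i = l i - 1" for i
      have "G x = 0" for x
      proof (rule less.hyps[OF _ G(1) Winv_prod_cancel[OF inv G(2,1)], of l' "s + 1"])
        show "nat (d - int (card ?I) + 1) < nat (d + 1)" using card d by simp
        fix \<mu> assume \<mu>: "\<mu> \<in> Lam ?n" "int (odd_size ?n \<mu>) \<le> d - int (card ?I)"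
          "\<not> (\<mu> = l' \<and> int (odd_size ?n \<mu>) = d - int (card ?I) \<and> coef G (bracket ?n l') = 0)"
        let ?m = "add_one ?n \<mu>"
        have "F (lat ?n r s ?m) = 0"
        proof (rule van)
          show "?m \<in> Lam ?n" using \<mu>(1) by (rule add_one_Lam)
          show "int (odd_size ?n ?m) \<le> d" using \<mu>(2) by (simp add: odd_size_add_one)
          show "\<not> (?m = l \<and> int (odd_size ?n ?m) = d \<and> coef F (bracket ?n l) = 0)"
          proof
            assume a: "?m = l \<and> int (odd_size ?n ?m) = d \<and> coef F (bracket ?n l) = 0"
            then have l: "l = ?m" by simp
            have "l' = \<mu>"
              using \<mu>(1) by (auto simp: l'_def l add_one_def Lam_def)
            moreover have size: "int (odd_size ?n \<mu>) = d - int (card ?I)"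
              using a by (simp add: odd_size_add_one)
            moreover have "coef F (bracket ?n ?m) = coef G (bracket ?n \<mu>)"
            proof -
              have "F = (\<lambda>x. (\<Prod>i\<in>?I. x i - s) * G x)" using G(2) by blast
              moreover have "?I \<subseteq> {1..?n}" by (auto simp: same_par_def)
              ultimately show ?thesis
                unfolding bracket_add_one[OF \<mu>(1)]
                using coef_prod_linear[OF finite_same_par _ G(1), of ?n "bracket ?n \<mu>" s]
                by (simp add: mono_deg_bracket[OF \<mu>(1)] size)
            qed
            ultimately show False using a \<mu>(3) by metis
          qed
        qed
        moreover have "lat ?n r s ?m i - s \<noteq> 0" if "i \<in> ?I" for i
          using lat_eq_0_iff[OF r, of "?n - i" "Suc (\<mu> i)"] that
          by (auto simp: lat_def add_one_def same_par_def algebra_simps)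
        moreover have "G (lat ?n r s ?m) = G (lat ?n r (s + 1) \<mu>)"
          by (rule polyfun_local[OF G(1)]) (auto simp: lat_def add_one_def)
        ultimately show "G (lat ?n r (s + 1) \<mu>) = 0"
          using G(2)[of "lat ?n r s ?m"] by (simp add: prod_zero_iff)
      qed
      then show ?thesis using G(2) by simp
    qed
  qed
qed

section \<open>Existence and uniqueness of the interpolation polynomials\<close>

lemma homogeneous_system_nontrivial:
  fixes A :: "'k \<Rightarrow> 'i \<Rightarrow> 'a::field"
  assumes "finite K" "finite I" "card K < card I"
  shows "\<exists>c. (\<exists>i\<in>I. c i \<noteq> 0) \<and> (\<forall>k\<in>K. (\<Sum>i\<in>I. A k i * c i) = 0)"
  using assms
proof (induction K arbitrary: I A rule: finite_induct)
  case empty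
  then obtain i where "i \<in> I" by fastforce
  then show ?case by (intro exI[of _ "\<lambda>_. 1"]) auto
next
  case (insert k K)
  show ?case
  proof (cases "\<forall>i\<in>I. A k i = 0")
    case True
    moreover have "card K < card I" using insert.prems insert.hyps by simp
    ultimately obtain c where "\<exists>i\<in>I. c i \<noteq> 0" "\<forall>k\<in>K. (\<Sum>i\<in>I. A k i * c i) = 0"
      using insert.IH[of I A] insert.prems(1) by blast
    with True show ?thesis by (intro exI[of _ c]) simp
  next
    case False
    then obtain j where j: "j \<in> I" "A k j \<noteq> 0" by blast
    let ?I = "I - {j}"
    obtain c where c: "\<exists>i\<in>?I. c i \<noteq> 0"
      "\<And>k'. k' \<in> K \<Longrightarrow> (\<Sum>i\<in>?I. (A k' i - A k' j * A k i / A k j) * c i) = 0"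
    proof -
      have "finite ?I" "card K < card ?I" using insert.prems insert.hyps j by auto
      then show ?thesis
        using insert.IH[of ?I "\<lambda>k' i. A k' i - A k' j * A k i / A k j"] that by blast
    qed
    define t where "t = - (\<Sum>i\<in>?I. A k i * c i) / A k j"
    define c' where "c' = c(j := t)"
    have split: "(\<Sum>i\<in>I. A k' i * c' i) = A k' j * t + (\<Sum>i\<in>?I. A k' i * c i)" for k'
    proof -
      have "(\<Sum>i\<in>?I. A k' i * c' i) = (\<Sum>i\<in>?I. A k' i * c i)"
        by (rule sum.cong) (auto simp: c'_def)
      then show ?thesis
        using sum.remove[OF insert.prems(1) j(1), of "\<lambda>i. A k' i * c' i"] by (simp add: c'_def)
    qed
    have "(\<Sum>i\<in>I. A k' i * c' i) = 0" if "k' \<in> K" for k'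
    proof -
      have "0 = (\<Sum>i\<in>?I. A k' i * c i - A k' j / A k j * (A k i * c i))"
        unfolding c(2)[OF that, symmetric] by (rule sum.cong) (auto simp: algebra_simps)
      also have "\<dots> = (\<Sum>i\<in>?I. A k' i * c i) + A k' j * t"
        by (simp only: sum_subtractf t_def flip: sum_distrib_left) simp
      finally show ?thesis by (simp add: split add.commute)
    qed
    moreover have "(\<Sum>i\<in>I. A k i * c' i) = 0"
      using j by (simp add: split t_def)
    moreover have "\<exists>i\<in>I. c' i \<noteq> 0" using c(1) by (auto simp: c'_def)
    ultimately show ?thesis by (intro exI[of _ c']) blast
  qed
qed

text \<open>The right-hand side is adjoined as the column of a further unknown \<open>None\<close>,
  so there are more unknowns than equations. Injectivity forces \<open>c None\<close> to be nonzero
  in a nontrivial solution, and dividing by it solves the system.\<close>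

lemma injective_system_solvable:
  fixes A :: "'i \<Rightarrow> 'i \<Rightarrow> 'a::field"
  assumes "finite I"
    and inj: "\<And>c. (\<And>k. k \<in> I \<Longrightarrow> (\<Sum>i\<in>I. A k i * c i) = 0) \<Longrightarrow> \<forall>i\<in>I. c i = 0"
  shows "\<exists>c. \<forall>k\<in>I. (\<Sum>i\<in>I. A k i * c i) = v k"
proof -
  define A' where "A' k i = (case i of None \<Rightarrow> - v k | Some i \<Rightarrow> A k i)" for k i
  let ?J = "insert None (Some ` I)"
  have "card ?J = Suc (card I)"
    using assms(1) by (subst card_insert_disjoint) (auto simp: card_image)
  then obtain c where c: "\<exists>i\<in>?J. c i \<noteq> 0" "\<forall>k\<in>I. (\<Sum>i\<in>?J. A' k i * c i) = 0"
    using homogeneous_system_nontrivial[of I ?J A'] assms(1) by auto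
  have sum: "(\<Sum>i\<in>I. A k i * c (Some i)) = v k * c None" if "k \<in> I" for k
  proof -
    have "(\<Sum>i\<in>?J. A' k i * c i) = - v k * c None + (\<Sum>i\<in>I. A k i * c (Some i))"
      using assms(1) by (subst sum.insert) (auto simp: sum.reindex A'_def)
    then show ?thesis using c(2) that by simp
  qed
  have "c None \<noteq> 0"
  proof
    assume "c None = 0"
    then have "\<forall>i\<in>I. c (Some i) = 0" using sum by (intro inj) auto
    with c(1) \<open>c None = 0\<close> show False by auto
  qed
  then show ?thesis using sum
    by (intro exI[of _ "\<lambda>i. c (Some i) / c None"]) (simp flip: sum_divide_distrib)
qed

section \<open>The action of W on polynomials and its orbit sums\<close>

lemma parity_perms_inj: "\<pi> \<in> parity_perms n \<Longrightarrow> inj \<pi>"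
  by (auto simp: parity_perms_def permutes_inj)

lemma parity_perms_id: "id \<in> parity_perms n"
  by (simp add: parity_perms_def permutes_id)

lemma parity_perms_comp:
  assumes "\<pi> \<in> parity_perms n" "\<sigma> \<in> parity_perms n"
  shows "\<pi> \<circ> \<sigma> \<in> parity_perms n"
proof -
  have "(\<pi> \<circ> \<sigma>) i mod 2 = i mod 2" if "i \<in> {1..n}" for i
    using assms that parity_perms_range[OF assms(2), of i] unfolding parity_perms_def by auto
  then show ?thesis using assms by (simp add: parity_perms_def permutes_compose)
qed

lemma parity_perms_inv:
  assumes "\<pi> \<in> parity_perms n"
  shows "inv \<pi> \<in> parity_perms n"
proof -
  have p: "\<pi> permutes {1..n}" using assms by (simp add: parity_perms_def)
  have "inv \<pi> i mod 2 = i mod 2" if "i \<in> {1..n}" for i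
  proof -
    have "inv \<pi> i \<in> {1..n}" using permutes_in_image[OF permutes_inv[OF p]] that by blast
    then have "\<pi> (inv \<pi> i) mod 2 = inv \<pi> i mod 2" using assms unfolding parity_perms_def by blast
    then show ?thesis using permutes_inverses(1)[OF p] by simp
  qed
  then show ?thesis using permutes_inv[OF p] by (simp add: parity_perms_def)
qed

lemma finite_parity_perms: "finite (parity_perms n)"
  by (rule finite_subset[OF _ finite_permutations[of "{1..n}"]]) (auto simp: parity_perms_def)

lemma lookup_map_key: "inj f \<Longrightarrow> Poly_Mapping.lookup (Poly_Mapping.map_key f m) i = Poly_Mapping.lookup m (f i)"
  by (simp add: map_key.rep_eq)

lemma
  assumes "\<pi> \<in> parity_perms n"
  shows eval_mono_map_key: "eval_mono (x \<circ> \<pi>) (Poly_Mapping.map_key \<pi> m) = eval_mono x m"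
    and mono_deg_map_key: "mono_deg (Poly_Mapping.map_key \<pi> m) = mono_deg m"
    and inj_map_key: "inj (Poly_Mapping.map_key \<pi> :: (nat \<Rightarrow>\<^sub>0 nat) \<Rightarrow> _)"
proof -
  have inj: "inj \<pi>" and surj: "surj \<pi>"
    using assms by (auto simp: parity_perms_def permutes_inj permutes_surj)
  have bij: "bij_betw \<pi> (Poly_Mapping.keys (Poly_Mapping.map_key \<pi> m)) (Poly_Mapping.keys m)"
    unfolding keys_map_key[OF inj] bij_betw_def
    using inj surj by (auto simp: surj_image_vimage_eq intro: inj_on_subset)
  show "eval_mono (x \<circ> \<pi>) (Poly_Mapping.map_key \<pi> m) = eval_mono x m"
    unfolding eval_mono_def using prod.reindex_bij_betw[OF bij, of "\<lambda>i. x i ^ Poly_Mapping.lookup m i"]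
    by (simp add: lookup_map_key[OF inj])
  show "mono_deg (Poly_Mapping.map_key \<pi> m) = mono_deg m"
    unfolding mono_deg_def using sum.reindex_bij_betw[OF bij, of "\<lambda>i. Poly_Mapping.lookup m i"]
    by (simp add: lookup_map_key[OF inj])
  show "inj (Poly_Mapping.map_key \<pi> :: (nat \<Rightarrow>\<^sub>0 nat) \<Rightarrow> _)"
  proof (rule injI, rule poly_mapping_eqI)
    fix a b :: "nat \<Rightarrow>\<^sub>0 nat" and i
    assume "Poly_Mapping.map_key \<pi> a = Poly_Mapping.map_key \<pi> b"
    then have "Poly_Mapping.lookup a (\<pi> j) = Poly_Mapping.lookup b (\<pi> j)" for j
      by (metis lookup_map_key[OF inj])
    then show "Poly_Mapping.lookup a i = Poly_Mapping.lookup b i"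
      using surj by (metis surj_def)
  qed
qed

lemma eval_poly_permute_vars:
  fixes p :: "'a::field_char_0 mpolynomial"
  assumes \<pi>: "\<pi> \<in> parity_perms n"
  shows "eval_poly x (permute_vars \<pi> p) = eval_poly (x \<circ> \<pi>) p"
proof -
  let ?k = "Poly_Mapping.map_key \<pi> :: (nat \<Rightarrow>\<^sub>0 nat) \<Rightarrow> _"
  have inj: "inj ?k" by (rule inj_map_key[OF \<pi>])
  have "?k (Poly_Mapping.map_key (inv \<pi>) m) = m" for m
    using parity_perms_inj[OF \<pi>] parity_perms_inj[OF parity_perms_inv[OF \<pi>]]
    by (intro poly_mapping_eqI) (simp add: lookup_map_key)
  then have surj: "surj ?k" by (metis surj_def)
  have bij: "bij_betw ?k (Poly_Mapping.keys (permute_vars \<pi> p)) (Poly_Mapping.keys p)"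
    unfolding permute_vars_def keys_map_key[OF inj] bij_betw_def
    using inj surj by (auto simp: surj_image_vimage_eq intro: inj_on_subset)
  have "eval_poly (x \<circ> \<pi>) p = (\<Sum>m\<in>Poly_Mapping.keys p. Poly_Mapping.lookup p m * eval_mono (x \<circ> \<pi>) m)"
    by (simp add: eval_poly_def eval_mono_def)
  also have "\<dots> = (\<Sum>m\<in>Poly_Mapping.keys (permute_vars \<pi> p). Poly_Mapping.lookup p (?k m) * eval_mono (x \<circ> \<pi>) (?k m))"
    by (rule sum.reindex_bij_betw[OF bij, symmetric])
  also have "\<dots> = eval_poly x (permute_vars \<pi> p)"
    unfolding eval_mono_map_key[OF \<pi>]
    by (simp add: eval_poly_def eval_mono_def permute_vars_def lookup_map_key[OF inj])
  finally show ?thesis ..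
qed

lemma W_invariant_iff_Winv:
  fixes p :: "'a::field_char_0 mpolynomial"
  shows "W_invariant n p \<longleftrightarrow> Winv n (\<lambda>x. eval_poly x p)"
  unfolding W_invariant_def Winv_def
  by (intro ball_cong) (metis eval_poly_inject eval_poly_permute_vars)+

lemma Winv_add: "Winv n F \<Longrightarrow> Winv n G \<Longrightarrow> Winv n (\<lambda>x. F x + G x)"
  and Winv_diff: "Winv n F \<Longrightarrow> Winv n G \<Longrightarrow> Winv n (\<lambda>x. F x - G x)"
  and Winv_mult: "Winv n F \<Longrightarrow> Winv n G \<Longrightarrow> Winv n (\<lambda>x. F x * G x)"
  and Winv_const: "Winv n (\<lambda>x. c)"
  for F G :: "(nat \<Rightarrow> 'a::field_char_0) \<Rightarrow> 'a"
  by (auto simp: Winv_def)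

lemma Winv_sum: "(\<And>i. i \<in> I \<Longrightarrow> Winv n (F i)) \<Longrightarrow> Winv n (\<lambda>x. \<Sum>i\<in>I. F i x)"
  for F :: "_ \<Rightarrow> (nat \<Rightarrow> 'a::field_char_0) \<Rightarrow> 'a"
  by (auto simp: Winv_def intro: sum.cong)

lemma bracket_antitone:
  assumes "l \<in> Lam n" "1 \<le> i" "i \<le> j" "j \<le> n" "i mod 2 = j mod 2"
  shows "Poly_Mapping.lookup (bracket n l) j \<le> Poly_Mapping.lookup (bracket n l) i"
proof -
  have "i + 2 * k \<le> n \<Longrightarrow> alt_tail n l (i + 2 * k) \<le> alt_tail n l i" for k
  proof (induction k)
    case (Suc k)
    let ?m = "i + 2 * k"
    have "l (Suc ?m) \<le> l ?m" using assms(1,2) Suc.prems by (auto simp: Lam_def)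
    moreover have "alt_tail n l ?m = int (l ?m) - int (l (Suc ?m)) + alt_tail n l (Suc (Suc ?m))"
      using Suc.prems by (simp add: alt_tail_step[of ?m] alt_tail_step[of "Suc ?m"])
    ultimately show ?case using Suc by simp
  qed simp
  moreover have "j = i + 2 * ((j - i) div 2)"
    using assms(3,5) mod_eq_dvd_iff_nat[of i j 2] by simp
  ultimately have "alt_tail n l j \<le> alt_tail n l i" using assms(4) by metis
  then show ?thesis using assms by (simp add: lookup_bracket)
qed

lemma bracket_inj:
  assumes "l \<in> Lam n" "l' \<in> Lam n" "bracket n l = bracket n l'"
  shows "l = l'"
proof
  fix i
  have nat: "nat (alt_tail n l m) = nat (alt_tail n l' m)" if "m \<in> {1..n}" for m
    using arg_cong[OF assms(3), of "\<lambda>p. Poly_Mapping.lookup p m"] that by (simp add: lookup_bracket)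
  have eq: "alt_tail n l m = alt_tail n l' m" if "1 \<le> m" "m \<le> Suc n" for m
  proof (cases "m = Suc n")
    case False
    then show ?thesis
      using nat[of m] alt_tail_bounds[OF assms(1) that] alt_tail_bounds[OF assms(2) that] that
      by (metis atLeastAtMost_iff int_nat_eq le_Suc_eq)
  qed (simp add: alt_tail_def)
  show "l i = l' i"
  proof (cases "i \<in> {1..n}")
    case True
    then show ?thesis using eq[of i] eq[of "Suc i"] alt_tail_step[of i n] by simp
  next
    case False
    then show ?thesis using assms(1,2) unfolding Lam_def by auto
  qed
qed

text \<open>Pigeonhole: if e' i exceeded e i, then \<pi> would map the positions up to i in the
  class of i injectively into those strictly below i.\<close>

lemma antitone_rearrangement_le:
  fixes e e' :: "nat \<Rightarrow> nat"
  assumes \<pi>: "\<pi> \<in> parity_perms n" and i: "i \<in> {1..n}"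
    and e: "\<And>i j. 1 \<le> i \<Longrightarrow> i \<le> j \<Longrightarrow> j \<le> n \<Longrightarrow> i mod 2 = j mod 2 \<Longrightarrow> e j \<le> e i"
    and e': "\<And>i j. 1 \<le> i \<Longrightarrow> i \<le> j \<Longrightarrow> j \<le> n \<Longrightarrow> i mod 2 = j mod 2 \<Longrightarrow> e' j \<le> e' i"
    and eq: "\<And>k. e' k = e (\<pi> k)"
  shows "e' i \<le> e i"
proof (rule ccontr)
  assume "\<not> e' i \<le> e i"
  then have lt: "e i < e' i" by simp
  let ?A = "{k \<in> {1..n}. k mod 2 = i mod 2 \<and> k \<le> i}" and ?B = "{k \<in> {1..n}. k mod 2 = i mod 2 \<and> k < i}"
  have "\<pi> ` ?A \<subseteq> ?B"
  proof
    fix j assume "j \<in> \<pi> ` ?A"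
    then obtain k where k: "j = \<pi> k" "k \<in> {1..n}" "k mod 2 = i mod 2" "k \<le> i" by blast
    have j: "j \<in> {1..n}" "j mod 2 = i mod 2"
      using k \<pi> parity_perms_range[OF \<pi>, of k] by (auto simp: parity_perms_def)
    have "e i < e j" using lt e'[of k i] k i eq[of k] by simp
    then have "j < i" using e[of i j] j i by (metis atLeastAtMost_iff leD leI)
    with j show "j \<in> ?B" by blast
  qed
  moreover have "inj_on \<pi> ?A" using parity_perms_inj[OF \<pi>] by (rule inj_on_subset) simp
  ultimately have "card ?A \<le> card ?B" by (intro card_inj_on_le) auto
  moreover have "?A = insert i ?B" using i by auto
  then have "card ?A = Suc (card ?B)" by simp
  ultimately show False by simp
qed

text \<open>The exponents [l] decrease within each parity class, and a W-orbit contains only one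
  such exponent.\<close>

lemma bracket_orbit_inj:
  assumes "l \<in> Lam n" "l' \<in> Lam n" "\<pi> \<in> parity_perms n"
    and "Poly_Mapping.map_key \<pi> (bracket n l) = bracket n l'"
  shows "l = l'"
proof (rule bracket_inj[OF assms(1,2)], rule poly_mapping_eqI)
  let ?e = "Poly_Mapping.lookup (bracket n l)" and ?e' = "Poly_Mapping.lookup (bracket n l')"
  have eq: "?e' k = ?e (\<pi> k)" for k
    unfolding assms(4)[symmetric] by (simp add: lookup_map_key parity_perms_inj[OF assms(3)])
  have eq': "?e k = ?e' (inv \<pi> k)" for k
    using assms(3) permutes_inverses(1)[of \<pi> "{1..n}" k] by (simp add: eq parity_perms_def)
  fix i
  show "?e i = ?e' i"
  proof (cases "i \<in> {1..n}")
    case True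
    show ?thesis
      using antitone_rearrangement_le[OF assms(3) True, of ?e ?e'] eq
        antitone_rearrangement_le[OF parity_perms_inv[OF assms(3)] True, of ?e' ?e] eq'
        bracket_antitone[OF assms(1)] bracket_antitone[OF assms(2)] by (intro antisym) blast+
  qed (auto simp: lookup_bracket)
qed

text \<open>A monomial occurs once for each element of its stabilizer. The multiplicity is left in,
  because in characteristic zero it is nonzero.\<close>

definition orbit_sum :: "nat \<Rightarrow> (nat \<Rightarrow> nat) \<Rightarrow> 'a::field_char_0 mpolynomial" where
  "orbit_sum n l = (\<Sum>\<pi>\<in>parity_perms n. Poly_Mapping.single (Poly_Mapping.map_key \<pi> (bracket n l)) 1)"

lemma eval_orbit_sum:
  "eval_poly x (orbit_sum n l) = (\<Sum>\<pi>\<in>parity_perms n. eval_mono x (Poly_Mapping.map_key \<pi> (bracket n l)))"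
  by (simp add: orbit_sum_def eval_poly_sum)

lemma Winv_orbit_sum: "Winv n (\<lambda>x :: nat \<Rightarrow> 'a::field_char_0. eval_poly x (orbit_sum n l))"
  unfolding Winv_def
proof (intro ballI allI)
  fix \<sigma> and x :: "nat \<Rightarrow> 'a" assume \<sigma>: "\<sigma> \<in> parity_perms n"
  let ?m = "\<lambda>\<pi>. Poly_Mapping.map_key \<pi> (bracket n l)"
  have bij: "bij_betw (\<lambda>\<pi>. \<pi> \<circ> \<sigma>) (parity_perms n) (parity_perms n)"
  proof (rule bij_betwI[of _ _ _ "\<lambda>\<pi>. \<pi> \<circ> inv \<sigma>"])
    show "\<pi> \<circ> \<sigma> \<circ> inv \<sigma> = \<pi>" "\<pi> \<circ> inv \<sigma> \<circ> \<sigma> = \<pi>" for \<pi>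
      using \<sigma> by (auto simp: parity_perms_def fun_eq_iff permutes_inverses)
  qed (use \<sigma> in \<open>auto intro: parity_perms_comp parity_perms_inv\<close>)
  have "eval_poly (x \<circ> \<sigma>) (orbit_sum n l) = (\<Sum>\<pi>\<in>parity_perms n. eval_mono (x \<circ> \<sigma>) (?m (\<pi> \<circ> \<sigma>)))"
    unfolding eval_orbit_sum by (rule sum.reindex_bij_betw[OF bij, symmetric])
  also have "\<dots> = (\<Sum>\<pi>\<in>parity_perms n. eval_mono x (?m \<pi>))"
  proof (rule sum.cong[OF refl])
    fix \<pi> assume \<pi>: "\<pi> \<in> parity_perms n"
    have "?m (\<pi> \<circ> \<sigma>) = Poly_Mapping.map_key \<sigma> (?m \<pi>)"
      using \<pi> \<sigma> by (simp add: map_key_compose parity_perms_inj)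
    then show "eval_mono (x \<circ> \<sigma>) (?m (\<pi> \<circ> \<sigma>)) = eval_mono x (?m \<pi>)"
      by (simp add: eval_mono_map_key[OF \<sigma>])
  qed
  finally show "eval_poly (x \<circ> \<sigma>) (orbit_sum n l) = eval_poly x (orbit_sum n l)"
    by (simp add: eval_orbit_sum)
qed

lemma polyfun_orbit_sum:
  assumes "l \<in> Lam n"
  shows "polyfun n (int (odd_size n l)) (\<lambda>x :: nat \<Rightarrow> 'a::field_char_0. eval_poly x (orbit_sum n l))"
proof -
  have "polyfun n (int (odd_size n l)) (\<lambda>x :: nat \<Rightarrow> 'a. eval_mono x (Poly_Mapping.map_key \<pi> (bracket n l)))"
    if \<pi>: "\<pi> \<in> parity_perms n" for \<pi>
  proof -
    let ?m = "Poly_Mapping.map_key \<pi> (bracket n l)"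
    have "Poly_Mapping.keys (bracket n l) \<subseteq> {1..n}"
      by (auto simp: in_keys_iff lookup_bracket split: if_splits)
    then have "Poly_Mapping.keys ?m \<subseteq> {1..n}"
      using parity_perms_range[OF \<pi>] by (auto simp only: keys_map_key[OF parity_perms_inj[OF \<pi>]])
    then have "polyfun n (int (odd_size n l)) (\<lambda>x. eval_poly x (Poly_Mapping.single ?m (1::'a)))"
      by (intro polyfun_eval_poly) (auto simp: poly_ring_def mono_deg_map_key[OF \<pi>] mono_deg_bracket[OF assms])
    then show ?thesis by simp
  qed
  then show ?thesis unfolding eval_orbit_sum by (rule polyfun_sum)
qed

lemma lookup_orbit_sum:
  assumes "l \<in> Lam n" "l' \<in> Lam n"
  shows "(Poly_Mapping.lookup (orbit_sum n l) (bracket n l') :: 'a::field_char_0) \<noteq> 0 \<longleftrightarrow> l = l'"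
proof -
  let ?K = "{\<pi> \<in> parity_perms n. Poly_Mapping.map_key \<pi> (bracket n l) = bracket n l'}"
  have "Poly_Mapping.lookup (orbit_sum n l) (bracket n l')
      = (\<Sum>\<pi>\<in>parity_perms n. if Poly_Mapping.map_key \<pi> (bracket n l) = bracket n l' then 1 else (0::'a))"
    by (simp add: orbit_sum_def lookup_sum lookup_single when_def)
  also have "\<dots> = of_nat (card ?K)"
    by (simp add: finite_parity_perms flip: sum.inter_filter)
  finally have *: "Poly_Mapping.lookup (orbit_sum n l) (bracket n l') = (of_nat (card ?K) :: 'a)" .
  have "?K \<noteq> {} \<longleftrightarrow> l = l'"
  proof
    assume "l = l'"
    moreover have "Poly_Mapping.map_key id (bracket n l) = bracket n l"
      by (rule poly_mapping_eqI) (simp add: lookup_map_key)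
    ultimately show "?K \<noteq> {}" using parity_perms_id by fastforce
  qed (use bracket_orbit_inj[OF assms] in blast)
  then show ?thesis using finite_parity_perms[of n] by (simp add: * card_eq_0_iff)
qed

section \<open>The polynomials characterized by \<open>is_R\<close>\<close>

lemma finite_Lam_le: "finite {l \<in> Lam n. odd_size n l \<le> d}"
proof (rule finite_subset)
  show "finite {f. \<forall>i. (i \<in> {1..n} \<longrightarrow> f i \<in> {..d}) \<and> (i \<notin> {1..n} \<longrightarrow> f i = (0::nat))}"
    by (rule finite_set_of_finite_funs) auto
  have "l i \<le> d" if l: "l \<in> Lam n" "odd_size n l \<le> d" and i: "i \<in> {1..n}" for l i
  proof -
    have "l i \<le> l 1" using l i by (auto simp: Lam_def)
    also have "l 1 \<le> odd_size n l"
      unfolding odd_size_def using i by (intro member_le_sum) auto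
    finally show ?thesis using l by simp
  qed
  then show "{l \<in> Lam n. odd_size n l \<le> d}
      \<subseteq> {f. \<forall>i. (i \<in> {1..n} \<longrightarrow> f i \<in> {..d}) \<and> (i \<notin> {1..n} \<longrightarrow> f i = (0::nat))}"
    by (auto simp: Lam_def)
qed

lemma mono_deg_le_total_degree: "m \<in> Poly_Mapping.keys p \<Longrightarrow> mono_deg m \<le> total_degree p"
  unfolding total_degree_def by (intro Max_ge) (auto simp: mono_deg_def)

lemma total_degree_eqI:
  assumes "\<And>m. m \<in> Poly_Mapping.keys p \<Longrightarrow> mono_deg m \<le> d" "m \<in> Poly_Mapping.keys p" "mono_deg m = d"
  shows "total_degree p = d"
  unfolding total_degree_def using assms by (intro Max_eqI) (auto simp: mono_deg_def)

lemma lat_0: "(\<lambda>i. rho n r i + of_nat (l i)) = lat n r 0 l"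
  by (simp add: fun_eq_iff lat_def rho_def)

lemma is_R_polyfun:
  assumes "is_R n r l p"
  shows "polyfun n (int (odd_size n l)) (\<lambda>x. eval_poly x p)" "Winv n (\<lambda>x. eval_poly x p)"
    and "\<mu> \<in> Lam n \<Longrightarrow> odd_size n \<mu> \<le> odd_size n l \<Longrightarrow> \<mu> \<noteq> l \<Longrightarrow> eval_poly (lat n r 0 \<mu>) p = 0"
    and "coef (\<lambda>x. eval_poly x p) (bracket n l) = 1"
  using assms mono_deg_le_total_degree[of _ p] unfolding is_R_def
  by (auto intro!: polyfun_eval_poly simp: W_invariant_iff_Winv lat_0 coef_eval_poly)

text \<open>The difference of two candidates has coefficient 0 at the monomial [l]; this replaces
  the unknown value at \<rho> + l in \<open>interpolation_zero\<close>.\<close>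

lemma is_R_unique:
  fixes r :: "'a::field_char_0"
  assumes r: "\<And>q::rat. q < 0 \<Longrightarrow> r \<noteq> of_rat q" and "is_R n r l p" "is_R n r l q"
  shows "p = q"
proof (rule eval_poly_inject)
  fix x
  note p = is_R_polyfun[OF assms(2)] and q = is_R_polyfun[OF assms(3)]
  let ?F = "\<lambda>x. eval_poly x p + - 1 * eval_poly x q"
  have c0: "coef ?F (bracket n l) = 0"
    by (simp only: coef_add[OF p(1) polyfun_cmult[OF q(1)]] coef_cmult[OF q(1)] p(4) q(4)) simp
  have "?F x = 0"
  proof (rule interpolation_zero[OF r, where l = l and d = "int (odd_size n l)" and s = 0 and n = n and F = ?F])
    show "polyfun n (int (odd_size n l)) ?F" by (rule polyfun.add[OF p(1) polyfun_cmult[OF q(1)]])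
    show "Winv n ?F" by (rule Winv_add[OF p(2) Winv_mult[OF Winv_const q(2)]])
    fix \<mu> assume \<mu>: "\<mu> \<in> Lam n" "int (odd_size n \<mu>) \<le> int (odd_size n l)"
      "\<not> (\<mu> = l \<and> int (odd_size n \<mu>) = int (odd_size n l) \<and> coef ?F (bracket n l) = 0)"
    with c0 have "\<mu> \<noteq> l" by blast
    then show "?F (lat n r 0 \<mu>) = 0" using p(3)[OF \<mu>(1)] q(3)[OF \<mu>(1)] \<mu>(2) by simp
  qed
  then show "eval_poly x p = eval_poly x q" by simp
qed

text \<open>Unknowns and conditions are both indexed by the partitions of size at most d, where the
  condition with index l prescribes a coefficient instead of a value. By
  \<open>interpolation_zero\<close> a solution of the homogeneous system is the zero polynomial, and
  its coefficient at the monomial [\<kappa>] exhibits c \<kappa> = 0.\<close>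

lemma is_R_exists:
  fixes r :: "'a::field_char_0"
  assumes r: "\<And>q::rat. q < 0 \<Longrightarrow> r \<noteq> of_rat q" and l: "l \<in> Lam n"
  obtains p where "is_R n r l p"
proof -
  define d where "d = odd_size n l"
  define I where "I = {\<mu> \<in> Lam n. odd_size n \<mu> \<le> d}"
  define P where "P c = (\<Sum>\<mu>\<in>I. Poly_Mapping.single 0 (c \<mu>) * orbit_sum n \<mu>)" for c :: "_ \<Rightarrow> 'a"
  define A where "A \<kappa> \<mu> = (if \<kappa> = l then Poly_Mapping.lookup (orbit_sum n \<mu>) (bracket n l)
    else eval_poly (lat n r 0 \<kappa>) (orbit_sum n \<mu>))" for \<kappa> \<mu>
  have fin: "finite I" unfolding I_def by (rule finite_Lam_le)
  have lI: "l \<in> I" using l by (simp add: I_def d_def)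
  have evP: "eval_poly x (P c) = (\<Sum>\<mu>\<in>I. c \<mu> * eval_poly x (orbit_sum n \<mu>))" for x c
    by (simp add: P_def eval_poly_sum eval_poly_mult)
  have lkP: "Poly_Mapping.lookup (P c) m = (\<Sum>\<mu>\<in>I. c \<mu> * Poly_Mapping.lookup (orbit_sum n \<mu>) m)" for m c
    using lookup_single_times[where k = 0 and m = m and 'a = 'a] unfolding add_0 by (simp add: P_def lookup_sum)
  have polyP: "polyfun n (int d) (\<lambda>x. eval_poly x (P c))" for c
    unfolding evP
    by (intro polyfun_sum polyfun_cmult polyfun.mono[OF polyfun_orbit_sum]) (auto simp: I_def)
  have invP: "Winv n (\<lambda>x. eval_poly x (P c))" for c
    unfolding evP by (intro Winv_sum Winv_mult Winv_const Winv_orbit_sum)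
  have AP: "(\<Sum>\<mu>\<in>I. A \<kappa> \<mu> * c \<mu>)
      = (if \<kappa> = l then Poly_Mapping.lookup (P c) (bracket n l) else eval_poly (lat n r 0 \<kappa>) (P c))" for \<kappa> c
    by (simp add: A_def evP lkP mult.commute)
  have "\<exists>c. \<forall>\<kappa>\<in>I. (\<Sum>\<mu>\<in>I. A \<kappa> \<mu> * c \<mu>) = (if \<kappa> = l then 1 else 0)"
  proof (rule injective_system_solvable[OF fin])
    fix c assume c: "\<And>\<kappa>. \<kappa> \<in> I \<Longrightarrow> (\<Sum>\<mu>\<in>I. A \<kappa> \<mu> * c \<mu>) = 0"
    have "eval_poly x (P c) = 0" for x
    proof (rule interpolation_zero[OF r polyP invP])
      fix \<kappa> assume \<kappa>: "\<kappa> \<in> Lam n" "int (odd_size n \<kappa>) \<le> int d"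
        "\<not> (\<kappa> = l \<and> int (odd_size n \<kappa>) = int d \<and> coef (\<lambda>x. eval_poly x (P c)) (bracket n l) = 0)"
      have "coef (\<lambda>x. eval_poly x (P c)) (bracket n l) = 0"
        using c[OF lI] by (simp add: AP coef_eval_poly)
      with \<kappa> have "\<kappa> \<noteq> l" by (auto simp: d_def)
      then show "eval_poly (lat n r 0 \<kappa>) (P c) = 0"
        using c[of \<kappa>] \<kappa> unfolding AP by (simp add: I_def)
    qed
    then have P0: "P c = 0" by (rule eval_poly_eq_0_imp)
    show "\<forall>\<kappa>\<in>I. c \<kappa> = 0"
    proof
      fix \<kappa> assume \<kappa>: "\<kappa> \<in> I"
      have "0 = Poly_Mapping.lookup (P c) (bracket n \<kappa>)" by (simp add: P0)
      also have "\<dots> = (\<Sum>\<mu>\<in>I. if \<mu> = \<kappa> then c \<kappa> * Poly_Mapping.lookup (orbit_sum n \<kappa>) (bracket n \<kappa>) else 0)"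
        unfolding lkP using \<kappa> lookup_orbit_sum[of _ n \<kappa>, where 'a = 'a] by (intro sum.cong) (auto simp: I_def)
      also have "\<dots> = c \<kappa> * Poly_Mapping.lookup (orbit_sum n \<kappa>) (bracket n \<kappa>)"
        using fin \<kappa> by simp
      finally show "c \<kappa> = 0" using \<kappa> lookup_orbit_sum[of \<kappa> n \<kappa>, where 'a = 'a] by (auto simp: I_def)
    qed
  qed
  then obtain c where "\<forall>\<kappa>\<in>I. (\<Sum>\<mu>\<in>I. A \<kappa> \<mu> * c \<mu>) = (if \<kappa> = l then 1 else 0)" by blast
  then have c: "Poly_Mapping.lookup (P c) (bracket n l) = 1"
    "\<And>\<kappa>. \<kappa> \<in> I \<Longrightarrow> \<kappa> \<noteq> l \<Longrightarrow> eval_poly (lat n r 0 \<kappa>) (P c) = 0"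
    using lI unfolding AP by auto
  obtain p where p: "p \<in> poly_ring n" "\<And>x. eval_poly x (P c) = eval_poly x p"
    "\<And>m. m \<in> Poly_Mapping.keys p \<Longrightarrow> int (mono_deg m) \<le> int d"
    using polyfun_rep[OF polyP[of c]] by metis
  have "P c = p" by (rule eval_poly_inject) (rule p(2))
  moreover have "total_degree p = d"
    using p(3) c(1) mono_deg_bracket[OF l] \<open>P c = p\<close>
    by (intro total_degree_eqI[of p d "bracket n l"]) (auto simp: in_keys_iff d_def)
  ultimately have "is_R n r l p"
    unfolding is_R_def lat_0 using p(1) c invP[of c] by (auto simp: W_invariant_iff_Winv I_def d_def)
  then show ?thesis by (rule that)
qed

lemma is_R_R_poly:
  fixes r :: "'a::field_char_0"
  assumes "\<And>q::rat. q < 0 \<Longrightarrow> r \<noteq> of_rat q" "l \<in> Lam n"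
  shows "is_R n r l (R_poly n r l)"
  unfolding R_poly_def using is_R_exists[OF assms] is_R_unique[OF assms(1)] by (metis theI)

section \<open>Transposition of graded operators\<close>

text \<open>\<open>A\<close> is the matrix of a raising operator that is self-adjoint for the bilinear form \<open>V\<close>. A
  matrix \<open>M\<close> satisfying the commutation hypothesis is \<open>exp (- ad A)\<close> applied to its diagonal
  part. So if transposition with respect to \<open>V\<close> takes \<open>M\<close> to the diagonal part of \<open>N\<close>, it
  takes \<open>N\<close> to the diagonal part of \<open>M\<close>.\<close>

lemma graded_transposition:
  fixes A V M N :: "'i \<Rightarrow> 'i \<Rightarrow> 'a::field_char_0" and sz :: "'i \<Rightarrow> nat" and I :: "'i set" and D :: nat
  defines "L s \<equiv> {i \<in> I. sz i = s}"
  assumes fin: "\<And>s. finite (L s)"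
    and self: "\<And>i j. i \<in> I \<Longrightarrow> j \<in> I \<Longrightarrow>
      (\<Sum>k\<in>L (sz i + 1). A k i * V k j) = (\<Sum>k\<in>L (sz j + 1). V i k * A k j)"
    and M: "\<And>i j m. i \<in> I \<Longrightarrow> j \<in> I \<Longrightarrow> sz i = sz j + Suc m \<Longrightarrow>
      of_nat (Suc m) * M i j = (\<Sum>k\<in>L (sz j + 1). M i k * A k j) - (\<Sum>k\<in>L (sz j + m). A i k * M k j)"
    and N: "\<And>i j m. i \<in> I \<Longrightarrow> j \<in> I \<Longrightarrow> sz i = sz j + Suc m \<Longrightarrow>
      of_nat (Suc m) * N i j = (\<Sum>k\<in>L (sz j + 1). N i k * A k j) - (\<Sum>k\<in>L (sz j + m). A i k * N k j)"
    and top: "\<And>i j. i \<in> I \<Longrightarrow> j \<in> I \<Longrightarrow> sz i = sz j + Suc D \<Longrightarrow> M i j = 0"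
    and base: "\<And>i j. i \<in> I \<Longrightarrow> j \<in> I \<Longrightarrow>
      (\<Sum>m\<le>D. \<Sum>k\<in>L (sz i + m). M k i * V k j) = (\<Sum>k\<in>L (sz j). V i k * N k j)"
    and ij: "i \<in> I" "j \<in> I"
  shows "(\<Sum>m\<le>D. \<Sum>k\<in>L (sz j + m). V i k * N k j) = (\<Sum>k\<in>L (sz i). M k i * V k j)"
proof -
  \<comment> \<open>\<open>Y m\<close> and \<open>Z m\<close> are V composed with the components of
    M and N that raise the size by m, and \<open>T\<close> is the commutator with A carried over to
    forms. Since only forms are compared, V need not be known to be nondegenerate.\<close>
  define Y where "Y m i j = (\<Sum>k\<in>L (sz i + m). M k i * V k j)" for m i j
  define Z where "Z m i j = (\<Sum>k\<in>L (sz j + m). V i k * N k j)" for m i j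
  define T where "T W i j = (\<Sum>k\<in>L (sz j + 1). W i k * A k j) - (\<Sum>k\<in>L (sz i + 1). A k i * W k j)" for W i j
  have LI: "k \<in> I \<and> sz k = s" if "k \<in> L s" for k s using that by (simp add: L_def)
  have Z_Suc: "of_nat (Suc m) * Z (Suc m) i j = T (Z m) i j" if ij: "i \<in> I" "j \<in> I" for m i j
  proof -
    have "of_nat (Suc m) * Z (Suc m) i j = (\<Sum>k\<in>L (sz j + Suc m). V i k * (of_nat (Suc m) * N k j))"
      by (simp only: Z_def sum_distrib_left mult.left_commute)
    also have "\<dots> = (\<Sum>k\<in>L (sz j + Suc m). V i k * ((\<Sum>l\<in>L (sz j + 1). N k l * A l j) - (\<Sum>l\<in>L (sz j + m). A k l * N l j)))"
      using LI ij by (intro sum.cong arg_cong2[of _ _ _ _ "(*)"] N refl) auto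
    also have "\<dots> = (\<Sum>k\<in>L (sz j + Suc m). \<Sum>l\<in>L (sz j + 1). V i k * N k l * A l j)
        - (\<Sum>k\<in>L (sz j + Suc m). \<Sum>l\<in>L (sz j + m). V i k * A k l * N l j)"
      by (simp add: right_diff_distrib sum_subtractf sum_distrib_left mult.assoc)
    also have "(\<Sum>k\<in>L (sz j + Suc m). \<Sum>l\<in>L (sz j + 1). V i k * N k l * A l j)
        = (\<Sum>l\<in>L (sz j + 1). Z m i l * A l j)"
      by (subst sum.swap) (intro sum.cong refl, use LI in \<open>simp add: Z_def sum_distrib_right\<close>)
    also have "(\<Sum>k\<in>L (sz j + Suc m). \<Sum>l\<in>L (sz j + m). V i k * A k l * N l j)
        = (\<Sum>l\<in>L (sz j + m). (\<Sum>k\<in>L (sz l + 1). V i k * A k l) * N l j)"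
      by (subst sum.swap) (intro sum.cong refl, use LI in \<open>simp add: sum_distrib_right\<close>)
    also have "\<dots> = (\<Sum>l\<in>L (sz j + m). (\<Sum>k\<in>L (sz i + 1). A k i * V k l) * N l j)"
      using LI ij self by (intro sum.cong refl) metis
    also have "\<dots> = (\<Sum>k\<in>L (sz i + 1). A k i * Z m k j)"
      unfolding sum_distrib_right Z_def
      by (subst sum.swap) (simp add: sum_distrib_left mult.assoc)
    finally show ?thesis by (simp add: T_def)
  qed
  have Y_Suc: "of_nat (Suc m) * Y (Suc m) i j = - T (Y m) i j" if ij: "i \<in> I" "j \<in> I" for m i j
  proof -
    have "of_nat (Suc m) * Y (Suc m) i j = (\<Sum>k\<in>L (sz i + Suc m). (of_nat (Suc m) * M k i) * V k j)"
      by (simp only: Y_def sum_distrib_left mult.assoc)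
    also have "\<dots> = (\<Sum>k\<in>L (sz i + Suc m). ((\<Sum>l\<in>L (sz i + 1). M k l * A l i) - (\<Sum>l\<in>L (sz i + m). A k l * M l i)) * V k j)"
      using LI ij by (intro sum.cong arg_cong2[of _ _ _ _ "(*)"] M refl) auto
    also have "\<dots> = (\<Sum>k\<in>L (sz i + Suc m). \<Sum>l\<in>L (sz i + 1). A l i * (M k l * V k j))
        - (\<Sum>k\<in>L (sz i + Suc m). \<Sum>l\<in>L (sz i + m). M l i * (A k l * V k j))"
      by (simp only: left_diff_distrib sum_subtractf sum_distrib_right) (simp only: mult_ac)
    also have "(\<Sum>k\<in>L (sz i + Suc m). \<Sum>l\<in>L (sz i + 1). A l i * (M k l * V k j))
        = (\<Sum>l\<in>L (sz i + 1). A l i * Y m l j)"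
      by (subst sum.swap) (intro sum.cong refl, use LI in \<open>simp add: Y_def sum_distrib_left\<close>)
    also have "(\<Sum>k\<in>L (sz i + Suc m). \<Sum>l\<in>L (sz i + m). M l i * (A k l * V k j))
        = (\<Sum>l\<in>L (sz i + m). M l i * (\<Sum>k\<in>L (sz l + 1). A k l * V k j))"
      by (subst sum.swap) (intro sum.cong refl, use LI in \<open>simp add: sum_distrib_left\<close>)
    also have "\<dots> = (\<Sum>l\<in>L (sz i + m). M l i * (\<Sum>k\<in>L (sz j + 1). V l k * A k j))"
      using LI ij self by (intro sum.cong refl) metis
    also have "\<dots> = (\<Sum>k\<in>L (sz j + 1). Y m i k * A k j)"
      unfolding sum_distrib_left Y_def
      by (subst sum.swap) (simp add: sum_distrib_right mult.assoc)
    finally show ?thesis by (simp add: T_def)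
  qed
  have Y_top: "Y (Suc D) i j = 0" if "i \<in> I" "j \<in> I" for i j
    unfolding Y_def by (rule sum.neutral) (use LI top that in auto)
  \<comment> \<open>Formally Z m is T^m / m! applied to Z 0, which by \<open>base\<close> is the sum
    of all Y k. As T takes Y k to - (k + 1) Y (k + 1), the sign and the binomial coefficient appear;
    \<open>Y_top\<close> cuts the sum off at D.\<close>
  have ZY: "Z m i j = (-1) ^ m * (\<Sum>k\<le>D. of_nat (k choose m) * Y k i j)" if "i \<in> I" "j \<in> I" for m i j
    using that
  proof (induction m arbitrary: i j)
    case 0
    then show ?case using base[of i j] by (simp add: Y_def Z_def)
  next
    case (Suc m)
    have "of_nat (Suc m) * Z (Suc m) i j = T (Z m) i j" by (rule Z_Suc[OF Suc.prems])
    also have "\<dots> = T (\<lambda>i j. (-1) ^ m * (\<Sum>k\<le>D. of_nat (k choose m) * Y k i j)) i j"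
      unfolding T_def using Suc LI by (intro arg_cong2[of _ _ _ _ "(-)"] sum.cong refl) auto
    also have "\<dots> = (-1) ^ m * (\<Sum>k\<le>D. of_nat (k choose m) * T (Y k) i j)"
      unfolding T_def
      by (simp add: sum_distrib_left sum_distrib_right right_diff_distrib sum_subtractf mult_ac
          sum.swap[of _ "{..D}"])
    also have "\<dots> = (-1) ^ Suc m * (\<Sum>k\<le>D. of_nat (k choose m) * (of_nat (Suc k) * Y (Suc k) i j))"
      using Y_Suc[OF Suc.prems] by (simp add: sum_negf)
    also have "\<dots> = (-1) ^ Suc m * (of_nat (Suc m) * (\<Sum>k\<le>D. of_nat (Suc k choose Suc m) * Y (Suc k) i j))"
    proof -
      have "of_nat (k choose m) * (of_nat (Suc k) * y) = of_nat (Suc m) * (of_nat (Suc k choose Suc m) * y)" for k and y :: 'a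
        using arg_cong[OF Suc_times_binomial_eq[of k m], of "of_nat :: nat \<Rightarrow> 'a"]
        unfolding of_nat_mult by (metis mult.assoc mult.commute)
      then show ?thesis by (simp only: sum_distrib_left)
    qed
    also have "(\<Sum>k\<le>D. of_nat (Suc k choose Suc m) * Y (Suc k) i j) = (\<Sum>k\<le>Suc D. of_nat (k choose Suc m) * Y k i j)"
      by (simp only: sum.atMost_Suc_shift) simp
    also have "\<dots> = (\<Sum>k\<le>D. of_nat (k choose Suc m) * Y k i j)"
      by (simp add: Y_top Suc.prems)
    finally show ?case
      by (simp only: mult.left_commute[of "(-1) ^ Suc m"] mult_cancel_left of_nat_eq_0_iff) simp
  qed
  \<comment> \<open>Summing Z m over m, the alternating binomial sums leave only Y 0, the diagonal
    part of M.\<close>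
  have alt: "(\<Sum>m\<le>D. (-1) ^ m * of_nat (k choose m)) = (if k = 0 then 1 else (0::'a))" if "k \<le> D" for k
  proof -
    have "(\<Sum>m\<le>D. (-1) ^ m * of_nat (k choose m)) = (\<Sum>m\<le>k. (-1) ^ m * of_nat (k choose m) :: 'a)"
      using that by (intro sum.mono_neutral_right) auto
    also have "\<dots> = (if k = 0 then 1 else 0)"
      using choose_alternating_sum[of k, where 'a = 'a] by simp
    finally show ?thesis .
  qed
  have "(\<Sum>m\<le>D. Z m i j) = (\<Sum>k\<le>D. (\<Sum>m\<le>D. (-1) ^ m * of_nat (k choose m)) * Y k i j)"
    by (simp add: ZY ij sum_distrib_left sum_distrib_right mult.assoc) (rule sum.swap)
  also have "\<dots> = (\<Sum>k\<le>D. if k = 0 then Y k i j else 0)"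
    by (rule sum.cong) (auto simp: alt)
  also have "\<dots> = Y 0 i j" by simp
  finally show ?thesis by (simp add: Y_def Z_def)
qed

section \<open>The difference operator\<close>

definition steps :: "nat \<Rightarrow> nat set set" where
  "steps n = {S. S \<subseteq> {1..n} \<and> card {i \<in> S. odd i} = 1 \<and> card {i \<in> S. even i} \<le> 1}"

definition pair_factor :: "'a::field_char_0 \<Rightarrow> nat \<Rightarrow> nat \<Rightarrow> 'a \<Rightarrow> 'a" where
  "pair_factor r a b u = (if a mod 2 = b mod 2 then inverse u else u - r)"

text \<open>The coefficient of the shift by the indicator of \<open>S\<close>; where two coordinates of equal parity
  coincide, it has a pole and the value below is junk.\<close>

definition step_coef :: "nat \<Rightarrow> 'a::field_char_0 \<Rightarrow> nat set \<Rightarrow> (nat \<Rightarrow> 'a) \<Rightarrow> 'a" where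
  "step_coef n r S x = (\<Prod>(a, b)\<in>S \<times> ({1..n} - S). pair_factor r a b (x a - x b)) * (\<Prod>a\<in>S \<inter> same_par n. x a)"

text \<open>The points off the poles of the coefficients \<open>step_coef\<close>.\<close>

definition regular :: "nat \<Rightarrow> (nat \<Rightarrow> 'a) \<Rightarrow> bool" where
  "regular n x \<longleftrightarrow> (\<forall>a\<in>{1..n}. \<forall>b\<in>{1..n}. a \<noteq> b \<longrightarrow> a mod 2 = b mod 2 \<longrightarrow> x a \<noteq> x b)"

definition par_pairs :: "nat \<Rightarrow> (nat \<times> nat) set" where
  "par_pairs n = {(a, b). a \<in> {1..n} \<and> b \<in> {1..n} \<and> a < b \<and> a mod 2 = b mod 2}"

text \<open>For T = \<open>par_pairs n\<close> this is the product of the Vandermonde determinants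
  of the two parity classes, up to sign. T is variable because single factors get removed.\<close>

definition vdm :: "(nat \<times> nat) set \<Rightarrow> (nat \<Rightarrow> 'a::field_char_0) \<Rightarrow> 'a" where
  "vdm T x = (\<Prod>(a, b)\<in>T. x a - x b)"

lemma finite_steps: "finite (steps n)"
  by (rule finite_subset[of _ "Pow {1..n}"]) (auto simp: steps_def)

lemma finite_step: "S \<in> steps n \<Longrightarrow> finite S"
  using finite_subset[of S "{1..n}"] by (auto simp: steps_def)

lemma finite_par_pairs [simp]: "finite (par_pairs n)"
  by (rule finite_subset[of _ "{1..n} \<times> {1..n}"]) (auto simp: par_pairs_def)

lemma card_odd_even: fixes n :: nat shows "card {i \<in> {1..n}. odd i} = card {i \<in> {1..n}. even i} + (if odd n then 1 else 0)"
proof (cases "even n")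
  case True
  then have "same_par n = {i \<in> {1..n}. even i}"
    by (auto simp: same_par_def even_iff_mod_2_eq_zero)
  with True show ?thesis using card_same_par[of n] by simp
next
  case False
  then obtain m where m: "n = Suc m" "even m" by (cases n) auto
  have "{i \<in> {1..n}. odd i} = insert n {i \<in> {1..m}. odd i}" "{i \<in> {1..n}. even i} = {i \<in> {1..m}. even i}"
    using m by (auto simp: le_Suc_eq)
  moreover have "same_par m = {i \<in> {1..m}. even i}"
    using m by (auto simp: same_par_def even_iff_mod_2_eq_zero)
  ultimately show ?thesis using card_same_par[of m] m by simp
qed

text \<open>The numerator of \<open>step_coef\<close> has degree one more than its denominator,
  because the number of odd positions exceeds that of even ones by 1 or 0 according to the parity of
  n. The same count later fixes a sign in \<open>weight_step\<close>.\<close>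

lemma step_degree:
  assumes "S \<in> steps n"
  shows "card {p \<in> S \<times> ({1..n} - S). fst p mod 2 \<noteq> snd p mod 2} + card (S \<inter> same_par n)
    = card {p \<in> S \<times> ({1..n} - S). fst p mod 2 = snd p mod 2} + 1"
proof -
  let ?O = "{i \<in> {1..n}. odd i}" and ?E = "{i \<in> {1..n}. even i}"
  let ?SO = "{i \<in> S. odd i}" and ?SE = "{i \<in> S. even i}"
  have S: "S \<subseteq> {1..n}" "card ?SO = 1" "card ?SE \<le> 1" and fin: "finite S"
    using assms finite_step[OF assms] by (auto simp: steps_def)
  have sub: "?SO \<subseteq> ?O" "?SE \<subseteq> ?E" using S by auto
  have le: "1 \<le> card ?O" "card ?SE \<le> card ?E"
    using card_mono[OF _ sub(1)] card_mono[OF _ sub(2)] S(2) by auto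
  have "{p \<in> S \<times> ({1..n} - S). fst p mod 2 \<noteq> snd p mod 2} = ?SO \<times> (?E - ?SE) \<union> ?SE \<times> (?O - ?SO)"
    by (auto simp: mod2_eq_if split: if_splits)
  then have 1: "card {p \<in> S \<times> ({1..n} - S). fst p mod 2 \<noteq> snd p mod 2}
      = card ?SO * (card ?E - card ?SE) + card ?SE * (card ?O - card ?SO)"
    using fin sub by (simp add: card_Un_disjoint card_cartesian_product card_Diff_subset disjoint_iff)
  have "{p \<in> S \<times> ({1..n} - S). fst p mod 2 = snd p mod 2} = ?SO \<times> (?O - ?SO) \<union> ?SE \<times> (?E - ?SE)"
    by (auto simp: mod2_eq_if split: if_splits)
  then have 2: "card {p \<in> S \<times> ({1..n} - S). fst p mod 2 = snd p mod 2}
      = card ?SO * (card ?O - card ?SO) + card ?SE * (card ?E - card ?SE)"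
    using fin sub by (simp add: card_Un_disjoint card_cartesian_product card_Diff_subset disjoint_iff)
  have "S \<inter> same_par n = (if odd n then ?SO else ?SE)"
    using S(1) by (auto simp: same_par_def mod2_eq_if split: if_splits)
  then have 3: "card (S \<inter> same_par n) = (if odd n then card ?SO else card ?SE)" by simp
  consider "card ?SE = 0" | "card ?SE = 1" using S(3) by linarith
  then show ?thesis
    by cases (use le card_odd_even[of n] in \<open>simp_all only: 1 2 3 S(2)\<close>, auto)
qed

lemma vdm_nonzero: "regular n x \<Longrightarrow> vdm (par_pairs n) x \<noteq> 0"
  unfolding vdm_def prod_zero_iff[OF finite_par_pairs] by (auto simp: par_pairs_def regular_def)

lemma vdm_zero: "\<not> regular n x \<Longrightarrow> vdm (par_pairs n) x = 0"
proof -
  assume "\<not> regular n x"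
  then obtain a b where ab: "a \<in> {1..n}" "b \<in> {1..n}" "a \<noteq> b" "a mod 2 = b mod 2" "x a = x b"
    by (auto simp: regular_def)
  then have "(a, b) \<in> par_pairs n \<or> (b, a) \<in> par_pairs n" by (auto simp: par_pairs_def)
  then show ?thesis using ab(5) unfolding vdm_def prod_zero_iff[OF finite_par_pairs] by force
qed

lemma polyfun_vdm: "T \<subseteq> par_pairs n \<Longrightarrow> polyfun n (int (card T)) (vdm T)"
  using polyfun_prod[of T n "\<lambda>_. 1" "\<lambda>(a, b) x. x a - x b"] unfolding vdm_def
  by (fastforce simp: par_pairs_def case_prod_unfold intro: polyfun_diff polyfun_var)

lemma regular_of_nat: "regular n (of_nat :: nat \<Rightarrow> 'a::field_char_0)"
  by (simp add: regular_def)

text \<open>The Vandermonde product is a nonzero polynomial that vanishes at the points not regular,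
  so a polynomial identity needs checking only at the regular ones.\<close>

lemma vdm_cancel:
  assumes "polyfun n d F" "\<And>x. regular n x \<Longrightarrow> F x = 0"
  shows "F x = 0"
proof (rule polyfun_mult_eq_0[OF polyfun_vdm[OF subset_refl] assms(1)])
  show "vdm (par_pairs n) x * F x = 0" for x
    using assms(2)[of x] vdm_zero[of n x] by (cases "regular n x") auto
  show "vdm (par_pairs n) (of_nat :: nat \<Rightarrow> 'a) \<noteq> 0" by (rule vdm_nonzero[OF regular_of_nat])
qed

lemma vdm_step_coef:
  fixes r :: "'a::field_char_0"
  assumes "S \<in> steps n"
  obtains N where "polyfun n (int (card (par_pairs n)) + 1) N"
    "\<And>x. regular n x \<Longrightarrow> N x = vdm (par_pairs n) x * step_coef n r S x"
proof -
  let ?P = "S \<times> ({1..n} - S)"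
  let ?same = "{p \<in> ?P. fst p mod 2 = snd p mod 2}" and ?opp = "{p \<in> ?P. fst p mod 2 \<noteq> snd p mod 2}"
  \<comment> \<open>Denominators come from pairs in either order, whereas \<open>par_pairs\<close>
    holds the increasing ones; \<open>g\<close> sorts a pair and \<open>e\<close> records the
    sign.\<close>
  define g where "g p = (if fst p < snd p then p else (snd p, fst p))" for p :: "nat \<times> nat"
  define e where "e p = (if fst p < snd p then 1 else - 1 :: 'a)" for p :: "nat \<times> nat"
  define N where "N x = vdm (par_pairs n - g ` ?same) x * ((\<Prod>p\<in>?same. e p) *
    ((\<Prod>p\<in>?opp. x (fst p) - x (snd p) - r) * (\<Prod>a\<in>S \<inter> same_par n. x a)))" for x
  have S: "S \<subseteq> {1..n}" and fin: "finite S" using assms finite_step[OF assms] by (auto simp: steps_def)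
  have inj: "inj_on g ?same"
    by (auto simp: inj_on_def g_def split: if_splits)
  have g: "g ` ?same \<subseteq> par_pairs n"
    using S by (fastforce simp: g_def par_pairs_def not_less_iff_gr_or_eq)
  have "polyfun n (int (card (par_pairs n - g ` ?same)) + (0 + (int (card ?opp) + int (card (S \<inter> same_par n))))) N"
    unfolding N_def
  proof (intro polyfun_mult)
    show "polyfun n (int (card (par_pairs n - g ` ?same))) (vdm (par_pairs n - g ` ?same))"
      by (rule polyfun_vdm) auto
    show "polyfun n 0 (\<lambda>x. \<Prod>p\<in>?same. e p)" by (simp add: polyfun.const)
    have "polyfun n (\<Sum>p\<in>?opp. 1) (\<lambda>x. \<Prod>p\<in>?opp. x (fst p) - x (snd p) - r)"
      using S by (intro polyfun_prod polyfun_diff polyfun_var polyfun.const) auto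
    then show "polyfun n (int (card ?opp)) (\<lambda>x. \<Prod>p\<in>?opp. x (fst p) - x (snd p) - r)" by simp
    have "polyfun n (\<Sum>p\<in>S \<inter> same_par n. 1) (\<lambda>x. \<Prod>a\<in>S \<inter> same_par n. x a)"
      using S by (intro polyfun_prod polyfun_var) auto
    then show "polyfun n (int (card (S \<inter> same_par n))) (\<lambda>x. \<Prod>a\<in>S \<inter> same_par n. x a)" by simp
  qed
  moreover have "int (card (par_pairs n - g ` ?same)) + (0 + (int (card ?opp) + int (card (S \<inter> same_par n))))
      = int (card (par_pairs n)) + 1"
    using step_degree[OF assms] card_mono[OF finite_par_pairs g] card_image[OF inj]
      card_Diff_subset[OF finite_subset[OF g finite_par_pairs] g] by linarith
  moreover have "N x = vdm (par_pairs n) x * step_coef n r S x" if x: "regular n x" for x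
  proof -
    have "vdm (par_pairs n) x = vdm (par_pairs n - g ` ?same) x * vdm (g ` ?same) x"
      unfolding vdm_def by (rule prod.subset_diff[OF g]) simp
    also have "vdm (g ` ?same) x = (\<Prod>p\<in>?same. e p * (x (fst p) - x (snd p)))"
      unfolding vdm_def prod.reindex[OF inj] o_def
      by (rule prod.cong) (auto simp: g_def e_def)
    finally have v: "vdm (par_pairs n) x
        = vdm (par_pairs n - g ` ?same) x * (\<Prod>p\<in>?same. e p * (x (fst p) - x (snd p)))" .
    have "(\<Prod>(a, b)\<in>?P. pair_factor r a b (x a - x b))
        = (\<Prod>p\<in>?same. pair_factor r (fst p) (snd p) (x (fst p) - x (snd p)))
        * (\<Prod>p\<in>?opp. pair_factor r (fst p) (snd p) (x (fst p) - x (snd p)))"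
      unfolding case_prod_unfold
      by (subst prod.union_disjoint[symmetric]) (use fin in \<open>auto intro!: prod.cong\<close>)
    also have "(\<Prod>p\<in>?same. pair_factor r (fst p) (snd p) (x (fst p) - x (snd p)))
        = (\<Prod>p\<in>?same. inverse (x (fst p) - x (snd p)))"
      by (rule prod.cong) (auto simp: pair_factor_def)
    also have "(\<Prod>p\<in>?opp. pair_factor r (fst p) (snd p) (x (fst p) - x (snd p)))
        = (\<Prod>p\<in>?opp. x (fst p) - x (snd p) - r)"
      by (rule prod.cong) (auto simp: pair_factor_def)
    finally have f: "step_coef n r S x = (\<Prod>p\<in>?same. inverse (x (fst p) - x (snd p)))
        * (\<Prod>p\<in>?opp. x (fst p) - x (snd p) - r) * (\<Prod>a\<in>S \<inter> same_par n. x a)"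
      by (simp add: step_coef_def)
    have "(\<Prod>p\<in>?same. e p * (x (fst p) - x (snd p))) * (\<Prod>p\<in>?same. inverse (x (fst p) - x (snd p)))
        = (\<Prod>p\<in>?same. e p)"
      unfolding prod.distrib[symmetric]
    proof (rule prod.cong[OF refl])
      fix p assume "p \<in> ?same"
      then have "x (fst p) \<noteq> x (snd p)" using x S unfolding regular_def by fastforce
      then show "e p * (x (fst p) - x (snd p)) * inverse (x (fst p) - x (snd p)) = e p" by simp
    qed
    then show ?thesis unfolding N_def v f by (metis (no_types, lifting) mult.assoc)
  qed
  ultimately show ?thesis using that[of N] by metis
qed

lemma regular_permute:
  assumes "\<pi> \<in> parity_perms n" "regular n x"
  shows "regular n (x \<circ> \<pi>)"
proof -
  have *: "\<pi> a \<noteq> \<pi> b \<and> \<pi> a \<in> {1..n} \<and> \<pi> b \<in> {1..n} \<and> \<pi> a mod 2 = \<pi> b mod 2"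
    if "a \<in> {1..n}" "b \<in> {1..n}" "a \<noteq> b" "a mod 2 = b mod 2" for a b
  proof -
    have "\<pi> a mod 2 = a mod 2" "\<pi> b mod 2 = b mod 2"
      using assms(1) that by (auto simp: parity_perms_def)
    then show ?thesis
      using that parity_perms_range[OF assms(1)] parity_perms_inj[OF assms(1)] by (simp add: inj_eq)
  qed
  show ?thesis
    unfolding regular_def o_apply
  proof (intro ballI impI)
    fix a b assume "a \<in> {1..n}" "b \<in> {1..n}" "a \<noteq> b" "a mod 2 = b mod 2"
    from *[OF this] show "x (\<pi> a) \<noteq> x (\<pi> b)" using assms(2) unfolding regular_def by blast
  qed
qed

lemma step_permute:
  assumes \<pi>: "\<pi> \<in> parity_perms n" and S: "S \<in> steps n"
  shows "\<pi> ` S \<in> steps n" "step_coef n r S (x \<circ> \<pi>) = step_coef n r (\<pi> ` S) x"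
proof -
  have inj: "inj \<pi>" by (rule parity_perms_inj[OF \<pi>])
  have sub: "S \<subseteq> {1..n}" using S by (auto simp: steps_def)
  have par: "\<pi> i mod 2 = i mod 2" if "i \<in> {1..n}" for i using \<pi> that by (simp add: parity_perms_def)
  then have par': "odd (\<pi> i) \<longleftrightarrow> odd i" if "i \<in> {1..n}" for i
    using that by (metis odd_iff_mod_2_eq_one)
  have rng: "\<pi> ` {1..n} = {1..n}" using \<pi> by (auto simp: parity_perms_def permutes_image)
  have "{i \<in> \<pi> ` S. odd i} = \<pi> ` {i \<in> S. odd i}" "{i \<in> \<pi> ` S. even i} = \<pi> ` {i \<in> S. even i}"
    using par' sub by blast+
  then have "card {i \<in> \<pi> ` S. odd i} = card {i \<in> S. odd i}" "card {i \<in> \<pi> ` S. even i} = card {i \<in> S. even i}"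
    using inj by (simp_all add: card_image inj_on_subset[OF inj])
  then show "\<pi> ` S \<in> steps n"
    using S sub rng unfolding steps_def by auto
  have compl: "{1..n} - \<pi> ` S = \<pi> ` ({1..n} - S)" using inj rng by (metis image_set_diff)
  have same: "\<pi> ` S \<inter> same_par n = \<pi> ` (S \<inter> same_par n)"
    using sub par parity_perms_range[OF \<pi>] unfolding same_par_def by auto
  have "\<pi> ` S \<times> ({1..n} - \<pi> ` S) = map_prod \<pi> \<pi> ` (S \<times> ({1..n} - S))"
    unfolding compl by auto
  moreover have "inj_on (map_prod \<pi> \<pi>) A" for A
    using prod.inj_map[OF inj inj] by (rule inj_on_subset) simp
  ultimately have "(\<Prod>(a, b)\<in>\<pi> ` S \<times> ({1..n} - \<pi> ` S). pair_factor r a b (x a - x b))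
      = (\<Prod>(a, b)\<in>S \<times> ({1..n} - S). pair_factor r (\<pi> a) (\<pi> b) (x (\<pi> a) - x (\<pi> b)))"
    by (simp add: prod.reindex case_prod_unfold)
  also have "\<dots> = (\<Prod>(a, b)\<in>S \<times> ({1..n} - S). pair_factor r a b (x (\<pi> a) - x (\<pi> b)))"
  proof (rule prod.cong[OF refl], clarify)
    fix a b assume "a \<in> S" "b \<in> {1..n}" "b \<notin> S"
    then show "pair_factor r (\<pi> a) (\<pi> b) (x (\<pi> a) - x (\<pi> b)) = pair_factor r a b (x (\<pi> a) - x (\<pi> b))"
      using par[of a] par[of b] sub by (auto simp: pair_factor_def)
  qed
  finally show "step_coef n r S (x \<circ> \<pi>) = step_coef n r (\<pi> ` S) x"
    using inj by (simp add: step_coef_def same prod.reindex inj_on_subset)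
qed

lemma step_permute_bij:
  assumes "\<pi> \<in> parity_perms n"
  shows "bij_betw (image \<pi>) (steps n) (steps n)"
proof -
  have "inj_on (image \<pi>) (steps n)"
    using parity_perms_inj[OF assms] by (auto intro!: inj_onI simp: inj_image_eq_iff)
  moreover have "image \<pi> ` steps n \<subseteq> steps n" using step_permute(1)[OF assms] by blast
  ultimately show ?thesis using endo_inj_surj[OF finite_steps] by (simp add: bij_betw_def)
qed

text \<open>A sum over all steps has at most simple poles along the hyperplanes \<open>x a = x b\<close>, and
  by invariance under the reflection in such a hyperplane its residue vanishes.\<close>

lemma step_sum_polyfun:
  fixes r :: "'a::field_char_0"
  assumes K: "\<And>S. S \<in> steps n \<Longrightarrow> polyfun n e (K S)"
    and equiv: "\<And>S \<pi> x. S \<in> steps n \<Longrightarrow> \<pi> \<in> parity_perms n \<Longrightarrow> K S (x \<circ> \<pi>) = K (\<pi> ` S) x"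
  obtains G where "polyfun n (e + 1) G" "Winv n G"
    "\<And>x. regular n x \<Longrightarrow> G x = (\<Sum>S\<in>steps n. step_coef n r S x * K S x)"
proof -
  let ?T = "par_pairs n"
  define LK where "LK x = (\<Sum>S\<in>steps n. step_coef n r S x * K S x)" for x
  have LK_inv: "LK (x \<circ> \<pi>) = LK x" if \<pi>: "\<pi> \<in> parity_perms n" for \<pi> x
  proof -
    have "LK (x \<circ> \<pi>) = (\<Sum>S\<in>steps n. step_coef n r (\<pi> ` S) x * K (\<pi> ` S) x)"
      unfolding LK_def by (rule sum.cong) (simp_all add: step_permute(2)[OF \<pi>] equiv \<pi>)
    also have "\<dots> = LK x"
      unfolding LK_def by (rule sum.reindex_bij_betw[OF step_permute_bij[OF \<pi>]])
    finally show ?thesis .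
  qed
  have "\<exists>N. \<forall>S\<in>steps n. polyfun n (int (card ?T) + 1) (N S)
      \<and> (\<forall>x. regular n x \<longrightarrow> N S x = vdm ?T x * step_coef n r S x)"
    by (rule bchoice) (metis vdm_step_coef)
  then obtain N where N: "\<And>S. S \<in> steps n \<Longrightarrow> polyfun n (int (card ?T) + 1) (N S)"
    "\<And>S x. S \<in> steps n \<Longrightarrow> regular n x \<Longrightarrow> N S x = vdm ?T x * step_coef n r S x" by blast
  define F where "F x = (\<Sum>S\<in>steps n. N S x * K S x)" for x
  have F: "polyfun n (int (card ?T) + 1 + e) F"
    unfolding F_def by (intro polyfun_sum polyfun_mult N K)
  have F_reg: "F x = vdm ?T x * LK x" if "regular n x" for x
    by (simp add: F_def LK_def N(2) that sum_distrib_left mult.assoc)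
  \<comment> \<open>A generic point of the hyperplane: all coordinates are distinct except that b
    receives the value of a.\<close>
  have pt: "\<exists>y::nat \<Rightarrow> 'a. y a = y b \<and> (\<forall>(c, d)\<in>?T - {(a, b)}. y c \<noteq> y d)" if ab: "(a, b) \<in> ?T" for a b
    using ab by (intro exI[of _ "\<lambda>i. of_nat (if i = b then a else i)"]) (auto simp: par_pairs_def split: if_splits)
  have F0: "F x = 0" if ab: "(a, b) \<in> ?T" and x: "x a = x b" for a b x
  proof -
    let ?t = "Transposition.transpose a b" and ?T' = "?T - {(a, b)}"
    have t: "?t \<in> parity_perms n"
      using ab by (intro transpose_parity_perms) (auto simp: par_pairs_def)
    have vdm: "vdm ?T y = (y a - y b) * vdm ?T' y" for y :: "nat \<Rightarrow> 'a"
      unfolding vdm_def by (subst prod.remove[OF finite_par_pairs ab]) simp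
    have V': "polyfun n (int (card ?T')) (vdm ?T')" by (rule polyfun_vdm) auto
    \<comment> \<open>Off the poles \<open>F\<close> is the Vandermonde product times the invariant
      sum \<open>LK\<close>, and the factor y a - y b changes sign under the reflection. Q = 0
      states this antisymmetry without division; on y a = y b it reads 2 * F y * vdm ?T' y =
      0.\<close>
    define Q where "Q y = F y * vdm ?T' (y \<circ> ?t) + F (y \<circ> ?t) * vdm ?T' y" for y
    have "Q y = 0" for y
    proof (rule vdm_cancel[where F = Q])
      show "polyfun n (int (card ?T) + 1 + e + int (card ?T')) Q"
        unfolding Q_def by (intro polyfun.add polyfun_mult F V' polyfun_parity_perm[OF F t] polyfun_parity_perm[OF V' t])
      show "Q y = 0" if "regular n y" for y
        unfolding Q_def F_reg[OF that] F_reg[OF regular_permute[OF t that]] LK_inv[OF t] vdm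
        by (simp add: algebra_simps)
    qed
    then have FV: "F y * vdm ?T' y = 0" if "y a = y b" for y
    proof -
      have "y \<circ> ?t = y" using that by (auto simp: fun_eq_iff transpose_def)
      then have "2 * (F y * vdm ?T' y) = Q y" by (simp add: Q_def)
      then show ?thesis using \<open>\<And>y. Q y = 0\<close> by simp
    qed
    let ?s = "\<lambda>y. y(b := y a)"
    have s: "polyfun n 1 (\<lambda>y. ?s y i)" if "i \<in> {1..n}" for i
      using that ab by (intro polyfun_upd polyfun_var) (auto simp: par_pairs_def)
    obtain y :: "nat \<Rightarrow> 'a" where y: "y a = y b" "\<forall>(c, d)\<in>?T'. y c \<noteq> y d" using pt[OF ab] by blast
    have "F (?s x) = 0"
    proof (rule polyfun_mult_eq_0[OF polyfun_subst[OF V' s] polyfun_subst[OF F s]])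
      show "vdm ?T' (?s x) * F (?s x) = 0" for x
        using FV[of "?s x"] ab by (auto simp: mult.commute par_pairs_def)
      have "?s y = y" using y(1) by auto
      then show "vdm ?T' (?s y) \<noteq> 0" using y(2) unfolding vdm_def case_prod_unfold by simp
    qed
    moreover have "?s x = x" using x by auto
    ultimately show ?thesis by simp
  qed
  obtain G where G: "polyfun n (int (card ?T) + 1 + e - int (card ?T)) G"
    "\<And>x. F x = (\<Prod>p\<in>?T. x (fst p) - x (snd p)) * G x"
  proof (rule polyfun_divide_prod[OF finite_par_pairs F, where a = fst and c = "\<lambda>p x. x (snd p)"])
    show "\<exists>x::nat \<Rightarrow> 'a. x (fst p) = x (snd p) \<and> x (fst q) \<noteq> x (snd q)"
      if "p \<in> ?T" "q \<in> ?T" "p \<noteq> q" for p q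
    proof -
      obtain y :: "nat \<Rightarrow> 'a" where y: "y (fst p) = y (snd p)" "\<forall>(c, d)\<in>?T - {p}. y c \<noteq> y d"
        using pt[of "fst p" "snd p"] \<open>p \<in> ?T\<close> by auto
      have "q \<in> ?T - {p}" using that by blast
      with y(2) have "y (fst q) \<noteq> y (snd q)" by (auto simp: case_prod_unfold)
      with y(1) show ?thesis by blast
    qed
    show "F x = 0" if "p \<in> ?T" "x (fst p) = x (snd p)" for p x
      using F0[of "fst p" "snd p" x] that by simp
  qed (auto simp: par_pairs_def intro!: polyfun_var)
  have G_reg: "G x = LK x" if "regular n x" for x
    using G(2)[of x] F_reg[OF that] vdm_nonzero[OF that] by (simp add: vdm_def case_prod_unfold)
  have G': "polyfun n (e + 1) G" using G(1) by (simp add: add.commute)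
  have "Winv n G"
    unfolding Winv_def
  proof (intro ballI allI)
    fix \<pi> x assume \<pi>: "\<pi> \<in> parity_perms n"
    have "G (x \<circ> \<pi>) - G x = 0"
    proof (rule vdm_cancel[where F = "\<lambda>x. G (x \<circ> \<pi>) - G x"])
      show "polyfun n (e + 1) (\<lambda>x. G (x \<circ> \<pi>) - G x)"
        by (intro polyfun_diff G' polyfun_parity_perm[OF G' \<pi>])
      show "G (x \<circ> \<pi>) - G x = 0" if "regular n x" for x
        using G_reg[OF that] G_reg[OF regular_permute[OF \<pi> that]] LK_inv[OF \<pi>] by simp
    qed
    then show "G (x \<circ> \<pi>) = G x" by simp
  qed
  then show ?thesis using that G' G_reg unfolding LK_def by blast
qed

section \<open>Steps on the lattice and their boundary\<close>

definition add_step :: "nat set \<Rightarrow> (nat \<Rightarrow> nat) \<Rightarrow> nat \<Rightarrow> nat" where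
  "add_step S l i = l i + (if i \<in> S then 1 else 0)"

lemma Lam_adjacentI:
  assumes "\<And>a. 1 \<le> a \<Longrightarrow> a < n \<Longrightarrow> l (Suc a) \<le> l a" "\<And>i. i \<notin> {1..n} \<Longrightarrow> l i = 0"
  shows "l \<in> Lam n"
proof -
  have "l j \<le> l i" if "i \<le> j" "1 \<le> i" "j \<le> n" for i j
    using that
  proof (induction j rule: dec_induct)
    case (step j)
    then show ?case using assms(1)[of j] by simp
  qed simp
  then show ?thesis using assms(2) by (auto simp: Lam_def)
qed

lemma LamD: "l \<in> Lam n \<Longrightarrow> 1 \<le> i \<Longrightarrow> i \<le> j \<Longrightarrow> j \<le> n \<Longrightarrow> l j \<le> l i"
  and Lam_outside: "l \<in> Lam n \<Longrightarrow> i \<notin> {1..n} \<Longrightarrow> l i = 0"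
  unfolding Lam_def by auto

lemma steps_subset: "S \<in> steps n \<Longrightarrow> S \<subseteq> {1..n}"
  by (simp add: steps_def)

lemma odd_size_add_step:
  assumes "S \<in> steps n"
  shows "odd_size n (add_step S l) = odd_size n l + 1"
proof -
  let ?O = "{i. i \<in> {1..n} \<and> odd i}"
  have "odd_size n (add_step S l) = odd_size n l + (\<Sum>i\<in>?O. if i \<in> S then 1 else 0)"
    by (simp add: odd_size_def add_step_def sum.distrib)
  also have "(\<Sum>i\<in>?O. if i \<in> S then 1 else 0) = card {i \<in> ?O. i \<in> S}"
    by (simp flip: sum.inter_filter)
  also have "{i \<in> ?O. i \<in> S} = {i \<in> S. odd i}" using steps_subset[OF assms] by auto
  also have "card \<dots> = 1" using assms by (simp add: steps_def)
  finally show ?thesis .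
qed

lemma lat_diff:
  assumes "l \<in> Lam n" "1 \<le> a" "a \<le> b" "b \<le> n"
  shows "lat n r s l a - lat n r s l b = of_nat (b - a) * r + of_nat (l a - l b)"
proof -
  obtain c where c: "l a = l b + c" using LamD[OF assms] le_Suc_ex by blast
  obtain e where e: "b = a + e" using assms(3) le_Suc_ex by blast
  then have "n - a = (n - b) + e" using assms(4) by simp
  then show ?thesis unfolding lat_def by (simp add: c e algebra_simps)
qed

lemma lat_add_step: "(\<lambda>i. lat n r s (add_step S l) i - (if i \<in> S then 1 else 0)) = lat n r s l"
  by (auto simp: lat_def add_step_def)

lemma lat_neg_add_step: "(\<lambda>i. - lat n r s l i - (if i \<in> S then 1 else 0)) = (\<lambda>i. - lat n r s (add_step S l) i)"
  by (auto simp: lat_def add_step_def)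

lemma step_coef_pair_zero:
  assumes "a \<in> S" "b \<in> {1..n} - S" "S \<in> steps n" "a mod 2 \<noteq> b mod 2" "x a - x b = r"
  shows "step_coef n r S x = 0"
proof -
  have "(\<Prod>(a, b)\<in>S \<times> ({1..n} - S). pair_factor r a b (x a - x b)) = 0"
    using assms finite_step[OF assms(3)]
    by (intro prod_zero bexI[of _ "(a, b)"]) (auto simp: pair_factor_def)
  then show ?thesis by (simp add: step_coef_def)
qed

lemma mod2_Suc_neq: "Suc a mod 2 \<noteq> a mod 2" "a mod 2 \<noteq> Suc a mod 2"
  by (auto simp: mod2_eq_if)

text \<open>Lowering l along S fails only at some a in S with l a = l (a + 1) and a + 1 not in S,
  where x a - x (a + 1) = r, or at a = n with l n = 0, where x n = 0. Either way a factor of the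
  coefficient vanishes.\<close>

lemma step_down_cases:
  assumes l: "l \<in> Lam n" and S: "S \<in> steps n"
  obtains k where "k \<in> Lam n" "l = add_step S k" | "step_coef n r S (lat n r 0 l) = 0"
proof (cases "\<exists>a\<in>S. if a = n then l n = 0 else Suc a \<notin> S \<and> l a = l (Suc a)")
  case True
  then obtain a where a: "a \<in> S" "if a = n then l n = 0 else Suc a \<notin> S \<and> l a = l (Suc a)" by blast
  have an: "a \<in> {1..n}" using a(1) steps_subset[OF S] by blast
  show ?thesis
  proof (cases "a = n")
    case True
    then have "lat n r 0 l a = 0" "a \<in> S \<inter> same_par n"
      using a an by (auto simp: lat_def same_par_def)
    then have "(\<Prod>a\<in>S \<inter> same_par n. lat n r 0 l a) = 0"
      by (intro prod_zero) auto
    then show ?thesis using that(2) by (simp add: step_coef_def)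
  next
    case False
    then have "lat n r 0 l a - lat n r 0 l (Suc a) = r"
      using an a lat_diff[OF l, of a "Suc a" r 0] by auto
    moreover have "Suc a \<in> {1..n} - S" using a an False by auto
    ultimately show ?thesis
      using that(2) step_coef_pair_zero[OF a(1) _ S mod2_Suc_neq(2)] by blast
  qed
next
  case False
  have pos: "l i \<noteq> 0" if "i \<in> S" for i
  proof -
    have "i \<le> n" using that steps_subset[OF S] by auto
    then have "i \<in> S \<longrightarrow> l i \<noteq> 0"
    proof (induction i rule: inc_induct)
      case base
      then show ?case using False by auto
    next
      case (step i)
      show ?case
      proof
        assume i: "i \<in> S"
        then have "l (Suc i) \<le> l i" using LamD[OF l, of i "Suc i"] steps_subset[OF S] step by auto
        then show "l i \<noteq> 0" using i step False by (cases "Suc i \<in> S") auto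
      qed
    qed
    then show ?thesis using that by blast
  qed
  define k where "k i = (if i \<in> S then l i - 1 else l i)" for i
  have lk: "l = add_step S k"
    using pos by (auto simp: fun_eq_iff add_step_def k_def)
  have "k \<in> Lam n"
  proof (rule Lam_adjacentI)
    fix a assume a: "1 \<le> a" "a < n"
    then have "l (Suc a) \<le> l a" by (intro LamD[OF l]) auto
    moreover have "l a \<noteq> l (Suc a)" if "a \<in> S" "Suc a \<notin> S" using False that a by auto
    ultimately show "k (Suc a) \<le> k a"
      by (cases "a \<in> S"; cases "Suc a \<in> S") (auto simp: k_def)
  next
    fix i assume "i \<notin> {1..n}"
    then show "k i = 0" using Lam_outside[OF l] by (simp add: k_def)
  qed
  then show ?thesis using that(1) lk by blast
qed

text \<open>Raising fails only where a + 1 is raised without a although the two parts agree. The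
  negation turns the difference into x (a + 1) - x a = r, so again a factor vanishes, for every
  offset s.\<close>

lemma step_up_boundary:
  assumes l: "l \<in> Lam n" and S: "S \<in> steps n" and "add_step S l \<notin> Lam n"
  shows "step_coef n r S (\<lambda>i. - lat n r s l i) = 0"
proof -
  have "\<exists>a. 1 \<le> a \<and> a < n \<and> \<not> add_step S l (Suc a) \<le> add_step S l a"
  proof (rule ccontr)
    assume "\<nexists>a. 1 \<le> a \<and> a < n \<and> \<not> add_step S l (Suc a) \<le> add_step S l a"
    then have "add_step S l \<in> Lam n"
      using Lam_outside[OF l] steps_subset[OF S] by (intro Lam_adjacentI) (auto simp: add_step_def)
    then show False using assms(3) by blast
  qed
  then obtain a where a: "1 \<le> a" "a < n" "\<not> add_step S l (Suc a) \<le> add_step S l a" by blast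
  moreover have "l (Suc a) \<le> l a" using a by (intro LamD[OF l]) auto
  ultimately have *: "Suc a \<in> S" "a \<notin> S" "l (Suc a) = l a"
    by (auto simp: add_step_def split: if_splits)
  then have "- lat n r s l (Suc a) - - lat n r s l a = r"
    using a lat_diff[OF l, of a "Suc a" r s] by simp
  then show ?thesis
    using * a by (intro step_coef_pair_zero[OF *(1) _ S mod2_Suc_neq(1)]) auto
qed

section \<open>The sum of the step coefficients\<close>

locale semisym =
  fixes n :: nat and r :: "'a::field_char_0"
  assumes n1: "1 \<le> n" and r_nonneg: "\<And>q::rat. q < 0 \<Longrightarrow> r \<noteq> of_rat q" and r0: "r \<noteq> 0"
begin

abbreviation pt :: "(nat \<Rightarrow> nat) \<Rightarrow> nat \<Rightarrow> 'a" where
  "pt l \<equiv> lat n r 0 l"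

text \<open>Here r \<noteq> 0 enters. It excludes b = 0 with a \<noteq> 0, so different coordinates
  of a lattice point never coincide.\<close>

lemma lin_zero: "of_nat a * r + of_nat b = 0 \<Longrightarrow> a = 0 \<and> b = 0"
  using lat_eq_0_iff[OF r_nonneg, of a b] r0 by auto

lemma regular_pt:
  assumes l: "l \<in> Lam n"
  shows "regular n (lat n r s l)"
proof -
  have *: "lat n r s l a \<noteq> lat n r s l b" if "a \<in> {1..n}" "b \<in> {1..n}" "a < b" for a b
    using lat_diff[OF l, of a b r s] lin_zero[of "b - a" "l a - l b"] that by auto
  show ?thesis unfolding regular_def
    by (intro ballI impI) (metis * nat_neq_iff)
qed

lemma regular_neg_pt: "l \<in> Lam n \<Longrightarrow> regular n (\<lambda>i. - lat n r s l i)"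
  using regular_pt[of l s] by (simp add: regular_def)

definition h :: "(nat \<Rightarrow> 'a) \<Rightarrow> 'a" where
  "h x = (\<Sum>i | i \<in> {1..n} \<and> odd i. x i - of_nat (n - i) * r)"

lemma h_pt: "h (pt l) = of_nat (odd_size n l)"
  by (simp add: h_def lat_def odd_size_def)

lemma polyfun_h: "polyfun n 1 h"
  unfolding h_def by (intro polyfun_sum polyfun_diff polyfun_var polyfun.const) auto

lemma Winv_h: "Winv n h"
  unfolding Winv_def
proof (intro ballI allI)
  fix \<pi> and x :: "nat \<Rightarrow> 'a" assume "\<pi> \<in> parity_perms n"
  from parity_perms_bij[OF this, of 1] have "bij_betw \<pi> {i \<in> {1..n}. odd i} {i \<in> {1..n}. odd i}"
    by (simp add: odd_iff_mod_2_eq_one)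
  from sum.reindex_bij_betw[OF this, of x] show "h (x \<circ> \<pi>) = h x"
    by (simp add: h_def sum_subtractf)
qed

lemma zero_in_Lam: "(\<lambda>_. 0) \<in> Lam n"
  by (simp add: Lam_def)

lemma odd_size_0: "odd_size n (\<lambda>_. 0) = 0"
  by (simp add: odd_size_def)

lemma odd_size_eq_0:
  assumes "l \<in> Lam n" "odd_size n l = 0"
  shows "l = (\<lambda>_. 0)"
proof
  fix i
  have "l 1 = 0" using assms(2) n1 by (auto simp: odd_size_def)
  then show "l i = 0"
    using LamD[OF assms(1), of 1 i] Lam_outside[OF assms(1), of i] by (cases "i \<in> {1..n}") auto
qed

text \<open>For the two lattice points of size one the products telescope.\<close>

lemma step_coef_first:
  assumes S: "S \<in> steps n" and l: "add_step S (\<lambda>_. 0) \<in> Lam n"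
  shows "step_coef n r S (pt (add_step S (\<lambda>_. 0))) = 1"
proof -
  let ?x = "pt (add_step S (\<lambda>_. 0))"
  \<comment> \<open>All differences of coordinates that occur have this form. The relation c (k + 1)
    - r = c k lets the factors of opposite parity cancel the denominators of equal parity.\<close>
  define c where "c k = of_nat k * r + 1" for k
  have c0: "c k \<noteq> 0" for k using lin_zero[of k 1] by (auto simp: c_def)
  have mem: "j \<in> S" if "1 \<le> i" "i \<in> S" "1 \<le> j" "j \<le> i" for i j
    using LamD[OF l, of j i] that steps_subset[OF S] by (auto simp: add_step_def split: if_splits)
  obtain i where i: "{i \<in> S. odd i} = {i}" using S by (auto simp: steps_def card_1_singleton_iff)
  then have "i \<in> S" by blast
  then have "1 \<le> i" using steps_subset[OF S] by auto
  then have "1 \<in> S" using mem[OF _ \<open>i \<in> S\<close>, of 1] by simp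
  then have "1 \<in> {i \<in> S. odd i}" by simp
  then have "1 = i" unfolding i by simp
  with i have odd1: "{i \<in> S. odd i} = {1}" by (simp only:)
  have "S \<subseteq> {1, 2}"
  proof
    fix j assume j: "j \<in> S"
    have "\<not> 3 \<le> j"
    proof
      assume "3 \<le> j"
      then have "3 \<in> S" using mem[of j 3] j by auto
      then have "3 \<in> {i \<in> S. odd i}" by simp
      then show False unfolding odd1 by simp
    qed
    then show "j \<in> {1, 2}" using j steps_subset[OF S] by fastforce
  qed
  with \<open>1 \<in> S\<close> consider "S = {1}" | "S = {1, 2}" by blast
  then show ?thesis
  proof cases
    case 1
    define g where "g b = pair_factor r 1 b (?x 1 - ?x b)" for b
    have x1: "?x 1 = c (n - 1)" by (simp add: lat_def add_step_def 1 c_def)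
    have d: "?x 1 - ?x b = c (b - 1)" if "b \<in> {2..n}" for b
      using lat_diff[OF l, of 1 b r 0] that by (auto simp: add_step_def 1 c_def)
    have g: "g b = (if odd b then inverse (c (b - 1)) else c (b - 2))" if b: "b \<in> {2..n}" for b
    proof -
      have "b - 1 = Suc (b - 2)" using b by auto
      then have "c (b - 1) - r = c (b - 2)" by (simp add: c_def algebra_simps)
      then show ?thesis unfolding g_def d[OF b]
        by (auto simp: pair_factor_def odd_iff_mod_2_eq_one even_iff_mod_2_eq_zero)
    qed
    have "m \<le> n \<Longrightarrow> (\<Prod>b=2..m. g b) = (if odd m then inverse (c (m - 1)) else 1)" if "1 \<le> m" for m
      using that
    proof (induction m rule: dec_induct)
      case base
      then show ?case by (simp add: c_def)
    next
      case (step m)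
      then have "{2..Suc m} = insert (Suc m) {2..m}" by auto
      then have "(\<Prod>b=2..Suc m. g b) = g (Suc m) * (\<Prod>b=2..m. g b)" by simp
      then show ?case using step g[of "Suc m"] c0[of "m - 1"] by (cases "odd m") simp_all
    qed
    from this[OF n1 order_refl] have "(\<Prod>b=2..n. g b) = (if odd n then inverse (c (n - 1)) else 1)" .
    moreover have "S \<times> ({1..n} - S) = Pair 1 ` {2..n}" by (auto simp: 1)
    then have "(\<Prod>(a, b)\<in>S \<times> ({1..n} - S). pair_factor r a b (?x a - ?x b)) = (\<Prod>b=2..n. g b)"
      by (simp add: prod.reindex inj_on_def g_def del: One_nat_def)
    moreover have "S \<inter> same_par n = (if odd n then {1} else {})"
      using n1 by (auto simp: 1 same_par_def odd_iff_mod_2_eq_one even_iff_mod_2_eq_zero)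
    ultimately show ?thesis using c0[of "n - 1"] x1 by (simp add: step_coef_def)
  next
    case 2
    then have n2: "2 \<le> n" using steps_subset[OF S] by auto
    define g where "g b = pair_factor r 1 b (?x 1 - ?x b) * pair_factor r 2 b (?x 2 - ?x b)" for b
    have x1: "?x 1 = c (n - 1)" "?x 2 = c (n - 2)" by (simp_all add: lat_def add_step_def 2 c_def)
    have d: "?x 1 - ?x b = c (b - 1)" "?x 2 - ?x b = c (b - 2)" if "b \<in> {3..n}" for b
      using lat_diff[OF l, of 1 b r 0] lat_diff[OF l, of 2 b r 0] that by (auto simp: add_step_def 2 c_def)
    have g: "g b = (if odd b then inverse (c (b - 1)) * c (b - 3) else 1)" if b: "b \<in> {3..n}" for b
    proof -
      have "b - 1 = Suc (b - 2)" "b - 2 = Suc (b - 3)" using b by auto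
      then have "c (b - 1) - r = c (b - 2)" "c (b - 2) - r = c (b - 3)" by (simp_all add: c_def algebra_simps)
      then show ?thesis unfolding g_def d[OF b] using c0
        by (auto simp: pair_factor_def odd_iff_mod_2_eq_one even_iff_mod_2_eq_zero)
    qed
    have "m \<le> n \<Longrightarrow> (\<Prod>b=3..m. g b) = inverse (c (if odd m then m - 1 else m - 2))" if "2 \<le> m" for m
      using that
    proof (induction m rule: dec_induct)
      case base
      then show ?case by (simp add: c_def)
    next
      case (step m)
      then have "{3..Suc m} = insert (Suc m) {3..m}" by auto
      then have "(\<Prod>b=3..Suc m. g b) = g (Suc m) * (\<Prod>b=3..m. g b)" by simp
      then show ?case using step g[of "Suc m"] c0[of "m - 2"] c0[of "m - 1"]
        by (cases "odd m") simp_all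
    qed
    from this[OF n2 order_refl] have "(\<Prod>b=3..n. g b) = inverse (c (if odd n then n - 1 else n - 2))" .
    moreover have "{1..n} - S = {3..n}" by (auto simp: 2)
    then have "(\<Prod>(a, b)\<in>S \<times> ({1..n} - S). pair_factor r a b (?x a - ?x b)) = (\<Prod>b=3..n. g b)"
      unfolding g_def prod.distrib 2 by (simp flip: prod.cartesian_product)
    moreover have "S \<inter> same_par n = (if odd n then {1} else {2})"
      using n1 n2 by (auto simp: 2 same_par_def odd_iff_mod_2_eq_one even_iff_mod_2_eq_zero)
    ultimately show ?thesis using c0 x1 by (simp add: step_coef_def)
  qed
qed

lemma add_step_inj: "add_step S k = add_step S' k \<Longrightarrow> S = S'"
  by (auto simp: add_step_def fun_eq_iff split: if_splits)

text \<open>The sum is an invariant polynomial of degree at most one, determined by its values at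
  the lattice points of size at most one. There only a step down to the zero partition can
  contribute, and it contributes 1.\<close>

lemma sum_step_coef:
  assumes "regular n x"
  shows "(\<Sum>S\<in>steps n. step_coef n r S x) = h x"
proof -
  obtain G where G: "polyfun n (0 + 1) G" "Winv n G"
    "\<And>x. regular n x \<Longrightarrow> G x = (\<Sum>S\<in>steps n. step_coef n r S x * 1)"
    by (rule step_sum_polyfun[of n 0 "\<lambda>_ _. 1" r]) (auto intro: polyfun.const)
  have "G x - h x = 0"
  proof (rule interpolation_zero[OF r_nonneg, where F = "\<lambda>x. G x - h x" and n = n and d = 1 and s = 0])
    show "polyfun n 1 (\<lambda>x. G x - h x)" using G(1) polyfun_h by (auto intro: polyfun_diff)
    show "Winv n (\<lambda>x. G x - h x)" by (rule Winv_diff[OF G(2) Winv_h])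
    fix \<mu> assume \<mu>: "\<mu> \<in> Lam n" "int (odd_size n \<mu>) \<le> 1"
    have G\<mu>: "G (pt \<mu>) = (\<Sum>S\<in>steps n. step_coef n r S (pt \<mu>))"
      using G(3)[OF regular_pt[OF \<mu>(1)]] by simp
    have nz: "\<mu> = add_step S (\<lambda>_. 0)" if S: "S \<in> steps n" "step_coef n r S (pt \<mu>) \<noteq> 0" for S
    proof -
      obtain k where k: "k \<in> Lam n" "\<mu> = add_step S k"
        using step_down_cases[OF \<mu>(1) S(1), where r = r] S(2) by blast
      then have "odd_size n k = 0" using \<mu>(2) odd_size_add_step[OF S(1), of k] by simp
      then show ?thesis using odd_size_eq_0[OF k(1)] k(2) by simp
    qed
    show "G (pt \<mu>) - h (pt \<mu>) = 0"
    proof (cases "\<exists>S\<in>steps n. step_coef n r S (pt \<mu>) \<noteq> 0")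
      case True
      then obtain S where S: "S \<in> steps n" "step_coef n r S (pt \<mu>) \<noteq> 0" by blast
      have "step_coef n r S (pt \<mu>) = 1"
        using step_coef_first[OF S(1)] \<mu>(1) unfolding nz[OF S, symmetric] by blast
      moreover have "step_coef n r S' (pt \<mu>) = 0" if "S' \<in> steps n" "S' \<noteq> S" for S'
        using nz[OF S] nz[OF that(1)] add_step_inj[of S' "\<lambda>_. 0" S] that(2) by metis
      ultimately have "step_coef n r S' (pt \<mu>) = (if S' = S then 1 else 0)" if "S' \<in> steps n" for S'
        using that by simp
      then have "G (pt \<mu>) = (\<Sum>S'\<in>steps n. if S' = S then 1 else 0)" unfolding G\<mu> by (intro sum.cong) auto
      then show ?thesis
        using S(1) finite_steps[of n] odd_size_add_step[OF S(1), of "\<lambda>_. 0"]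
        unfolding nz[OF S, symmetric] by (simp add: h_pt odd_size_0)
    next
      case False
      \<comment> \<open>A point of size one is the indicator of a step, whose coefficient there is
        1; so if all coefficients vanish, the size is 0.\<close>
      have "odd_size n \<mu> = 0"
      proof (rule ccontr)
        assume "odd_size n \<mu> \<noteq> 0"
        then obtain a where "a \<in> {1..n}" "\<mu> a \<noteq> 0" unfolding odd_size_def by (auto elim!: sum.not_neutral_contains_not_neutral)
        then have \<mu>1: "\<mu> 1 \<noteq> 0" using LamD[OF \<mu>(1), of 1 a] by auto
        have sum1: "odd_size n \<mu> = \<mu> 1 + (\<Sum>i\<in>{i. i \<in> {1..n} \<and> odd i} - {1}. \<mu> i)"
          unfolding odd_size_def using n1 by (subst sum.remove[of _ 1]) auto
        moreover have "odd_size n \<mu> \<le> 1" using \<mu>(2) by simp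
        ultimately have "\<mu> 1 = 1" "(\<Sum>i\<in>{i. i \<in> {1..n} \<and> odd i} - {1}. \<mu> i) = 0"
          using \<mu>1 by linarith+
        then have a: "\<mu> 1 = 1" "\<And>i. i \<in> {1..n} \<Longrightarrow> odd i \<Longrightarrow> i \<noteq> 1 \<Longrightarrow> \<mu> i = 0"
          by auto
        have b: "\<mu> i = 0" if "3 \<le> i" for i
          using LamD[OF \<mu>(1), of 3 i] Lam_outside[OF \<mu>(1), of i] a(2)[of 3] that by (cases "i \<le> n") auto
        have c: "\<mu> 2 \<le> 1" using LamD[OF \<mu>(1), of 1 2] a(1) Lam_outside[OF \<mu>(1), of 2] by (cases "2 \<le> n") auto
        define S where "S = {i. \<mu> i \<noteq> 0}"
        have S12: "S \<subseteq> {1, 2}"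
        proof
          fix i assume i: "i \<in> S"
          then have "i \<noteq> 0" using Lam_outside[OF \<mu>(1), of 0] by (cases "i = 0") (auto simp: S_def)
          moreover have "\<not> 3 \<le> i" using b[of i] i by (auto simp: S_def)
          ultimately show "i \<in> {1, 2}" by auto
        qed
        have \<mu>S: "\<mu> = add_step S (\<lambda>_. 0)"
        proof
          fix i show "\<mu> i = add_step S (\<lambda>_. 0) i"
            using S12 a(1) c by (cases "i = 1"; cases "i = 2") (auto simp: add_step_def S_def)
        qed
        have "S \<in> steps n"
        proof -
          have "{i \<in> S. odd i} = {1}" using S12 a(1) by (auto simp: S_def)
          moreover have "{i \<in> S. even i} \<subseteq> {2}" using S12 by auto
          then have "card {i \<in> S. even i} \<le> 1" using card_mono[of "{2}" "{i \<in> S. even i}"] by simp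
          moreover have "S \<subseteq> {1..n}"
          proof (rule subsetI, rule ccontr)
            fix i assume i: "i \<in> S" "i \<notin> {1..n}"
            have "\<mu> i = 0" by (rule Lam_outside[OF \<mu>(1) i(2)])
            then show False using i(1) by (simp add: S_def)
          qed
          ultimately show ?thesis by (simp add: steps_def)
        qed
        then show False using False step_coef_first[of S] \<mu>S \<mu>(1) by auto
      qed
      then show ?thesis using False by (simp add: G\<mu> h_pt)
    qed
  qed
  then show ?thesis using G(3)[OF assms] by simp
qed

end

section \<open>Multiplication in the interpolation basis\<close>

context semisym
begin

definition Rt :: "(nat \<Rightarrow> nat) \<Rightarrow> (nat \<Rightarrow> 'a) \<Rightarrow> 'a" where
  "Rt l x = eval_poly x (R_poly n r l) / eval_poly (pt l) (R_poly n r l)"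

definition ball :: "nat \<Rightarrow> (nat \<Rightarrow> nat) set" where
  "ball d = {\<mu> \<in> Lam n. odd_size n \<mu> \<le> d}"

lemma finite_ball [simp]: "finite (ball d)"
  unfolding ball_def by (rule finite_Lam_le)

lemma vanishing:
  assumes "polyfun n d F" "Winv n F" "\<And>\<mu>. \<mu> \<in> Lam n \<Longrightarrow> int (odd_size n \<mu>) \<le> d \<Longrightarrow> F (pt \<mu>) = 0"
  shows "F x = 0"
  using interpolation_zero[OF r_nonneg assms(1,2), where s = 0] assms(3) by blast

lemma is_R: "l \<in> Lam n \<Longrightarrow> is_R n r l (R_poly n r l)"
  by (rule is_R_R_poly[OF r_nonneg])

text \<open>Vanishing at its own point as well would make the polynomial zero, against its
  coefficient 1. This justifies the division in \<open>Rt\<close>.\<close>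

lemma R_nonzero:
  assumes "l \<in> Lam n"
  shows "eval_poly (pt l) (R_poly n r l) \<noteq> 0"
proof
  let ?p = "R_poly n r l"
  assume 0: "eval_poly (pt l) ?p = 0"
  note R = is_R_polyfun[OF is_R[OF assms]]
  have "eval_poly x ?p = 0" for x
  proof (rule vanishing[OF R(1,2)])
    fix \<mu> assume "\<mu> \<in> Lam n" "int (odd_size n \<mu>) \<le> int (odd_size n l)"
    then show "eval_poly (pt \<mu>) ?p = 0" using R(3)[of \<mu>] 0 by (cases "\<mu> = l") auto
  qed
  then have "(\<lambda>x. eval_poly x ?p) = (\<lambda>x. 0)" by blast
  then show False using R(4) coef_const[of "0::'a" "bracket n l"] by (simp split: if_splits)
qed

lemma polyfun_Rt: "l \<in> Lam n \<Longrightarrow> polyfun n (int (odd_size n l)) (Rt l)"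
  unfolding Rt_def divide_inverse
  by (subst mult.commute) (intro polyfun_cmult is_R_polyfun(1)[OF is_R])

lemma Winv_Rt: "l \<in> Lam n \<Longrightarrow> Winv n (Rt l)"
  unfolding Rt_def divide_inverse by (intro Winv_mult Winv_const is_R_polyfun(2)[OF is_R])

lemma Rt_self: "l \<in> Lam n \<Longrightarrow> Rt l (pt l) = 1"
  using R_nonzero by (simp add: Rt_def)

lemma Rt_vanish: "l \<in> Lam n \<Longrightarrow> \<mu> \<in> Lam n \<Longrightarrow> odd_size n \<mu> \<le> odd_size n l \<Longrightarrow> \<mu> \<noteq> l \<Longrightarrow> Rt l (pt \<mu>) = 0"
  using is_R_polyfun(3)[OF is_R] by (simp add: Rt_def)

lemma Rt_zero: "Rt (\<lambda>_. 0) x = 1"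
proof -
  have "Rt (\<lambda>_. 0) x - 1 = 0"
  proof (rule vanishing[where F = "\<lambda>x. Rt (\<lambda>_. 0) x - 1" and d = 0])
    show "polyfun n 0 (\<lambda>x. Rt (\<lambda>_. 0) x - 1)"
      using polyfun_Rt[OF zero_in_Lam] by (intro polyfun_diff polyfun.const) (simp_all add: odd_size_0)
    show "Winv n (\<lambda>x. Rt (\<lambda>_. 0) x - 1)" by (intro Winv_diff Winv_Rt zero_in_Lam Winv_const)
    fix \<mu> assume "\<mu> \<in> Lam n" "int (odd_size n \<mu>) \<le> 0"
    then show "Rt (\<lambda>_. 0) (pt \<mu>) - 1 = 0"
      using odd_size_eq_0[of \<mu>] Rt_self[OF zero_in_Lam] by simp
  qed
  then show ?thesis by simp
qed

text \<open>The operator \<open>h - L\<close>, \<open>L\<close> being the weighted sum of the shifts, does not raise the degree.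
  At lattice points \<open>L\<close> only involves values at points of smaller size, so \<open>Rt l\<close> is an
  eigenfunction.\<close>

lemma eigenfunction:
  assumes l: "l \<in> Lam n" and x: "regular n x"
  shows "(\<Sum>S\<in>steps n. step_coef n r S x * Rt l (\<lambda>i. x i - (if i \<in> S then 1 else 0)))
    = (h x - of_nat (odd_size n l)) * Rt l x"
proof -
  let ?d = "int (odd_size n l)"
  \<comment> \<open>The difference \<open>K S\<close> has one degree less than \<open>Rt l\<close>,
    which makes up for the degree one of the coefficients. Its first term sums to h *
    \<open>Rt l\<close> by \<open>sum_step_coef\<close>.\<close>
  define K where "K S x = Rt l x - Rt l (\<lambda>i. x i - (if i \<in> S then 1 else 0))" for S x
  obtain G where G: "polyfun n (?d - 1 + 1) G" "Winv n G"
    "\<And>x. regular n x \<Longrightarrow> G x = (\<Sum>S\<in>steps n. step_coef n r S x * K S x)"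
  proof (rule step_sum_polyfun[of n "?d - 1" K r])
    show "polyfun n (?d - 1) (K S)" for S
      unfolding K_def by (rule polyfun_translate_diff[OF polyfun_Rt[OF l]])
    fix S \<pi> and x :: "nat \<Rightarrow> 'a" assume \<pi>: "\<pi> \<in> parity_perms n"
    have inv: "Rt l (y \<circ> \<pi>) = Rt l y" for y using Winv_Rt[OF l] \<pi> by (simp add: Winv_def)
    have "(\<lambda>i. (x \<circ> \<pi>) i - (if i \<in> S then 1 else 0)) = (\<lambda>i. x i - (if i \<in> \<pi> ` S then 1 else 0)) \<circ> \<pi>"
      using parity_perms_inj[OF \<pi>] by (auto simp: fun_eq_iff inj_image_mem_iff)
    then show "K S (x \<circ> \<pi>) = K (\<pi> ` S) x"
      unfolding K_def by (simp only: inv)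
  qed blast
  have G_reg: "G x = h x * Rt l x - (\<Sum>S\<in>steps n. step_coef n r S x * Rt l (\<lambda>i. x i - (if i \<in> S then 1 else 0)))"
    if "regular n x" for x
    unfolding G(3)[OF that] K_def sum_step_coef[OF that, symmetric]
    by (simp only: right_diff_distrib sum_subtractf sum_distrib_right)
  have "G x - of_nat (odd_size n l) * Rt l x = 0"
  proof (rule vanishing[where F = "\<lambda>x. G x - of_nat (odd_size n l) * Rt l x"])
    show "polyfun n ?d (\<lambda>x. G x - of_nat (odd_size n l) * Rt l x)"
      using G(1) by (intro polyfun_diff polyfun_cmult polyfun_Rt l) simp
    show "Winv n (\<lambda>x. G x - of_nat (odd_size n l) * Rt l x)"
      by (intro Winv_diff Winv_mult Winv_const Winv_Rt l G(2))
    fix \<mu> assume \<mu>: "\<mu> \<in> Lam n" "int (odd_size n \<mu>) \<le> ?d"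
    have "(\<Sum>S\<in>steps n. step_coef n r S (pt \<mu>) * Rt l (\<lambda>i. pt \<mu> i - (if i \<in> S then 1 else 0))) = 0"
    proof (rule sum.neutral, rule ballI)
      fix S assume S: "S \<in> steps n"
      show "step_coef n r S (pt \<mu>) * Rt l (\<lambda>i. pt \<mu> i - (if i \<in> S then 1 else 0)) = 0"
      proof (rule step_down_cases[OF \<mu>(1) S, where r = r])
        fix k assume k: "k \<in> Lam n" "\<mu> = add_step S k"
        then have "odd_size n k < odd_size n l"
          using \<mu>(2) odd_size_add_step[OF S, of k] by simp
        then have "Rt l (pt k) = 0" using k by (intro Rt_vanish l) auto
        then show ?thesis unfolding k(2) lat_add_step by simp
      qed simp
    qed
    then have "G (pt \<mu>) = of_nat (odd_size n \<mu>) * Rt l (pt \<mu>)"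
      using G_reg[OF regular_pt[OF \<mu>(1)]] by (simp add: h_pt)
    then show "G (pt \<mu>) - of_nat (odd_size n l) * Rt l (pt \<mu>) = 0"
      using Rt_vanish[OF l \<mu>(1)] \<mu>(2) by (cases "\<mu> = l") auto
  qed
  then show ?thesis using G_reg[OF x] by (simp add: algebra_simps)
qed

text \<open>The matrix of the part of multiplication by \<open>h\<close> that raises the size. Its
  entries are plain values because \<open>h\<close> minus the size of l equals 1 at the points one
  size higher.\<close>

definition A :: "(nat \<Rightarrow> nat) \<Rightarrow> (nat \<Rightarrow> nat) \<Rightarrow> 'a" where
  "A \<mu> l = (if odd_size n \<mu> = odd_size n l + 1 then Rt l (pt \<mu>) else 0)"

text \<open>Evaluation at the lattice points is unitriangular with respect to the size.\<close>

lemma sum_Rt_at: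
  assumes "\<kappa> \<in> ball K"
  shows "(\<Sum>\<mu>\<in>ball K. c \<mu> * Rt \<mu> (pt \<kappa>))
    = c \<kappa> + (\<Sum>\<mu>\<in>{\<mu> \<in> Lam n. odd_size n \<mu> < odd_size n \<kappa>}. c \<mu> * Rt \<mu> (pt \<kappa>))"
proof -
  let ?L = "{\<mu> \<in> Lam n. odd_size n \<mu> < odd_size n \<kappa>}"
  have fin: "finite ?L" by (rule finite_subset[OF _ finite_Lam_le[of n "odd_size n \<kappa>"]]) auto
  have "(\<Sum>\<mu>\<in>ball K. c \<mu> * Rt \<mu> (pt \<kappa>)) = (\<Sum>\<mu>\<in>insert \<kappa> ?L. c \<mu> * Rt \<mu> (pt \<kappa>))"
  proof (rule sum.mono_neutral_right)
    show "insert \<kappa> ?L \<subseteq> ball K" using assms by (auto simp: ball_def)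
    show "\<forall>\<mu>\<in>ball K - insert \<kappa> ?L. c \<mu> * Rt \<mu> (pt \<kappa>) = 0"
    proof
      fix \<mu> assume "\<mu> \<in> ball K - insert \<kappa> ?L"
      then have "\<mu> \<in> Lam n" "odd_size n \<kappa> \<le> odd_size n \<mu>" "\<kappa> \<noteq> \<mu>" by (auto simp: ball_def)
      then show "c \<mu> * Rt \<mu> (pt \<kappa>) = 0" using assms Rt_vanish[of \<mu> \<kappa>] by (simp add: ball_def)
    qed
  qed simp
  also have "\<dots> = c \<kappa> + (\<Sum>\<mu>\<in>?L. c \<mu> * Rt \<mu> (pt \<kappa>))"
    using assms fin Rt_self[of \<kappa>] by (subst sum.insert) (auto simp: ball_def)
  finally show ?thesis .
qed

text \<open>The unitriangular system is solved one size at a time; agreement at the lattice points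
  of size at most K is then agreement as functions by \<open>vanishing\<close>.\<close>

lemma Rt_expansion:
  assumes F: "polyfun n (int K) F" "Winv n F"
  obtains c where "\<And>x. F x = (\<Sum>\<mu>\<in>ball K. c \<mu> * Rt \<mu> x)"
proof -
  have "\<exists>c. \<forall>\<kappa>\<in>ball K. odd_size n \<kappa> < t \<longrightarrow> F (pt \<kappa>) = (\<Sum>\<mu>\<in>ball K. c \<mu> * Rt \<mu> (pt \<kappa>))" for t
  proof (induction t)
    case (Suc t)
    then obtain c where c: "\<And>\<kappa>. \<kappa> \<in> ball K \<Longrightarrow> odd_size n \<kappa> < t \<Longrightarrow> F (pt \<kappa>) = (\<Sum>\<mu>\<in>ball K. c \<mu> * Rt \<mu> (pt \<kappa>))"
      by blast
    define c' where "c' \<kappa> = (if odd_size n \<kappa> = t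
      then F (pt \<kappa>) - (\<Sum>\<mu>\<in>{\<mu> \<in> Lam n. odd_size n \<mu> < odd_size n \<kappa>}. c \<mu> * Rt \<mu> (pt \<kappa>)) else c \<kappa>)" for \<kappa>
    have "F (pt \<kappa>) = (\<Sum>\<mu>\<in>ball K. c' \<mu> * Rt \<mu> (pt \<kappa>))" if \<kappa>: "\<kappa> \<in> ball K" "odd_size n \<kappa> < Suc t" for \<kappa>
    proof -
      have "(\<Sum>\<mu>\<in>{\<mu> \<in> Lam n. odd_size n \<mu> < odd_size n \<kappa>}. c' \<mu> * Rt \<mu> (pt \<kappa>))
          = (\<Sum>\<mu>\<in>{\<mu> \<in> Lam n. odd_size n \<mu> < odd_size n \<kappa>}. c \<mu> * Rt \<mu> (pt \<kappa>))"
        using \<kappa>(2) by (intro sum.cong) (auto simp: c'_def)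
      then show ?thesis
        unfolding sum_Rt_at[OF \<kappa>(1)] using c[OF \<kappa>(1)] \<kappa>(2) sum_Rt_at[OF \<kappa>(1), of c]
        by (cases "odd_size n \<kappa> = t") (simp_all add: c'_def)
    qed
    then show ?case by blast
  qed simp
  from this[of "Suc K"] obtain c where c: "\<And>\<kappa>. \<kappa> \<in> ball K \<Longrightarrow> F (pt \<kappa>) = (\<Sum>\<mu>\<in>ball K. c \<mu> * Rt \<mu> (pt \<kappa>))"
    by (auto simp: ball_def less_Suc_eq_le)
  have "F x - (\<Sum>\<mu>\<in>ball K. c \<mu> * Rt \<mu> x) = 0" for x
  proof (rule vanishing[where F = "\<lambda>x. F x - (\<Sum>\<mu>\<in>ball K. c \<mu> * Rt \<mu> x)"])
    have "polyfun n (int K) (Rt \<mu>)" if "\<mu> \<in> ball K" for \<mu>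
      by (rule polyfun.mono[OF polyfun_Rt]) (use that in \<open>auto simp: ball_def\<close>)
    then show "polyfun n (int K) (\<lambda>x. F x - (\<Sum>\<mu>\<in>ball K. c \<mu> * Rt \<mu> x))"
      by (intro polyfun_diff F(1) polyfun_sum polyfun_cmult)
    show "Winv n (\<lambda>x. F x - (\<Sum>\<mu>\<in>ball K. c \<mu> * Rt \<mu> x))"
      by (intro Winv_diff F(2) Winv_sum Winv_mult Winv_const Winv_Rt) (simp add: ball_def)
    fix \<mu> assume "\<mu> \<in> Lam n" "int (odd_size n \<mu>) \<le> int K"
    then show "F (pt \<mu>) - (\<Sum>\<kappa>\<in>ball K. c \<kappa> * Rt \<kappa> (pt \<mu>)) = 0"
      using c[of \<mu>] by (simp add: ball_def)
  qed
  then show ?thesis using that[of c] by simp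
qed

text \<open>Where F vanishes at all points of size below s, unitriangularity kills the lower
  coefficients size by size, and no correction to the value remains.\<close>

lemma Rt_coeff_at:
  assumes F: "\<And>\<kappa>. \<kappa> \<in> ball K \<Longrightarrow> F (pt \<kappa>) = (\<Sum>\<mu>\<in>ball K. c \<mu> * Rt \<mu> (pt \<kappa>))"
    and van: "\<And>\<kappa>. \<kappa> \<in> ball K \<Longrightarrow> odd_size n \<kappa> < s \<Longrightarrow> F (pt \<kappa>) = 0"
    and \<kappa>: "\<kappa> \<in> ball K" "odd_size n \<kappa> \<le> s"
  shows "c \<kappa> = F (pt \<kappa>)"
  using \<kappa>
proof (induction "odd_size n \<kappa>" arbitrary: \<kappa> rule: less_induct)
  case less
  have "(\<Sum>\<mu>\<in>{\<mu> \<in> Lam n. odd_size n \<mu> < odd_size n \<kappa>}. c \<mu> * Rt \<mu> (pt \<kappa>)) = 0"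
  proof (rule sum.neutral, rule ballI)
    fix \<mu> assume \<mu>: "\<mu> \<in> {\<mu> \<in> Lam n. odd_size n \<mu> < odd_size n \<kappa>}"
    then have "\<mu> \<in> ball K" "odd_size n \<mu> < s" using less.prems by (auto simp: ball_def)
    then have "c \<mu> = 0" using less.hyps[of \<mu>] van[of \<mu>] \<mu> by simp
    then show "c \<mu> * Rt \<mu> (pt \<kappa>) = 0" by simp
  qed
  then show ?case using F[OF less.prems(1)] sum_Rt_at[OF less.prems(1), of c] by simp
qed

lemma Rt_independent:
  assumes "\<And>x. (\<Sum>\<mu>\<in>ball K. c \<mu> * Rt \<mu> x) = (\<Sum>\<mu>\<in>ball K. c' \<mu> * Rt \<mu> x)" "\<kappa> \<in> ball K"
  shows "c \<kappa> = c' \<kappa>"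
proof -
  have "c \<kappa> - c' \<kappa> = (\<lambda>_. 0) (pt \<kappa>)"
    using assms
    by (intro Rt_coeff_at[where K = K and s = K and c = "\<lambda>\<mu>. c \<mu> - c' \<mu>"])
      (auto simp: left_diff_distrib sum_subtractf ball_def)
  then show ?thesis by simp
qed

lemma h_times_Rt:
  assumes l: "l \<in> Lam n" and K: "odd_size n l + 1 \<le> K"
  shows "h x * Rt l x = of_nat (odd_size n l) * Rt l x + (\<Sum>\<mu>\<in>ball K. A \<mu> l * Rt \<mu> x)"
proof -
  let ?d = "odd_size n l"
  let ?F = "\<lambda>x. (h x - of_nat ?d) * Rt l x"
  have "polyfun n (1 + int ?d) ?F"
    by (intro polyfun_mult polyfun_diff polyfun_h polyfun.const polyfun_Rt l) simp
  then have "polyfun n (int (?d + 1)) ?F" by (simp add: add.commute)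
  moreover have "Winv n ?F" by (intro Winv_mult Winv_diff Winv_h Winv_const Winv_Rt l)
  ultimately obtain c where c: "\<And>x. ?F x = (\<Sum>\<mu>\<in>ball (?d + 1). c \<mu> * Rt \<mu> x)"
    using Rt_expansion[of "?d + 1" ?F] by blast
  have low: "?F (pt \<kappa>) = 0" if "\<kappa> \<in> Lam n" "odd_size n \<kappa> < ?d + 1" for \<kappa>
    using Rt_vanish[OF l that(1)] that(2) by (cases "\<kappa> = l") (auto simp: h_pt)
  have cA: "c \<mu> = A \<mu> l" if \<mu>: "\<mu> \<in> ball (?d + 1)" for \<mu>
  proof -
    have "c \<mu> = ?F (pt \<mu>)"
      by (rule Rt_coeff_at[where F = ?F and s = "?d + 1", OF c _ \<mu>]) (use low \<mu> in \<open>auto simp: ball_def\<close>)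
    also have "\<dots> = A \<mu> l"
      using \<mu> low[of \<mu>] by (cases "odd_size n \<mu> = ?d + 1") (auto simp: A_def h_pt ball_def)
    finally show ?thesis .
  qed
  have "(\<Sum>\<mu>\<in>ball K. A \<mu> l * Rt \<mu> x) = (\<Sum>\<mu>\<in>ball (?d + 1). A \<mu> l * Rt \<mu> x)"
    by (rule sum.mono_neutral_right[OF finite_ball]) (use K in \<open>auto simp: ball_def A_def\<close>)
  also have "\<dots> = ?F x" unfolding c by (rule sum.cong) (simp_all add: cA)
  finally show ?thesis by (simp add: algebra_simps)
qed

text \<open>The diagonal form in low size holds because F * \<open>Rt \<nu>\<close> vanishes at the
  other points of size at most that of \<nu>. The last identity compares coefficients in F * (h *
  \<open>Rt \<nu>\<close>) = h * (F * \<open>Rt \<nu>\<close>), with \<open>h\<close> acting as the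
  sizes plus \<open>A\<close>.\<close>

lemma multiplication_matrix:
  assumes F: "polyfun n (int D) F" "Winv n F"
  obtains M where
    "\<And>\<nu> x. \<nu> \<in> Lam n \<Longrightarrow> F x * Rt \<nu> x = (\<Sum>\<mu>\<in>ball (odd_size n \<nu> + D). M \<mu> \<nu> * Rt \<mu> x)"
    "\<And>\<mu> \<nu>. odd_size n \<nu> + D < odd_size n \<mu> \<Longrightarrow> M \<mu> \<nu> = 0"
    "\<And>\<mu> \<nu>. \<mu> \<in> Lam n \<Longrightarrow> \<nu> \<in> Lam n \<Longrightarrow> odd_size n \<mu> \<le> odd_size n \<nu> \<Longrightarrow> M \<mu> \<nu> = (if \<mu> = \<nu> then F (pt \<nu>) else 0)"
    "\<And>\<kappa> \<nu>. \<kappa> \<in> Lam n \<Longrightarrow> \<nu> \<in> Lam n \<Longrightarrow> odd_size n \<nu> \<le> odd_size n \<kappa> \<Longrightarrow>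
      of_nat (odd_size n \<kappa> - odd_size n \<nu>) * M \<kappa> \<nu>
      = (\<Sum>\<mu>\<in>ball (odd_size n \<nu> + 1). M \<kappa> \<mu> * A \<mu> \<nu>) - (\<Sum>\<mu>\<in>ball (odd_size n \<kappa>). A \<kappa> \<mu> * M \<mu> \<nu>)"
proof -
  have "\<forall>\<nu>\<in>Lam n. \<exists>c. \<forall>x. F x * Rt \<nu> x = (\<Sum>\<mu>\<in>ball (odd_size n \<nu> + D). c \<mu> * Rt \<mu> x)"
  proof
    fix \<nu> assume \<nu>: "\<nu> \<in> Lam n"
    have "polyfun n (int (odd_size n \<nu> + D)) (\<lambda>x. F x * Rt \<nu> x)"
      using polyfun_mult[OF F(1) polyfun_Rt[OF \<nu>]] by (simp add: add.commute)
    from Rt_expansion[OF this Winv_mult[OF F(2) Winv_Rt[OF \<nu>]]]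
    show "\<exists>c. \<forall>x. F x * Rt \<nu> x = (\<Sum>\<mu>\<in>ball (odd_size n \<nu> + D). c \<mu> * Rt \<mu> x)" by metis
  qed
  from bchoice[OF this] obtain c
    where c: "\<And>\<nu> x. \<nu> \<in> Lam n \<Longrightarrow> F x * Rt \<nu> x = (\<Sum>\<mu>\<in>ball (odd_size n \<nu> + D). c \<nu> \<mu> * Rt \<mu> x)"
    by blast
  define M where "M \<mu> \<nu> = (if odd_size n \<mu> \<le> odd_size n \<nu> + D then c \<nu> \<mu> else 0)" for \<mu> \<nu>
  have M0: "M \<mu> \<nu> = 0" if "odd_size n \<nu> + D < odd_size n \<mu>" for \<mu> \<nu> using that by (simp add: M_def)
  have M: "F x * Rt \<nu> x = (\<Sum>\<mu>\<in>ball K. M \<mu> \<nu> * Rt \<mu> x)" if "\<nu> \<in> Lam n" "odd_size n \<nu> + D \<le> K" for \<nu> x K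
  proof -
    have "F x * Rt \<nu> x = (\<Sum>\<mu>\<in>ball (odd_size n \<nu> + D). M \<mu> \<nu> * Rt \<mu> x)"
      unfolding c[OF that(1)] by (rule sum.cong) (auto simp: M_def ball_def)
    also have "\<dots> = (\<Sum>\<mu>\<in>ball K. M \<mu> \<nu> * Rt \<mu> x)"
      by (rule sum.mono_neutral_left[OF finite_ball]) (use that(2) in \<open>auto simp: ball_def M_def\<close>)
    finally show ?thesis .
  qed
  have M_diag: "M \<mu> \<nu> = (if \<mu> = \<nu> then F (pt \<nu>) else 0)"
    if \<mu>: "\<mu> \<in> Lam n" and \<nu>: "\<nu> \<in> Lam n" and le: "odd_size n \<mu> \<le> odd_size n \<nu>" for \<mu> \<nu>
  proof -
    have "M \<mu> \<nu> = F (pt \<mu>) * Rt \<nu> (pt \<mu>)"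
    proof (rule Rt_coeff_at[where F = "\<lambda>x. F x * Rt \<nu> x" and K = "odd_size n \<nu> + D" and s = "odd_size n \<nu>", OF M[OF \<nu> order_refl]])
      fix \<kappa> assume "\<kappa> \<in> ball (odd_size n \<nu> + D)" "odd_size n \<kappa> < odd_size n \<nu>"
      then have "Rt \<nu> (pt \<kappa>) = 0" by (intro Rt_vanish \<nu>) (auto simp: ball_def)
      then show "F (pt \<kappa>) * Rt \<nu> (pt \<kappa>) = 0" by simp
    qed (use \<mu> le in \<open>auto simp: ball_def\<close>)
    then show ?thesis using Rt_self[OF \<nu>] Rt_vanish[OF \<nu> \<mu> le] by auto
  qed
  have comm: "of_nat (odd_size n \<kappa> - odd_size n \<nu>) * M \<kappa> \<nu>
      = (\<Sum>\<mu>\<in>ball (odd_size n \<nu> + 1). M \<kappa> \<mu> * A \<mu> \<nu>) - (\<Sum>\<mu>\<in>ball (odd_size n \<kappa>). A \<kappa> \<mu> * M \<mu> \<nu>)"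
    if \<kappa>: "\<kappa> \<in> Lam n" and \<nu>: "\<nu> \<in> Lam n" and le: "odd_size n \<nu> \<le> odd_size n \<kappa>" for \<kappa> \<nu>
  proof -
    \<comment> \<open>Large enough for every basis function in the expansion of F * h *
      \<open>Rt \<nu>\<close>, and for \<kappa> itself to lie in the ball.\<close>
    define K where "K = odd_size n \<kappa> + odd_size n \<nu> + D + 1"
    let ?l = "\<lambda>\<kappa>. of_nat (odd_size n \<nu>) * M \<kappa> \<nu> + (\<Sum>\<mu>\<in>ball K. M \<kappa> \<mu> * A \<mu> \<nu>)"
    let ?r = "\<lambda>\<kappa>. of_nat (odd_size n \<kappa>) * M \<kappa> \<nu> + (\<Sum>\<mu>\<in>ball K. A \<kappa> \<mu> * M \<mu> \<nu>)"
    have FA: "A \<mu> \<nu> * (F x * Rt \<mu> x) = A \<mu> \<nu> * (\<Sum>\<kappa>\<in>ball K. M \<kappa> \<mu> * Rt \<kappa> x)" if "\<mu> \<in> ball K" for \<mu> x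
      using that M[of \<mu> K x] by (cases "odd_size n \<mu> = odd_size n \<nu> + 1") (auto simp: A_def K_def ball_def)
    have hM: "M \<mu> \<nu> * (h x * Rt \<mu> x) = M \<mu> \<nu> * (of_nat (odd_size n \<mu>) * Rt \<mu> x + (\<Sum>\<kappa>\<in>ball K. A \<kappa> \<mu> * Rt \<kappa> x))"
      if "\<mu> \<in> ball K" for \<mu> x
      using that h_times_Rt[of \<mu> K x] by (cases "odd_size n \<mu> \<le> odd_size n \<nu> + D") (auto simp: M_def K_def ball_def)
    have "(\<Sum>\<kappa>\<in>ball K. ?l \<kappa> * Rt \<kappa> x) = (\<Sum>\<kappa>\<in>ball K. ?r \<kappa> * Rt \<kappa> x)" for x
    proof -
      have Fx: "F x * Rt \<nu> x = (\<Sum>\<mu>\<in>ball K. M \<mu> \<nu> * Rt \<mu> x)" by (rule M[OF \<nu>]) (simp add: K_def)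
      have "(\<Sum>\<kappa>\<in>ball K. (\<Sum>\<mu>\<in>ball K. M \<kappa> \<mu> * A \<mu> \<nu>) * Rt \<kappa> x)
          = (\<Sum>\<mu>\<in>ball K. A \<mu> \<nu> * (\<Sum>\<kappa>\<in>ball K. M \<kappa> \<mu> * Rt \<kappa> x))"
        unfolding sum_distrib_right sum_distrib_left by (subst sum.swap) (simp only: mult_ac)
      then have "(\<Sum>\<kappa>\<in>ball K. ?l \<kappa> * Rt \<kappa> x)
          = of_nat (odd_size n \<nu>) * (F x * Rt \<nu> x) + (\<Sum>\<mu>\<in>ball K. A \<mu> \<nu> * (\<Sum>\<kappa>\<in>ball K. M \<kappa> \<mu> * Rt \<kappa> x))"
        by (simp only: Fx distrib_right sum.distrib) (simp only: sum_distrib_left mult.assoc)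
      also have "\<dots> = of_nat (odd_size n \<nu>) * (F x * Rt \<nu> x) + (\<Sum>\<mu>\<in>ball K. A \<mu> \<nu> * (F x * Rt \<mu> x))"
        by (simp add: FA)
      also have "\<dots> = F x * (h x * Rt \<nu> x)"
      proof -
        have "h x * Rt \<nu> x = of_nat (odd_size n \<nu>) * Rt \<nu> x + (\<Sum>\<mu>\<in>ball K. A \<mu> \<nu> * Rt \<mu> x)"
          by (rule h_times_Rt[OF \<nu>]) (simp add: K_def)
        then show ?thesis by (simp add: distrib_left sum_distrib_left mult_ac)
      qed
      also have "\<dots> = h x * (F x * Rt \<nu> x)" by simp
      also have "\<dots> = (\<Sum>\<mu>\<in>ball K. M \<mu> \<nu> * (h x * Rt \<mu> x))"
        unfolding Fx by (simp add: sum_distrib_left mult_ac)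
      also have "\<dots> = (\<Sum>\<mu>\<in>ball K. M \<mu> \<nu> * (of_nat (odd_size n \<mu>) * Rt \<mu> x + (\<Sum>\<kappa>\<in>ball K. A \<kappa> \<mu> * Rt \<kappa> x)))"
        by (rule sum.cong) (simp_all only: hM)
      also have "\<dots> = (\<Sum>\<mu>\<in>ball K. of_nat (odd_size n \<mu>) * M \<mu> \<nu> * Rt \<mu> x)
          + (\<Sum>\<mu>\<in>ball K. \<Sum>\<kappa>\<in>ball K. A \<kappa> \<mu> * M \<mu> \<nu> * Rt \<kappa> x)"
        by (simp add: distrib_left sum.distrib sum_distrib_left mult_ac)
      also have "(\<Sum>\<mu>\<in>ball K. \<Sum>\<kappa>\<in>ball K. A \<kappa> \<mu> * M \<mu> \<nu> * Rt \<kappa> x) = (\<Sum>\<kappa>\<in>ball K. \<Sum>\<mu>\<in>ball K. A \<kappa> \<mu> * M \<mu> \<nu> * Rt \<kappa> x)"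
        by (rule sum.swap)
      finally show ?thesis by (simp add: distrib_right sum.distrib sum_distrib_right)
    qed
    then have eq: "?l \<kappa> = ?r \<kappa>"
      by (rule Rt_independent[where c = ?l and c' = ?r]) (use \<kappa> in \<open>auto simp: ball_def K_def\<close>)
    have "(\<Sum>\<mu>\<in>ball K. M \<kappa> \<mu> * A \<mu> \<nu>) = (\<Sum>\<mu>\<in>ball (odd_size n \<nu> + 1). M \<kappa> \<mu> * A \<mu> \<nu>)"
      by (rule sum.mono_neutral_right[OF finite_ball]) (auto simp: ball_def K_def A_def)
    moreover have "(\<Sum>\<mu>\<in>ball K. A \<kappa> \<mu> * M \<mu> \<nu>) = (\<Sum>\<mu>\<in>ball (odd_size n \<kappa>). A \<kappa> \<mu> * M \<mu> \<nu>)"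
      by (rule sum.mono_neutral_right[OF finite_ball]) (auto simp: ball_def K_def A_def)
    ultimately show ?thesis using eq le by (simp add: of_nat_diff algebra_simps)
  qed
  show ?thesis by (rule that[of M, OF M[OF _ order_refl] M0 M_diag comm])
qed

end

section \<open>The weight and the symmetry\<close>

text \<open>At \<open>x = \<rho> + l\<close> the weight is, up to a constant, a product of
  \<open>Gamma (x a - x b + r) / Gamma (x a - x b + 1 - r)\<close> over the pairs of opposite parity, of
  \<open>x a - x b\<close> over the pairs of equal parity, and of \<open>Gamma (x a + \<alpha>) / Gamma (x a + 1)\<close> over
  \<open>same_par n\<close>.\<close>

definition pair_weight :: "'a::field_char_0 \<Rightarrow> nat \<Rightarrow> nat \<Rightarrow> nat \<Rightarrow> 'a" where
  "pair_weight r a b N = (if a mod 2 = b mod 2 then of_nat (b - a) * r + of_nat N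
    else pochhammer (of_nat (b - a) * r + r) N / pochhammer (of_nat (b - a) * r + 1 - r) N)"

definition end_weight :: "nat \<Rightarrow> 'a::field_char_0 \<Rightarrow> 'a \<Rightarrow> nat \<Rightarrow> nat \<Rightarrow> 'a" where
  "end_weight n r \<alpha> a N = pochhammer (of_nat (n - a) * r + \<alpha>) N / pochhammer (of_nat (n - a) * r + 1) N"

definition all_pairs :: "nat \<Rightarrow> (nat \<times> nat) set" where
  "all_pairs n = {(a, b). a \<in> {1..n} \<and> b \<in> {1..n} \<and> a < b}"

definition weight :: "nat \<Rightarrow> 'a::field_char_0 \<Rightarrow> 'a \<Rightarrow> (nat \<Rightarrow> nat) \<Rightarrow> 'a" where
  "weight n r \<alpha> l = (- 1) ^ odd_size n l * ((\<Prod>(a, b)\<in>all_pairs n. pair_weight r a b (l a - l b))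
    * (\<Prod>a\<in>same_par n. end_weight n r \<alpha> a (l a)))"

lemma finite_all_pairs [simp]: "finite (all_pairs n)"
  by (rule finite_subset[of _ "{1..n} \<times> {1..n}"]) (auto simp: all_pairs_def)

locale semisym_shifted = semisym +
  fixes \<alpha> :: "'a::field_char_0"
  assumes \<alpha>: "\<And>a b :: nat. \<alpha> \<noteq> - of_nat a - of_nat b * (2 * r)"
begin

abbreviation np :: "(nat \<Rightarrow> nat) \<Rightarrow> nat \<Rightarrow> 'a" where
  "np l \<equiv> \<lambda>i. - lat n r \<alpha> l i"

section \<open>The weight and its difference equation\<close>

lemma opposite_denominator:
  assumes "a < b"
  shows "of_nat (b - a) * r + 1 - r + of_nat N \<noteq> 0"
proof -
  obtain m where m: "b - a = Suc m" using assms by (metis Suc_diff_Suc)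
  have eq: "of_nat (b - a) * r + 1 - r + of_nat N = of_nat m * r + of_nat (Suc N)"
    unfolding m by (simp add: algebra_simps)
  show ?thesis unfolding eq using lin_zero[of m "Suc N"] by blast
qed

lemma pair_weight_nonzero:
  assumes "a < b"
  shows "pair_weight r a b N \<noteq> 0"
proof (cases "a mod 2 = b mod 2")
  case True
  then show ?thesis using lin_zero[of "b - a" N] assms by (auto simp: pair_weight_def)
next
  case False
  have "of_nat (b - a) * r + r \<noteq> - of_nat k" for k
    using lin_zero[of "Suc (b - a)" k] by (auto simp: distrib_right eq_neg_iff_add_eq_0 add.commute)
  moreover have "of_nat (b - a) * r + 1 - r \<noteq> - of_nat k" for k
    using opposite_denominator[OF assms, of k] by (simp add: eq_neg_iff_add_eq_0)
  ultimately show ?thesis using False by (simp add: pair_weight_def pochhammer_eq_0_iff)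
qed

text \<open>For positions of the parity of n the number n - a is even; hence only multiples of 2 r
  occur among the values forbidden to \<alpha>.\<close>

lemma end_weight_nonzero:
  assumes "a \<in> same_par n"
  shows "end_weight n r \<alpha> a N \<noteq> 0"
proof -
  have "even (n - a)" using assms by (simp add: same_par_def even_diff_nat mod2_eq_if split: if_splits)
  then obtain m where "n - a = 2 * m" by (rule evenE)
  then have "of_nat (n - a) * r + \<alpha> \<noteq> - of_nat k" for k
    using \<alpha>[of k m] by (auto simp: algebra_simps eq_neg_iff_add_eq_0)
  moreover have "of_nat (n - a) * r + 1 \<noteq> - of_nat k" for k
    using lin_zero[of "n - a" "Suc k"] by (auto simp: eq_neg_iff_add_eq_0 algebra_simps)
  ultimately show ?thesis by (simp add: end_weight_def pochhammer_eq_0_iff)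
qed

lemma weight_nonzero: "weight n r \<alpha> l \<noteq> 0"
  unfolding weight_def mult_eq_0_iff prod_zero_iff[OF finite_all_pairs] prod_zero_iff[OF finite_same_par]
  using pair_weight_nonzero end_weight_nonzero by (auto simp: all_pairs_def)

text \<open>The weight of an unordered pair, addressable in either order: a step is indexed by pairs
  (a, b) with a in S and b outside, whichever is smaller.\<close>

definition cross_weight :: "(nat \<Rightarrow> nat) \<Rightarrow> nat \<times> nat \<Rightarrow> 'a" where
  "cross_weight l p = (if fst p < snd p then pair_weight r (fst p) (snd p) (l (fst p) - l (snd p))
    else pair_weight r (snd p) (fst p) (l (snd p) - l (fst p)))"

text \<open>A step changes N by one. For opposite parity the Pochhammer quotient then changes by u /
  v, while \<open>pair_factor\<close> is v at one of the two points and - u at the other. For equal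
  parity the weight is the difference itself and cancels the inverse. If b < a, then N decreases and
  the two points exchange roles.\<close>

lemma cross_weight_step:
  assumes l: "l \<in> Lam n" and k: "add_step S l \<in> Lam n" and S: "S \<in> steps n" and a: "a \<in> S" and b: "b \<in> {1..n} - S"
  shows "cross_weight (add_step S l) (a, b) * pair_factor r a b (pt (add_step S l) a - pt (add_step S l) b)
    = - (cross_weight l (a, b) * pair_factor r a b (np l a - np l b))"
proof -
  let ?k = "add_step S l"
  have an: "a \<in> {1..n}" using a steps_subset[OF S] by blast
  have kab: "?k a = Suc (l a)" "?k b = l b" using a b by (auto simp: add_step_def)
  consider "a < b" | "b < a" using a b by fastforce
  then show ?thesis
  proof cases
    case 1
    define s where "s = of_nat (b - a) * r"
    define N where "N = l a - l b"
    have "l b \<le> l a" using LamD[OF l, of a b] an b 1 by auto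
    then have kN: "?k a - ?k b = Suc N" by (simp add: kab N_def)
    have d1: "pt ?k a - pt ?k b = s + of_nat (Suc N)"
      using lat_diff[OF k, of a b r 0] an b 1 by (simp add: kN s_def)
    have d2: "np l a - np l b = - (s + of_nat N)"
      using lat_diff[OF l, of a b r \<alpha>] an b 1 by (simp add: N_def s_def algebra_simps)
    have nz: "s + of_nat (Suc N) \<noteq> 0" "s + of_nat N \<noteq> 0" "s + 1 - r + of_nat N \<noteq> 0"
      using lin_zero[of "b - a" "Suc N"] lin_zero[of "b - a" N] opposite_denominator[OF 1, of N] 1
      by (auto simp: s_def)
    have cw: "cross_weight ?k (a, b) = pair_weight r a b (Suc N)" "cross_weight l (a, b) = pair_weight r a b N"
      using 1 by (simp_all only: cross_weight_def fst_conv snd_conv if_True kN N_def)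
    show ?thesis
    proof (cases "a mod 2 = b mod 2")
      case True
      then have "pair_weight r a b m = s + of_nat m" for m
        by (simp only: pair_weight_def s_def simp_thms if_True)
      moreover have "pair_factor r a b u = inverse u" for u
        using True by (simp add: pair_factor_def)
      ultimately show ?thesis unfolding d1 d2 cw using nz(1,2) by (simp del: of_nat_Suc minus_add_distrib)
    next
      case False
      define P where "P = pochhammer (s + r) N"
      define Q where "Q = pochhammer (s + 1 - r) N"
      define u where "u = s + r + of_nat N"
      define v where "v = s + 1 - r + of_nat N"
      have "v \<noteq> 0" using nz(3) by (simp only: v_def not_False_eq_True)
      have pw: "pair_weight r a b m = pochhammer (s + r) m / pochhammer (s + 1 - r) m" for m
        by (simp only: pair_weight_def s_def False if_False)
      have "cross_weight ?k (a, b) = P * u / (Q * v)"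
        by (simp only: cw pw pochhammer_Suc P_def Q_def u_def v_def)
      moreover have "cross_weight l (a, b) = P / Q"
        by (simp only: cw pw P_def Q_def)
      moreover have "pair_factor r a b (s + of_nat (Suc N)) = v"
        "pair_factor r a b (- (s + of_nat N)) = - u"
        using False by (simp_all add: pair_factor_def u_def v_def)
      ultimately show ?thesis unfolding d1 d2 using \<open>v \<noteq> 0\<close> by (simp del: of_nat_Suc minus_add_distrib)
    qed
  next
    case 2
    define s where "s = of_nat (a - b) * r"
    define N where "N = ?k b - ?k a"
    have "?k a \<le> ?k b" using LamD[OF k, of b a] an b 2 by auto
    then have lN: "l b - l a = Suc N" by (simp add: kab N_def)
    have d1: "pt ?k a - pt ?k b = - (s + of_nat N)"
      using lat_diff[OF k, of b a r 0] an b 2 by (simp add: N_def s_def algebra_simps)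
    have d2: "np l a - np l b = s + of_nat (Suc N)"
      using lat_diff[OF l, of b a r \<alpha>] an b 2 by (simp add: lN s_def)
    have nz: "s + of_nat (Suc N) \<noteq> 0" "s + of_nat N \<noteq> 0" "s + 1 - r + of_nat N \<noteq> 0"
      using lin_zero[of "a - b" "Suc N"] lin_zero[of "a - b" N] opposite_denominator[OF 2, of N] 2
      by (auto simp: s_def)
    have "\<not> a < b" using 2 by simp
    then have cw: "cross_weight ?k (a, b) = pair_weight r b a N" "cross_weight l (a, b) = pair_weight r b a (Suc N)"
      by (simp_all only: cross_weight_def fst_conv snd_conv if_False lN N_def)
    show ?thesis
    proof (cases "a mod 2 = b mod 2")
      case True
      then have "pair_weight r b a m = s + of_nat m" for m
        by (simp only: pair_weight_def s_def simp_thms if_True)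
      moreover have "pair_factor r a b u = inverse u" for u
        using True by (simp add: pair_factor_def)
      ultimately show ?thesis unfolding d1 d2 cw using nz(1,2) by (simp del: of_nat_Suc minus_add_distrib)
    next
      case False
      define P where "P = pochhammer (s + r) N"
      define Q where "Q = pochhammer (s + 1 - r) N"
      define u where "u = s + r + of_nat N"
      define v where "v = s + 1 - r + of_nat N"
      have "v \<noteq> 0" using nz(3) by (simp only: v_def not_False_eq_True)
      have pw: "pair_weight r b a m = pochhammer (s + r) m / pochhammer (s + 1 - r) m" for m
        using False by (simp only: pair_weight_def s_def eq_commute[of "b mod 2"] if_False)
      have "cross_weight l (a, b) = P * u / (Q * v)"
        by (simp only: cw pw pochhammer_Suc P_def Q_def u_def v_def)
      moreover have "cross_weight ?k (a, b) = P / Q"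
        by (simp only: cw pw P_def Q_def)
      moreover have "pair_factor r a b (s + of_nat (Suc N)) = v"
        "pair_factor r a b (- (s + of_nat N)) = - u"
        using False by (simp_all add: pair_factor_def u_def v_def)
      ultimately show ?thesis unfolding d1 d2 using \<open>v \<noteq> 0\<close> by (simp del: of_nat_Suc minus_add_distrib)
    qed
  qed
qed

lemma end_weight_step:
  assumes "a \<in> S"
  shows "end_weight n r \<alpha> a (add_step S l a) * pt (add_step S l) a = - (end_weight n r \<alpha> a (l a) * np l a)"
proof -
  define u where "u = of_nat (n - a) * r + \<alpha> + of_nat (l a)"
  define v where "v = of_nat (n - a) * r + 1 + of_nat (l a)"
  have "v \<noteq> 0" using lin_zero[of "n - a" "Suc (l a)"] by (auto simp: v_def algebra_simps)
  moreover have "pt (add_step S l) a = v" "np l a = - u"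
    using assms by (simp_all add: lat_def add_step_def u_def v_def)
  moreover have "end_weight n r \<alpha> a (add_step S l a) = end_weight n r \<alpha> a (l a) * (u / v)"
    using assms by (simp add: end_weight_def add_step_def pochhammer_Suc u_def v_def)
  ultimately show ?thesis by simp
qed

text \<open>Pairs lying inside S or inside its complement keep their difference, so only the pairs
  across and the ends in S contribute, each with a sign change.\<close>

lemma weight_step:
  assumes l: "l \<in> Lam n" and k: "add_step S l \<in> Lam n" and S: "S \<in> steps n"
  shows "weight n r \<alpha> (add_step S l) * step_coef n r S (pt (add_step S l)) = weight n r \<alpha> l * step_coef n r S (np l)"
proof -
  let ?k = "add_step S l" and ?C = "S \<times> ({1..n} - S)" and ?T = "all_pairs n" and ?E = "S \<inter> same_par n"
  define g where "g p = (if fst p < snd p then p else (snd p, fst p))" for p :: "nat \<times> nat"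
  define rest where "rest m = (\<Prod>(a, b)\<in>?T - g ` ?C. pair_weight r a b (m a - m b))" for m
  have Sn: "S \<subseteq> {1..n}" and fin: "finite S" using steps_subset[OF S] finite_step[OF S] by auto
  have inj: "inj_on g ?C"
    by (auto simp: inj_on_def g_def split: if_splits)
  have gC: "g ` ?C \<subseteq> ?T"
    using Sn by (fastforce simp: g_def all_pairs_def not_less_iff_gr_or_eq)
  have split: "(\<Prod>(a, b)\<in>?T. pair_weight r a b (m a - m b)) = rest m * (\<Prod>p\<in>?C. cross_weight m p)" for m
  proof -
    have "(\<Prod>(a, b)\<in>g ` ?C. pair_weight r a b (m a - m b)) = (\<Prod>p\<in>?C. cross_weight m p)"
      unfolding prod.reindex[OF inj] by (rule prod.cong) (auto simp: g_def cross_weight_def)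
    then show ?thesis unfolding rest_def by (subst prod.subset_diff[OF gC]) simp_all
  qed
  have rest: "rest ?k = rest l"
    unfolding rest_def
  proof (rule prod.cong[OF refl], clarify)
    fix a b assume ab: "(a, b) \<in> ?T" "(a, b) \<notin> g ` ?C"
    have "a \<in> S \<longleftrightarrow> b \<in> S"
    proof (rule ccontr)
      assume "(a \<in> S) \<noteq> (b \<in> S)"
      then have "(a, b) \<in> ?C \<or> (b, a) \<in> ?C" using ab(1) by (auto simp: all_pairs_def)
      moreover have "g (a, b) = (a, b)" "g (b, a) = (a, b)" using ab(1) by (auto simp: g_def all_pairs_def)
      ultimately show False using ab(2) by (metis imageI)
    qed
    then show "pair_weight r a b (?k a - ?k b) = pair_weight r a b (l a - l b)"
      by (simp add: add_step_def)
  qed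
  have cross: "(\<Prod>p\<in>?C. cross_weight ?k p) * (\<Prod>(a, b)\<in>?C. pair_factor r a b (pt ?k a - pt ?k b))
      = (- 1) ^ card ?C * ((\<Prod>p\<in>?C. cross_weight l p) * (\<Prod>(a, b)\<in>?C. pair_factor r a b (np l a - np l b)))"
  proof -
    have "(\<Prod>p\<in>?C. cross_weight ?k p) * (\<Prod>(a, b)\<in>?C. pair_factor r a b (pt ?k a - pt ?k b))
        = (\<Prod>p\<in>?C. - 1 * (cross_weight l p * (case p of (a, b) \<Rightarrow> pair_factor r a b (np l a - np l b))))"
      unfolding prod.distrib[symmetric]
      by (rule prod.cong[OF refl]) (use cross_weight_step[OF l k S] in auto)
    also have "\<dots> = (\<Prod>p\<in>?C. - 1) * ((\<Prod>p\<in>?C. cross_weight l p) * (\<Prod>(a, b)\<in>?C. pair_factor r a b (np l a - np l b)))"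
      by (simp only: prod.distrib)
    finally show ?thesis by simp
  qed
  have ends: "(\<Prod>a\<in>same_par n. end_weight n r \<alpha> a (?k a)) * (\<Prod>a\<in>?E. pt ?k a)
      = (- 1) ^ card ?E * ((\<Prod>a\<in>same_par n. end_weight n r \<alpha> a (l a)) * (\<Prod>a\<in>?E. np l a))"
  proof -
    have sp: "(\<Prod>a\<in>same_par n. f a) = (\<Prod>a\<in>same_par n - ?E. f a) * (\<Prod>a\<in>?E. f a)" for f :: "nat \<Rightarrow> 'a"
      by (rule prod.subset_diff) auto
    have "(\<Prod>a\<in>same_par n - ?E. end_weight n r \<alpha> a (?k a)) = (\<Prod>a\<in>same_par n - ?E. end_weight n r \<alpha> a (l a))"
      by (rule prod.cong) (auto simp: add_step_def)
    moreover have "(\<Prod>a\<in>?E. end_weight n r \<alpha> a (?k a)) * (\<Prod>a\<in>?E. pt ?k a)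
        = (\<Prod>a\<in>?E. - 1 * (end_weight n r \<alpha> a (l a) * np l a))"
      unfolding prod.distrib[symmetric] by (rule prod.cong[OF refl]) (simp add: end_weight_step)
    then have "(\<Prod>a\<in>?E. end_weight n r \<alpha> a (?k a)) * (\<Prod>a\<in>?E. pt ?k a)
        = (- 1) ^ card ?E * ((\<Prod>a\<in>?E. end_weight n r \<alpha> a (l a)) * (\<Prod>a\<in>?E. np l a))"
      by (simp only: prod.distrib prod_constant)
    ultimately show ?thesis unfolding sp mult.assoc by (simp only: mult.left_commute)
  qed
  \<comment> \<open>By \<open>step_degree\<close> the number of sign changes is odd; the sign (- 1)
    ^ \<open>odd_size\<close> in \<open>weight\<close> supplies the compensating one.\<close>
  have "?C = {p \<in> ?C. fst p mod 2 = snd p mod 2} \<union> {p \<in> ?C. fst p mod 2 \<noteq> snd p mod 2}" by blast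
  then have "card ?C = card {p \<in> ?C. fst p mod 2 = snd p mod 2} + card {p \<in> ?C. fst p mod 2 \<noteq> snd p mod 2}"
    using fin by (subst card_Un_disjoint[symmetric]) auto
  then have "card ?C + card ?E = 2 * card {p \<in> ?C. fst p mod 2 = snd p mod 2} + 1"
    using step_degree[OF S] by linarith
  then have "odd (card ?C + card ?E)" by simp
  then have sign: "(- 1) ^ card ?C * (- 1) ^ card ?E = (- 1 :: 'a)"
    unfolding power_add[symmetric] by simp
  let ?wk = "\<Prod>p\<in>?C. cross_weight ?k p" and ?fk = "\<Prod>(a, b)\<in>?C. pair_factor r a b (pt ?k a - pt ?k b)"
  let ?ek = "\<Prod>a\<in>same_par n. end_weight n r \<alpha> a (?k a)" and ?xk = "\<Prod>a\<in>?E. pt ?k a"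
  let ?wl = "\<Prod>p\<in>?C. cross_weight l p" and ?fl = "\<Prod>(a, b)\<in>?C. pair_factor r a b (np l a - np l b)"
  let ?el = "\<Prod>a\<in>same_par n. end_weight n r \<alpha> a (l a)" and ?xl = "\<Prod>a\<in>?E. np l a"
  have "weight n r \<alpha> ?k * step_coef n r S (pt ?k)
      = (- 1) ^ (odd_size n l + 1) * rest l * ((?wk * ?fk) * (?ek * ?xk))"
    unfolding weight_def step_coef_def split rest odd_size_add_step[OF S] by (simp only: mult_ac)
  also have "\<dots> = (- 1) ^ (odd_size n l + 1) * rest l * (((- 1) ^ card ?C * (- 1) ^ card ?E) * ((?wl * ?fl) * (?el * ?xl)))"
    unfolding cross ends by (simp only: mult_ac)
  also have "\<dots> = (- 1) ^ odd_size n l * rest l * ((?wl * ?fl) * (?el * ?xl))"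
    unfolding sign by simp
  also have "\<dots> = weight n r \<alpha> l * step_coef n r S (np l)"
    unfolding weight_def step_coef_def split by (simp only: mult_ac)
  finally show ?thesis .
qed

section \<open>The bilinear form\<close>

definition V :: "(nat \<Rightarrow> nat) \<Rightarrow> (nat \<Rightarrow> nat) \<Rightarrow> 'a" where
  "V l \<nu> = weight n r \<alpha> \<nu> * Rt l (np \<nu>)"

abbreviation level :: "nat \<Rightarrow> (nat \<Rightarrow> nat) set" where
  "level s \<equiv> {l \<in> Lam n. odd_size n l = s}"

lemma finite_level: "finite (level s)"
  by (rule finite_subset[OF _ finite_Lam_le[of n s]]) auto

text \<open>The eigenfunction identity for \<open>Rt j\<close> at k, where \<open>h\<close> minus
  the size of j is 1. A step from k that stays in the lattice ends at the size of j, where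
  \<open>Rt j\<close> is 1 at j and 0 elsewhere.\<close>

lemma A_eq_step_coef:
  assumes k: "k \<in> Lam n" "odd_size n k = odd_size n j + 1" and j: "j \<in> Lam n"
  shows "A k j = (\<Sum>S\<in>steps n. if k = add_step S j then step_coef n r S (pt k) else 0)"
proof -
  have "A k j = (h (pt k) - of_nat (odd_size n j)) * Rt j (pt k)"
    by (simp add: A_def k(2) h_pt)
  also have "\<dots> = (\<Sum>S\<in>steps n. step_coef n r S (pt k) * Rt j (\<lambda>i. pt k i - (if i \<in> S then 1 else 0)))"
    by (rule eigenfunction[OF j regular_pt[OF k(1)], symmetric])
  also have "\<dots> = (\<Sum>S\<in>steps n. if k = add_step S j then step_coef n r S (pt k) else 0)"
  proof (rule sum.cong[OF refl])
    fix S assume S: "S \<in> steps n"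
    show "step_coef n r S (pt k) * Rt j (\<lambda>i. pt k i - (if i \<in> S then 1 else 0))
        = (if k = add_step S j then step_coef n r S (pt k) else 0)"
    proof (cases "k = add_step S j")
      case True
      show ?thesis unfolding True lat_add_step using Rt_self[OF j] by simp
    next
      case False
      show ?thesis
      proof (rule step_down_cases[OF k(1) S, where r = r])
        fix k' assume k': "k' \<in> Lam n" "k = add_step S k'"
        then have "Rt j (pt k') = 0"
          using k(2) False odd_size_add_step[OF S, of k'] by (intro Rt_vanish[OF j]) auto
        then show ?thesis using False unfolding k'(2) lat_add_step by simp
      qed (use False in simp)
    qed
  qed
  finally show ?thesis .
qed

text \<open>Both sides are the weighted value at \<open>np j\<close> of the difference operator
  applied to \<open>Rt i\<close>. The left one is so by \<open>h_times_Rt\<close> and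
  \<open>eigenfunction\<close>. For the right one \<open>weight_step\<close> moves the weight to the
  raised points, and \<open>step_up_boundary\<close> discards the steps out of \<Lambda>.\<close>

lemma V_self_adjoint:
  assumes i: "i \<in> Lam n" and j: "j \<in> Lam n"
  shows "(\<Sum>k\<in>level (odd_size n i + 1). A k i * V k j) = (\<Sum>k\<in>level (odd_size n j + 1). V i k * A k j)"
proof -
  let ?f = "\<lambda>S k. weight n r \<alpha> k * step_coef n r S (pt k) * Rt i (np k)"
  have "(\<Sum>k\<in>level (odd_size n i + 1). A k i * V k j)
      = weight n r \<alpha> j * (\<Sum>k\<in>level (odd_size n i + 1). A k i * Rt k (np j))"
    by (simp add: V_def sum_distrib_left mult_ac)
  also have "(\<Sum>k\<in>level (odd_size n i + 1). A k i * Rt k (np j))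
      = (\<Sum>k\<in>ball (odd_size n i + 1). A k i * Rt k (np j))"
    by (rule sum.mono_neutral_left[OF finite_ball]) (auto simp: ball_def A_def)
  also have "\<dots> = (h (np j) - of_nat (odd_size n i)) * Rt i (np j)"
    using h_times_Rt[OF i order_refl, of "np j"] by (simp add: algebra_simps)
  also have "\<dots> = (\<Sum>S\<in>steps n. step_coef n r S (np j) * Rt i (np (add_step S j)))"
    unfolding eigenfunction[OF i regular_neg_pt[OF j], symmetric] lat_neg_add_step ..
  also have "weight n r \<alpha> j * \<dots> = (\<Sum>S\<in>steps n. if add_step S j \<in> Lam n then ?f S (add_step S j) else 0)"
    unfolding sum_distrib_left
  proof (rule sum.cong[OF refl])
    fix S assume S: "S \<in> steps n"
    show "weight n r \<alpha> j * (step_coef n r S (np j) * Rt i (np (add_step S j)))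
        = (if add_step S j \<in> Lam n then ?f S (add_step S j) else 0)"
      using weight_step[OF j _ S] step_up_boundary[OF j S, of r \<alpha>]
      by (cases "add_step S j \<in> Lam n") (auto simp: mult.assoc[symmetric])
  qed
  also have "\<dots> = (\<Sum>S\<in>steps n. \<Sum>k\<in>level (odd_size n j + 1). if k = add_step S j then ?f S k else 0)"
  proof (rule sum.cong[OF refl])
    fix S assume S: "S \<in> steps n"
    show "(if add_step S j \<in> Lam n then ?f S (add_step S j) else 0)
        = (\<Sum>k\<in>level (odd_size n j + 1). if k = add_step S j then ?f S k else 0)"
      using odd_size_add_step[OF S, of j] finite_level by (simp add: sum.delta)
  qed
  also have "\<dots> = (\<Sum>k\<in>level (odd_size n j + 1). \<Sum>S\<in>steps n. if k = add_step S j then ?f S k else 0)"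
    by (rule sum.swap)
  also have "\<dots> = (\<Sum>k\<in>level (odd_size n j + 1). V i k * A k j)"
  proof (rule sum.cong[OF refl])
    fix k assume "k \<in> level (odd_size n j + 1)"
    then have "A k j = (\<Sum>S\<in>steps n. if k = add_step S j then step_coef n r S (pt k) else 0)"
      by (intro A_eq_step_coef j) auto
    then show "(\<Sum>S\<in>steps n. if k = add_step S j then ?f S k else 0) = V i k * A k j"
      by (simp add: V_def sum_distrib_left if_distrib mult_ac cong: if_cong)
  qed
  finally show ?thesis .
qed

lemma sum_levels:
  "(\<Sum>m\<le>D. \<Sum>k\<in>level (s + m). f k) = (\<Sum>k\<in>{k \<in> Lam n. s \<le> odd_size n k \<and> odd_size n k \<le> s + D}. f k)"
proof -
  have "{k \<in> Lam n. s \<le> odd_size n k \<and> odd_size n k \<le> s + D} = (\<Union>m\<in>{..D}. level (s + m))"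
    by (auto simp: le_iff_add)
  then show ?thesis using finite_level by (simp add: sum.UNION_disjoint disjoint_iff)
qed

lemma V_eq:
  assumes l: "l \<in> Lam n" and \<kappa>: "\<kappa> \<in> Lam n"
  shows "V l \<kappa> = Rt \<kappa> (np l) * V l (\<lambda>_. 0)"
proof -
  let ?D = "odd_size n \<kappa>" and ?o = "(\<lambda>_. 0) :: nat \<Rightarrow> nat"
  \<comment> \<open>The reflection z \<mapsto> - z - \<alpha> exchanges \<open>pt j\<close> and
    \<open>np j\<close>, which is the content of \<open>F_pt\<close> and
    \<open>F_np\<close>.\<close>
  define F where "F x = Rt \<kappa> (\<lambda>i. - x i - \<alpha>)" for x
  have F: "polyfun n (int ?D) F"
    unfolding F_def
    by (rule polyfun_subst[OF polyfun_Rt[OF \<kappa>]]) (intro polyfun_diff polyfun_uminus polyfun_var polyfun.const, simp_all)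
  have F_inv: "Winv n F"
    unfolding Winv_def
  proof (intro ballI allI)
    fix \<pi> and x :: "nat \<Rightarrow> 'a" assume "\<pi> \<in> parity_perms n"
    then have "Rt \<kappa> ((\<lambda>i. - x i - \<alpha>) \<circ> \<pi>) = Rt \<kappa> (\<lambda>i. - x i - \<alpha>)"
      using Winv_Rt[OF \<kappa>] by (simp add: Winv_def)
    then show "F (x \<circ> \<pi>) = F x" by (simp add: F_def o_def)
  qed
  have F_pt: "F (pt j) = Rt \<kappa> (np j)" for j
    unfolding F_def by (rule arg_cong[of _ _ "Rt \<kappa>"]) (simp add: fun_eq_iff lat_def)
  have F_np: "F (np j) = Rt \<kappa> (pt j)" for j
    unfolding F_def by (rule arg_cong[of _ _ "Rt \<kappa>"]) (simp add: fun_eq_iff lat_def)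
  obtain M where M:
    "\<And>\<nu> x. \<nu> \<in> Lam n \<Longrightarrow> F x * Rt \<nu> x = (\<Sum>\<mu>\<in>ball (odd_size n \<nu> + ?D). M \<mu> \<nu> * Rt \<mu> x)"
    "\<And>\<mu> \<nu>. odd_size n \<nu> + ?D < odd_size n \<mu> \<Longrightarrow> M \<mu> \<nu> = 0"
    "\<And>\<mu> \<nu>. \<mu> \<in> Lam n \<Longrightarrow> \<nu> \<in> Lam n \<Longrightarrow> odd_size n \<mu> \<le> odd_size n \<nu> \<Longrightarrow> M \<mu> \<nu> = (if \<mu> = \<nu> then F (pt \<nu>) else 0)"
    "\<And>\<kappa> \<nu>. \<kappa> \<in> Lam n \<Longrightarrow> \<nu> \<in> Lam n \<Longrightarrow> odd_size n \<nu> \<le> odd_size n \<kappa> \<Longrightarrow>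
      of_nat (odd_size n \<kappa> - odd_size n \<nu>) * M \<kappa> \<nu>
      = (\<Sum>\<mu>\<in>ball (odd_size n \<nu> + 1). M \<kappa> \<mu> * A \<mu> \<nu>) - (\<Sum>\<mu>\<in>ball (odd_size n \<kappa>). A \<kappa> \<mu> * M \<mu> \<nu>)"
    by (rule multiplication_matrix[OF F F_inv]) blast
  obtain N where N:
    "\<And>\<nu> x. \<nu> \<in> Lam n \<Longrightarrow> Rt \<kappa> x * Rt \<nu> x = (\<Sum>\<mu>\<in>ball (odd_size n \<nu> + ?D). N \<mu> \<nu> * Rt \<mu> x)"
    "\<And>\<mu> \<nu>. odd_size n \<nu> + ?D < odd_size n \<mu> \<Longrightarrow> N \<mu> \<nu> = 0"
    "\<And>\<mu> \<nu>. \<mu> \<in> Lam n \<Longrightarrow> \<nu> \<in> Lam n \<Longrightarrow> odd_size n \<mu> \<le> odd_size n \<nu> \<Longrightarrow> N \<mu> \<nu> = (if \<mu> = \<nu> then Rt \<kappa> (pt \<nu>) else 0)"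
    "\<And>\<kappa> \<nu>. \<kappa> \<in> Lam n \<Longrightarrow> \<nu> \<in> Lam n \<Longrightarrow> odd_size n \<nu> \<le> odd_size n \<kappa> \<Longrightarrow>
      of_nat (odd_size n \<kappa> - odd_size n \<nu>) * N \<kappa> \<nu>
      = (\<Sum>\<mu>\<in>ball (odd_size n \<nu> + 1). N \<kappa> \<mu> * A \<mu> \<nu>) - (\<Sum>\<mu>\<in>ball (odd_size n \<kappa>). A \<kappa> \<mu> * N \<mu> \<nu>)"
    by (rule multiplication_matrix[OF polyfun_Rt[OF \<kappa>] Winv_Rt[OF \<kappa>]]) blast
  have comm: "of_nat (Suc m) * X i j = (\<Sum>k\<in>level (odd_size n j + 1). X i k * A k j) - (\<Sum>k\<in>level (odd_size n j + m). A i k * X k j)"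
    if X: "\<And>\<kappa> \<nu>. \<kappa> \<in> Lam n \<Longrightarrow> \<nu> \<in> Lam n \<Longrightarrow> odd_size n \<nu> \<le> odd_size n \<kappa> \<Longrightarrow>
      of_nat (odd_size n \<kappa> - odd_size n \<nu>) * X \<kappa> \<nu>
      = (\<Sum>\<mu>\<in>ball (odd_size n \<nu> + 1). X \<kappa> \<mu> * A \<mu> \<nu>) - (\<Sum>\<mu>\<in>ball (odd_size n \<kappa>). A \<kappa> \<mu> * X \<mu> \<nu>)"
      and ij: "i \<in> Lam n" "j \<in> Lam n" "odd_size n i = odd_size n j + Suc m" for X :: "_ \<Rightarrow> _ \<Rightarrow> 'a" and i j m
  proof -
    have "(\<Sum>\<mu>\<in>ball (odd_size n j + 1). X i \<mu> * A \<mu> j) = (\<Sum>k\<in>level (odd_size n j + 1). X i k * A k j)"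
      by (rule sum.mono_neutral_right[OF finite_ball]) (auto simp: ball_def A_def)
    moreover have "(\<Sum>\<mu>\<in>ball (odd_size n i). A i \<mu> * X \<mu> j) = (\<Sum>k\<in>level (odd_size n j + m). A i k * X k j)"
      by (rule sum.mono_neutral_right[OF finite_ball]) (auto simp: ball_def A_def ij(3))
    ultimately show ?thesis using X[OF ij(1,2)] ij(3) by simp
  qed
  have "(\<Sum>m\<le>?D. \<Sum>k\<in>level (odd_size n ?o + m). V l k * N k ?o) = (\<Sum>k\<in>level (odd_size n l). M k l * V k ?o)"
  proof (rule graded_transposition[where A = A and sz = "odd_size n" and I = "Lam n", OF finite_level V_self_adjoint])
    show "M i j = 0" if "odd_size n i = odd_size n j + Suc ?D" for i j
      using M(2)[of j i] that by simp
    \<comment> \<open>Up to the weight, V evaluates its first argument at \<open>np j\<close>, and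
      there F has the value of \<open>Rt \<kappa>\<close> at \<open>pt j\<close>, the diagonal entry
      of N.\<close>
    show "(\<Sum>m\<le>?D. \<Sum>k\<in>level (odd_size n i + m). M k i * V k j) = (\<Sum>k\<in>level (odd_size n j). V i k * N k j)"
      if i: "i \<in> Lam n" and j: "j \<in> Lam n" for i j
    proof -
      have "(\<Sum>m\<le>?D. \<Sum>k\<in>level (odd_size n i + m). M k i * V k j) = (\<Sum>k\<in>ball (odd_size n i + ?D). M k i * V k j)"
        unfolding sum_levels
      proof (rule sum.mono_neutral_left[OF finite_ball])
        show "\<forall>k\<in>ball (odd_size n i + ?D) - {k \<in> Lam n. odd_size n i \<le> odd_size n k \<and> odd_size n k \<le> odd_size n i + ?D}. M k i * V k j = 0"
        proof
          fix k assume "k \<in> ball (odd_size n i + ?D) - {k \<in> Lam n. odd_size n i \<le> odd_size n k \<and> odd_size n k \<le> odd_size n i + ?D}"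
          then have "k \<in> Lam n" "odd_size n k < odd_size n i" by (auto simp: ball_def)
          then have "M k i = 0" using M(3)[of k i] i by auto
          then show "M k i * V k j = 0" by simp
        qed
      qed (auto simp: ball_def)
      also have "\<dots> = weight n r \<alpha> j * (F (np j) * Rt i (np j))"
        unfolding M(1)[OF i] by (simp add: V_def sum_distrib_left mult_ac)
      also have "\<dots> = V i j * Rt \<kappa> (pt j)" by (simp add: V_def F_np)
      also have "\<dots> = (\<Sum>k\<in>level (odd_size n j). if k = j then V i j * Rt \<kappa> (pt j) else 0)"
        using finite_level j by (simp add: sum.delta)
      also have "\<dots> = (\<Sum>k\<in>level (odd_size n j). V i k * N k j)"
        by (rule sum.cong) (use N(3)[OF _ j] in auto)
      finally show ?thesis .
    qed
  qed (use l zero_in_Lam comm[OF M(4)] comm[OF N(4)] in auto)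
  moreover have "(\<Sum>k\<in>level (odd_size n l). M k l * V k ?o) = Rt \<kappa> (np l) * V l ?o"
  proof -
    have "(\<Sum>k\<in>level (odd_size n l). M k l * V k ?o) = (\<Sum>k\<in>level (odd_size n l). if k = l then F (pt l) * V l ?o else 0)"
      by (rule sum.cong) (use M(3)[OF _ l] in auto)
    then show ?thesis using finite_level l by (simp add: sum.delta F_pt)
  qed
  moreover have "(\<Sum>m\<le>?D. \<Sum>k\<in>level (odd_size n ?o + m). V l k * N k ?o) = V l \<kappa>"
  proof -
    \<comment> \<open>The zero partition stands for the constant function 1, so column 0 of N is the
      expansion of \<open>Rt \<kappa>\<close> itself, a unit vector.\<close>
    have N0: "N \<mu> ?o = (if \<mu> = \<kappa> then 1 else 0)" if "\<mu> \<in> ball ?D" for \<mu>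
    proof (rule Rt_independent[OF _ that])
      fix x
      have "(\<Sum>\<mu>\<in>ball ?D. N \<mu> ?o * Rt \<mu> x) = Rt \<kappa> x"
        using N(1)[OF zero_in_Lam, of x] by (simp add: Rt_zero odd_size_0)
      also have "\<dots> = (\<Sum>\<mu>\<in>ball ?D. if \<mu> = \<kappa> then Rt \<kappa> x else 0)"
        using \<kappa> by (subst sum.delta[OF finite_ball]) (simp add: ball_def)
      also have "\<dots> = (\<Sum>\<mu>\<in>ball ?D. (if \<mu> = \<kappa> then 1 else 0) * Rt \<mu> x)"
        by (rule sum.cong) auto
      finally show "(\<Sum>\<mu>\<in>ball ?D. N \<mu> ?o * Rt \<mu> x) = (\<Sum>\<mu>\<in>ball ?D. (if \<mu> = \<kappa> then 1 else 0) * Rt \<mu> x)" .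
    qed
    have "(\<Sum>m\<le>?D. \<Sum>k\<in>level (odd_size n ?o + m). V l k * N k ?o) = (\<Sum>k\<in>ball ?D. V l k * N k ?o)"
      unfolding sum_levels odd_size_0 by (rule sum.cong) (auto simp: ball_def)
    also have "\<dots> = (\<Sum>k\<in>ball ?D. if k = \<kappa> then V l \<kappa> else 0)"
      by (rule sum.cong) (auto simp: N0)
    also have "\<dots> = V l \<kappa>" using \<kappa> by (subst sum.delta[OF finite_ball]) (simp add: ball_def)
    finally show ?thesis .
  qed
  ultimately show ?thesis by simp
qed

lemma
  assumes l: "l \<in> Lam n" and \<nu>: "\<nu> \<in> Lam n"
  shows Rt_origin_nonzero: "Rt l (np (\<lambda>_. 0)) \<noteq> 0"
    and Rt_symmetry: "Rt l (np \<nu>) * Rt \<nu> (np (\<lambda>_. 0)) = Rt \<nu> (np l) * Rt l (np (\<lambda>_. 0))"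
proof -
  let ?o = "(\<lambda>_. 0) :: nat \<Rightarrow> nat" and ?w = "weight n r \<alpha>"
  have w: "?w \<kappa> = Rt \<kappa> (np ?o) * ?w ?o" if "\<kappa> \<in> Lam n" for \<kappa>
    using V_eq[OF zero_in_Lam that] by (simp add: V_def Rt_zero)
  show "Rt l (np ?o) \<noteq> 0" using w[OF l] weight_nonzero[of l] by auto
  have "?w \<nu> * Rt l (np \<nu>) = Rt \<nu> (np l) * (?w ?o * Rt l (np ?o))"
    using V_eq[OF l \<nu>] by (simp add: V_def)
  then have "?w ?o * (Rt l (np \<nu>) * Rt \<nu> (np ?o)) = ?w ?o * (Rt \<nu> (np l) * Rt l (np ?o))"
    unfolding w[OF \<nu>] by (simp only: mult_ac)
  then show "Rt l (np \<nu>) * Rt \<nu> (np ?o) = Rt \<nu> (np l) * Rt l (np ?o)"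
    using weight_nonzero[of ?o] by simp
qed

end

theorem corollary7p4:
  fixes n :: nat and r \<alpha> :: "'a::field_char_0"
  assumes "n \<ge> 1"
    and "\<And>q::rat. q < 0 \<Longrightarrow> r \<noteq> of_rat q"
    and "r \<noteq> 0"
    and "\<And>a b :: nat. \<alpha> \<noteq> - of_nat a - of_nat b * (2 * r)"
  shows "\<forall>l\<in>Lam n. \<forall>\<nu>\<in>Lam n.
    eval_poly (\<lambda>i. - rho_shift n r \<alpha> i - of_nat (\<nu> i)) (R_poly n r l)
        / eval_poly (\<lambda>i. - rho_shift n r \<alpha> i) (R_poly n r l)
    = eval_poly (\<lambda>i. - rho_shift n r \<alpha> i - of_nat (l i)) (R_poly n r \<nu>)
        / eval_poly (\<lambda>i. - rho_shift n r \<alpha> i) (R_poly n r \<nu>)"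
proof (intro ballI)
  interpret semisym_shifted n r \<alpha> by unfold_locales (use assms in auto)
  fix l \<nu> assume l: "l \<in> Lam n" and \<nu>: "\<nu> \<in> Lam n"
  have shift: "(\<lambda>i. - rho_shift n r \<alpha> i - of_nat (\<mu> i)) = np \<mu>" for \<mu>
    by (simp add: fun_eq_iff rho_shift_def rho_def lat_def)
  have shift0: "(\<lambda>i. - rho_shift n r \<alpha> i) = np (\<lambda>_. 0)"
    by (simp add: fun_eq_iff rho_shift_def rho_def lat_def)
  have ratio: "eval_poly x (R_poly n r \<mu>) / eval_poly y (R_poly n r \<mu>) = Rt \<mu> x / Rt \<mu> y"
    if "\<mu> \<in> Lam n" for \<mu> x y
    using R_nonzero[OF that] by (simp add: Rt_def)
  show "eval_poly (\<lambda>i. - rho_shift n r \<alpha> i - of_nat (\<nu> i)) (R_poly n r l)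
        / eval_poly (\<lambda>i. - rho_shift n r \<alpha> i) (R_poly n r l)
    = eval_poly (\<lambda>i. - rho_shift n r \<alpha> i - of_nat (l i)) (R_poly n r \<nu>)
        / eval_poly (\<lambda>i. - rho_shift n r \<alpha> i) (R_poly n r \<nu>)"
    unfolding shift shift0 ratio[OF l] ratio[OF \<nu>]
    using Rt_symmetry[OF l \<nu>] Rt_origin_nonzero[OF l l] Rt_origin_nonzero[OF \<nu> \<nu>]
    by (simp add: frac_eq_eq)
qed

end
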